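(* Let $\mathcal C_C=(\mathcal C,1_{\mathcal C},\underline M,K)$ be a homotopy probability algebra admitting an expectation $\mathfrak c$, and let $H$ be the cohomology of $(\mathcal C,K)$ with $1_H=[1_{\mathcal C}]\neq0$. Then there exists a unital $sL_\infty$-morphism $\underline\varphi:(H,1_H,\underline0)\to(\mathcal C,1_{\mathcal C},\underline\ell^K)$ whose first component $\varphi_1:(H,0)\to(\mathcal C,K)$ is a cochain quasi-isomorphism (inducing the identity on cohomology). That is, the descendant unital $sL_\infty$-algebra $(\mathcal C,1_{\mathcal C},\underline\ell^K)$ is quasi-isomorphic to its cohomology with the zero $sL_\infty$-structure.
   Context: Conventions: $\Bbbk$ is a field of characteristic zero; vector spaces are $\mathbb Z$-graded. $P(n)$ is the set of partitions of $[n]$, written $\pi=B_1\sqcup\dots\sqcup B_{|\pi|}$ with blocks ordered by increasing maximal element, each block increasing. For $B=\{j_1<\dots<j_r\}$, $f(x_B)=f_r(x_{j_1},\dots,x_{j_r})$, $|x_B|=\sum_{j\in B}|x_j|$. $\epsilon(\pi)$ is the Koszul sign of rearranging $x_1\otimes\dots\otimes x_n$ into $x_{B_1}\otimes\dots\otimes x_{B_{|\pi|}}$; $\epsilon(\pi,i)=\epsilon(\pi)(-1)^{|x_{B_1}|+\dots+|x_{B_{i-1}}|}$. A sum "over $\pi\in P(n)$, $|B_i|=n-|\pi|+1$" ranges over pairs $(\pi,i)$ with all blocks other than $B_i$ singletons. A unital $sL_\infty$-algebra $(V,1_V,\underline\ell)$: $1_V\in V^0$, degree-$1$ $\ell_n:S^nV\to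 V$ with $\sum_{\pi\in P(n),|B_i|=n-|\pi|+1}\epsilon(\pi,i)\ell_{|\pi|}(x_{B_1},\dots,\ell(x_{B_i}),\dots,x_{B_{|\pi|}})=0$ and $\ell_n(x_1,\dots,x_{n-1},1_V)=0$. A unital $sL_\infty$-morphism: degree-$0$ $\phi_n:S^nV\to V'$ with $\sum_{\pi\in P(n)}\epsilon(\pi)\ell'_{|\pi|}(\phi(x_{B_1}),\dots,\phi(x_{B_{|\pi|}}))=\sum_{\pi\in P(n),|B_i|=n-|\pi|+1}\epsilon(\pi,i)\phi_{|\pi|}(x_{B_1},\dots,\ell(x_{B_i}),\dots,x_{B_{|\pi|}})$, $\phi_1(1_V)=1_{V'}$, $\phi_k(x_1,\dots,x_{k-1},1_V)=0$ for $k\ge2$. Homotopy probability algebra $(\mathcal C,1_{\mathcal C},\underline M,K)$: $1_{\mathcal C}\in\mathcal C^0$; degree-$0$ $M_n:S^n\mathcal C\to\mathcal C$, $M_1=\mathrm{id}$, $M_{n+1}(x_1..x_n,1_{\mathcal C})=M_n(x_1..x_n)$; $K$ degree $1$, $K^2=0$, $K1_{\mathcal C}=0$, $1_{\mathcal C}\notin\operatorname{im}K$. An expectation is a degree-$0$ linear $\mathfrak c:\mathcal C\to\Bbbk$ with $\mathfrak c(1_{\mathcal C})=1$, $\mathfrak c\circ K=0$. Descendant $\ell^K_n$ (degree 1): recursively $KM_n(x_1..x_n)=\sum_{\pi\in P(n),|B_i|=n-|\pi|+1}\epsilon(\pi,i)M_{|\pi|}(x_{B_1},\dots,\ell^K(x_{B_i}),\dots,x_{B_{|\pi|}})$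 (so $\ell^K_1=K$). *)

theory Defs
  imports Main "HOL.Vector_Spaces" "HOL-Library.Disjoint_Sets"
begin

definition graded_vs :: "('k::field \<Rightarrow> 'v::ab_group_add \<Rightarrow> 'v) \<Rightarrow> (int \<Rightarrow> 'v set) \<Rightarrow> bool" where
  "graded_vs sc G \<longleftrightarrow> vector_space sc \<and> (\<forall>i. module.subspace sc (G i))
     \<and> (\<forall>v. \<exists>I f. finite I \<and> (\<forall>i. f i \<in> G i) \<and> v = sum f I)
     \<and> (\<forall>I f. finite I \<and> (\<forall>i\<in>I. f i \<in> G i) \<and> sum f I = 0 \<longrightarrow> (\<forall>i\<in>I. f i = 0))"

definition graded_map :: "('k::field \<Rightarrow> 'v::ab_group_add \<Rightarrow> 'v) \<Rightarrow> (int \<Rightarrow> 'v set)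
    \<Rightarrow> ('k \<Rightarrow> 'w::ab_group_add \<Rightarrow> 'w) \<Rightarrow> (int \<Rightarrow> 'w set) \<Rightarrow> int \<Rightarrow> ('v \<Rightarrow> 'w) \<Rightarrow> bool" where
  "graded_map sc G sc' G' k f \<longleftrightarrow> Vector_Spaces.linear sc sc' f \<and> (\<forall>i. \<forall>v\<in>G i. f v \<in> G' (i + k))"

definition homog :: "(int \<Rightarrow> 'v set) \<Rightarrow> 'v list \<Rightarrow> int list \<Rightarrow> bool" where
  "homog G xs ds \<longleftrightarrow> length ds = length xs \<and> (\<forall>j<length xs. xs ! j \<in> G (ds ! j))"

definition ksign :: "int \<Rightarrow> int \<Rightarrow> int" where
  "ksign d e = (if even (d * e) then 1 else -1)"

definition swap_adj :: "nat \<Rightarrow> 'a list \<Rightarrow> 'a list" where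
  "swap_adj j xs = xs[j := xs ! Suc j, Suc j := xs ! j]"

text \<open>Families of maps S^n V \<rightarrow> W (n \<ge> 1) are encoded as one function on lists; the
  n-th component is the restriction to lists of length n.
  sym_map: the n-th component is multilinear, graded symmetric (Koszul sign rule) and of degree k.\<close>
definition sym_map :: "('k::field \<Rightarrow> 'v::ab_group_add \<Rightarrow> 'v) \<Rightarrow> (int \<Rightarrow> 'v set)
    \<Rightarrow> ('k \<Rightarrow> 'w::ab_group_add \<Rightarrow> 'w) \<Rightarrow> (int \<Rightarrow> 'w set) \<Rightarrow> int \<Rightarrow> nat \<Rightarrow> ('v list \<Rightarrow> 'w) \<Rightarrow> bool" where
  "sym_map sc G sc' G' k n f \<longleftrightarrow>
     (\<forall>xs j. length xs = n \<and> j < n \<longrightarrow> Vector_Spaces.linear sc sc' (\<lambda>v. f (xs[j := v])))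
   \<and> (\<forall>xs ds. length xs = n \<and> homog G xs ds \<longrightarrow> f xs \<in> G' (sum_list ds + k))
   \<and> (\<forall>xs ds j. length xs = n \<and> homog G xs ds \<and> Suc j < n \<longrightarrow>
        f (swap_adj j xs) = sc' (of_int (ksign (ds ! j) (ds ! Suc j))) (f xs))"

definition sym_family :: "('k::field \<Rightarrow> 'v::ab_group_add \<Rightarrow> 'v) \<Rightarrow> (int \<Rightarrow> 'v set)
    \<Rightarrow> ('k \<Rightarrow> 'w::ab_group_add \<Rightarrow> 'w) \<Rightarrow> (int \<Rightarrow> 'w set) \<Rightarrow> int \<Rightarrow> ('v list \<Rightarrow> 'w) \<Rightarrow> bool" where
  "sym_family sc G sc' G' k f \<longleftrightarrow> (\<forall>n\<ge>1. sym_map sc G sc' G' k n f)"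

definition ord_partitions :: "nat \<Rightarrow> nat set list set" where
  "ord_partitions n = {bs. partition_on {..<n} (set bs) \<and> sorted_wrt (\<lambda>A B. Max A < Max B) bs}"

definition sub :: "'a list \<Rightarrow> nat set \<Rightarrow> 'a list" where
  "sub xs B = map (\<lambda>j. xs ! j) (sorted_list_of_set B)"

definition bdeg :: "int list \<Rightarrow> nat set \<Rightarrow> int" where
  "bdeg ds B = (\<Sum>j\<in>B. ds ! j)"

text \<open>epsilon(pi): Koszul sign of the rearrangement x_1..x_n \<mapsto> x_{B_1}..x_{B_k}.\<close>
definition eps :: "int list \<Rightarrow> nat set list \<Rightarrow> int" where
  "eps ds bs = (let \<sigma> = concat (map sorted_list_of_set bs) in
     \<Prod>p\<in>{(a, b). a < b \<and> b < length \<sigma> \<and> \<sigma> ! b < \<sigma> ! a}.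
        ksign (ds ! (\<sigma> ! fst p)) (ds ! (\<sigma> ! snd p)))"

definition eps_i :: "int list \<Rightarrow> nat set list \<Rightarrow> nat \<Rightarrow> int" where
  "eps_i ds bs i = eps ds bs * (if even (\<Sum>j<i. bdeg ds (bs ! j)) then 1 else -1)"

text \<open>Argument list (x_{B_1},...,g(x_{B_i}),...,x_{B_k}) where all blocks except B_i are singletons.\<close>
definition inner_args :: "'v list \<Rightarrow> nat set list \<Rightarrow> nat \<Rightarrow> ('v list \<Rightarrow> 'v) \<Rightarrow> 'v list" where
  "inner_args xs bs i g =
     map (\<lambda>j. if j = i then g (sub xs (bs ! j)) else xs ! Min (bs ! j)) [0..<length bs]"

definition inner_sum :: "('k::field \<Rightarrow> 'w::ab_group_add \<Rightarrow> 'w) \<Rightarrow> int list \<Rightarrow> 'v list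
     \<Rightarrow> ('v list \<Rightarrow> 'w) \<Rightarrow> ('v list \<Rightarrow> 'v) \<Rightarrow> 'w" where
  "inner_sum sc ds xs F g =
     (\<Sum>p\<in>{(bs, i). bs \<in> ord_partitions (length xs) \<and> i < length bs
                   \<and> card (bs ! i) = length xs - length bs + 1}.
        sc (of_int (eps_i ds (fst p) (snd p))) (F (inner_args xs (fst p) (snd p) g)))"

definition outer_sum :: "('k::field \<Rightarrow> 'w::ab_group_add \<Rightarrow> 'w) \<Rightarrow> int list \<Rightarrow> 'v list
     \<Rightarrow> ('w list \<Rightarrow> 'w) \<Rightarrow> ('v list \<Rightarrow> 'w) \<Rightarrow> 'w" where
  "outer_sum sc ds xs F g =
     (\<Sum>bs\<in>ord_partitions (length xs). sc (of_int (eps ds bs)) (F (map (\<lambda>B. g (sub xs B)) bs)))"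

definition unital_sLinf_morphism ::
  "('k::field \<Rightarrow> 'v::ab_group_add \<Rightarrow> 'v) \<Rightarrow> (int \<Rightarrow> 'v set) \<Rightarrow> 'v \<Rightarrow> ('v list \<Rightarrow> 'v)
   \<Rightarrow> ('k \<Rightarrow> 'w::ab_group_add \<Rightarrow> 'w) \<Rightarrow> (int \<Rightarrow> 'w set) \<Rightarrow> 'w \<Rightarrow> ('w list \<Rightarrow> 'w)
   \<Rightarrow> ('v list \<Rightarrow> 'w) \<Rightarrow> bool" where
  "unital_sLinf_morphism sc G one l sc' G' one' l' \<phi> \<longleftrightarrow>
     sym_family sc G sc' G' 0 \<phi>
   \<and> (\<forall>xs ds. xs \<noteq> [] \<and> homog G xs ds \<longrightarrow>
        outer_sum sc' ds xs l' \<phi> = inner_sum sc' ds xs \<phi> l)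
   \<and> \<phi> [one] = one'
   \<and> (\<forall>xs. xs \<noteq> [] \<longrightarrow> \<phi> (xs @ [one]) = 0)"

definition homotopy_prob_alg ::
  "('k::field \<Rightarrow> 'v::ab_group_add \<Rightarrow> 'v) \<Rightarrow> (int \<Rightarrow> 'v set) \<Rightarrow> 'v \<Rightarrow> ('v list \<Rightarrow> 'v) \<Rightarrow> ('v \<Rightarrow> 'v) \<Rightarrow> bool" where
  "homotopy_prob_alg sc G one M K \<longleftrightarrow>
     graded_vs sc G \<and> one \<in> G 0
   \<and> sym_family sc G sc G 0 M
   \<and> (\<forall>x. M [x] = x)
   \<and> (\<forall>xs. xs \<noteq> [] \<longrightarrow> M (xs @ [one]) = M xs)
   \<and> graded_map sc G sc G 1 K \<and> (\<forall>v. K (K v) = 0) \<and> K one = 0 \<and> one \<notin> range K"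

definition expectation ::
  "('k::field \<Rightarrow> 'v::ab_group_add \<Rightarrow> 'v) \<Rightarrow> (int \<Rightarrow> 'v set) \<Rightarrow> 'v \<Rightarrow> ('v \<Rightarrow> 'v) \<Rightarrow> ('v \<Rightarrow> 'k) \<Rightarrow> bool" where
  "expectation sc G one K c \<longleftrightarrow>
     Vector_Spaces.linear sc (*) c \<and> (\<forall>i. i \<noteq> 0 \<longrightarrow> (\<forall>v\<in>G i. c v = 0))
   \<and> c one = 1 \<and> (\<forall>v. c (K v) = 0)"

text \<open>lK is the descendant family l^K of (M, K): on homogeneous inputs (which determine it)
  K M_n(x_1..x_n) = sum_{pi, |B_i| = n-|pi|+1} eps(pi,i) M_{|pi|}(x_{B_1},..,l^K(x_{B_i}),..).\<close>
definition is_descendant ::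
  "('k::field \<Rightarrow> 'v::ab_group_add \<Rightarrow> 'v) \<Rightarrow> (int \<Rightarrow> 'v set) \<Rightarrow> ('v list \<Rightarrow> 'v) \<Rightarrow> ('v \<Rightarrow> 'v) \<Rightarrow> ('v list \<Rightarrow> 'v) \<Rightarrow> bool" where
  "is_descendant sc G M K lK \<longleftrightarrow>
     (\<forall>xs ds. xs \<noteq> [] \<and> homog G xs ds \<longrightarrow> K (M xs) = inner_sum sc ds xs M lK)"

definition is_cohomology ::
  "('k::field \<Rightarrow> 'v::ab_group_add \<Rightarrow> 'v) \<Rightarrow> (int \<Rightarrow> 'v set) \<Rightarrow> ('v \<Rightarrow> 'v)
   \<Rightarrow> ('k \<Rightarrow> 'h::ab_group_add \<Rightarrow> 'h) \<Rightarrow> (int \<Rightarrow> 'h set) \<Rightarrow> ('v \<Rightarrow> 'h) \<Rightarrow> bool" where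
  "is_cohomology sc G K scH GH pr \<longleftrightarrow>
     graded_vs scH GH \<and> graded_map sc G scH GH 0 pr
   \<and> (\<forall>h. \<exists>v. K v = 0 \<and> pr v = h)
   \<and> (\<forall>v. K v = 0 \<longrightarrow> (pr v = 0 \<longleftrightarrow> v \<in> range K))"

end

theory Submission
  imports Defs "HOL-Library.Multiset"
begin

text \<open>
  Read as a coalgebra map, \<open>M\<close> intertwines \<open>\<ell>\<^sup>K\<close> with the linear differential \<open>K\<close>, and it is
  invertible because \<open>M\<^sub>1 = id\<close>. So a morphism \<open>\<phi>\<close> from \<open>(H, 0)\<close> to \<open>(C, \<ell>\<^sup>K)\<close> is the same thing as a
  family \<open>\<Phi> = M \<bullet> \<phi>\<close> of graded symmetric maps with values in the kernel of \<open>K\<close>, and \<open>\<phi>\<close> is unital exactly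
  when \<open>\<Phi>\<^sub>1(1) = 1\<close> and \<open>\<Phi>\<^sub>n\<^sub>+\<^sub>1(x, 1) = \<Phi>\<^sub>n(x)\<close>. Take a graded linear section \<open>s\<close> of the projection from cocycles
  to cohomology with \<open>s(1) = 1\<close>, put \<open>e = c \<circ> s\<close> and \<open>u(x) = s(x) - e(x) 1\<close>, and let \<open>\<Phi>\<^sub>n(x)\<close> be the first
  order part \<open>\<Prod>\<^sub>j e(x\<^sub>j) 1 + \<Sum>\<^sub>i \<Prod>\<^sub>j\<^sub>\<noteq>\<^sub>i e(x\<^sub>j) u(x\<^sub>i)\<close> of the product of the \<open>e(x\<^sub>j) 1 + u(x\<^sub>j)\<close>. Then \<open>\<phi>\<close> is
  obtained from \<open>\<Phi>\<close> by recursion on the number of arguments. Expanding \<open>K \<Phi> = 0\<close> with the descendant equation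
  and grouping the terms by the union of the blocks inside \<open>\<ell>\<^sup>K\<close> gives the morphism equation by induction.
\<close>

section \<open>Koszul signs of ordered partitions\<close>

text \<open>Two demands on \<open>\<Phi>\<close> compete. \<open>M\<close> applied to cocycles need
  not be closed under \<open>K\<close>, while setting \<open>\<Phi>\<close> to zero from two
  arguments on violates the rule for inserting the unit. The expectation reconciles them: it
  supplies a scalar function \<open>e\<close> that is 1 on the unit and vanishes outside degree 0.
  Inserting the unit multiplies each old term by 1, and the one new term vanishes because
  \<open>u\<close> is zero on the unit. Cutting the expansion off at first order leaves at most one
  factor \<open>u\<close> per term, so no product of cocycles is ever formed. The combinatorial
  obstacle is that the descendant equation is applied to lists of blocks, whose entries come from
  renumbered sublists. All sums are therefore rewritten over set partitions of subsets of one fixed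
  index set, where signs are products over pairs of blocks compared by their maxima. Terms can then
  be matched block by block, without following permutations.\<close>

text \<open>\<open>msort\<close> lists disjoint blocks in the order of \<open>ord_partitions\<close>.\<close>

definition msort :: "nat set set \<Rightarrow> nat set list" where
  "msort P = map (the_inv_into P Max) (sorted_list_of_set (Max ` P))"

text \<open>Koszul contribution of a pair listed with \<open>q\<close> before \<open>p\<close>: only
  inversions count.\<close>

definition wsign :: "(nat \<Rightarrow> int) \<Rightarrow> nat \<Rightarrow> nat \<Rightarrow> int" where
  "wsign d q p = (if p < q then ksign (d q) (d p) else 1)"

definition cross_sign :: "(nat \<Rightarrow> int) \<Rightarrow> nat set \<Rightarrow> nat set \<Rightarrow> int" where
  "cross_sign d A B = (\<Prod>q\<in>A. \<Prod>p\<in>B. wsign d q p)"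

fun perm_sign :: "(nat \<Rightarrow> int) \<Rightarrow> nat list \<Rightarrow> int" where
  "perm_sign d [] = 1"
| "perm_sign d (x # xs) = (\<Prod>p\<in>set xs. wsign d x p) * perm_sign d xs"

text \<open>Koszul sign of writing the blocks one after another in an arbitrary order. Each block is
  listed increasingly, so inversions occur only between different blocks.\<close>

fun blocks_sign :: "(nat \<Rightarrow> int) \<Rightarrow> nat set list \<Rightarrow> int" where
  "blocks_sign d [] = 1"
| "blocks_sign d (B # Bs) = cross_sign d B (\<Union>(set Bs)) * blocks_sign d Bs"

text \<open>Unlike \<open>eps\<close>, this mentions no list: the order of the blocks is read off their maxima.\<close>

definition part_sign :: "(nat \<Rightarrow> int) \<Rightarrow> nat set set \<Rightarrow> int" where
  "part_sign d P = (\<Prod>B\<in>P. \<Prod>C\<in>{C\<in>P. Max B < Max C}. cross_sign d B C)"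

definition deg_sign :: "int \<Rightarrow> int" where
  "deg_sign a = (if even a then 1 else -1)"

lemma ksign_sq: "ksign a b * ksign a b = 1"
  by (simp add: ksign_def)

lemma ksign_comm: "ksign a b = ksign b a"
  by (simp add: ksign_def mult.commute)

lemma ksign_zero [simp]: "ksign a 0 = 1" "ksign 0 a = 1"
  by (simp_all add: ksign_def)

lemma ksign_cong: "even a = even a' \<Longrightarrow> even b = even b' \<Longrightarrow> ksign a b = ksign a' b'"
  by (simp add: ksign_def)

lemma deg_sign_add: "deg_sign (a + b) = deg_sign a * deg_sign b"
  by (auto simp: deg_sign_def)

lemma deg_sign_sum: "finite A \<Longrightarrow> deg_sign (sum f A) = (\<Prod>a\<in>A. deg_sign (f a))"
  by (induction A rule: finite_induct) (auto simp: deg_sign_add deg_sign_def)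

lemma ksign_add_right: "ksign a (b + c) = ksign a b * ksign a c"
  by (auto simp: ksign_def)

lemma ksign_sum_right: "finite B \<Longrightarrow> ksign a (sum f B) = (\<Prod>b\<in>B. ksign a (f b))"
  by (induction B rule: finite_induct) (auto simp: ksign_add_right)

lemma ksign_sum_sum:
  "finite A \<Longrightarrow> finite B \<Longrightarrow> ksign (sum f A) (sum g B) = (\<Prod>a\<in>A. \<Prod>b\<in>B. ksign (f a) (g b))"
proof -
  assume fin: "finite A" "finite B"
  have "ksign (sum f A) (sum g B) = (\<Prod>a\<in>A. ksign (sum g B) (f a))"
    using fin by (simp add: ksign_comm[of "sum f A"] ksign_sum_right)
  also have "\<dots> = (\<Prod>a\<in>A. \<Prod>b\<in>B. ksign (f a) (g b))"
    using fin by (intro prod.cong refl) (simp add: ksign_comm[of "sum g B"] ksign_sum_right)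
  finally show ?thesis .
qed

lemma wsign_mult_swap: "p \<noteq> q \<Longrightarrow> wsign d q p * wsign d p q = ksign (d q) (d p)"
  by (auto simp: wsign_def ksign_comm)

text \<open>Each pair from \<open>A\<close> and \<open>B\<close> is an inversion in exactly one of
  the two orders, so together the two signs collect the Koszul sign of every pair once.\<close>

lemma cross_sign_mult_swap:
  assumes "finite A" "finite B" "disjnt A B"
  shows "cross_sign d A B * cross_sign d B A = ksign (\<Sum>a\<in>A. d a) (\<Sum>b\<in>B. d b)"
proof -
  have "cross_sign d B A = (\<Prod>q\<in>A. \<Prod>p\<in>B. wsign d p q)"
    unfolding cross_sign_def by (rule prod.swap)
  then have "cross_sign d A B * cross_sign d B A = (\<Prod>q\<in>A. \<Prod>p\<in>B. wsign d q p * wsign d p q)"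
    by (simp add: cross_sign_def prod.distrib)
  also have "\<dots> = (\<Prod>q\<in>A. \<Prod>p\<in>B. ksign (d q) (d p))"
    using assms(3) by (intro prod.cong refl wsign_mult_swap) (auto simp: disjnt_iff)
  finally show ?thesis using assms by (simp add: ksign_sum_sum)
qed

lemma cross_sign_Union_right:
  assumes "finite R" "\<And>C. C \<in> R \<Longrightarrow> finite C" "disjoint R"
  shows "cross_sign d B (\<Union>R) = (\<Prod>C\<in>R. cross_sign d B C)"
proof -
  have "cross_sign d B (\<Union>R) = (\<Prod>q\<in>B. \<Prod>C\<in>R. \<Prod>p\<in>C. wsign d q p)"
    unfolding cross_sign_def using assms
    by (intro prod.cong refl, subst prod.Union_disjoint) (auto simp: disjoint_def)
  then show ?thesis by (simp add: cross_sign_def prod.swap[of _ B R])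
qed

lemma cross_sign_Union_left:
  assumes "finite R" "\<And>C. C \<in> R \<Longrightarrow> finite C" "disjoint R"
  shows "cross_sign d (\<Union>R) B = (\<Prod>C\<in>R. cross_sign d C B)"
  unfolding cross_sign_def using assms
  by (subst prod.Union_disjoint) (auto simp: disjoint_def)

lemma cross_sign_eq_1: "(\<And>a b. a \<in> A \<Longrightarrow> b \<in> B \<Longrightarrow> a < b) \<Longrightarrow> cross_sign d A B = 1"
  unfolding cross_sign_def wsign_def by (intro prod.neutral ballI) (metis order.asym)

lemma cross_sign_empty [simp]: "cross_sign d A {} = 1" "cross_sign d {} A = 1"
  by (simp_all add: cross_sign_def)

lemma cross_sign_cong:
  assumes "\<And>a. a \<in> A \<union> B \<Longrightarrow> even (d a) = even (d' a)"
  shows "cross_sign d A B = cross_sign d' A B"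
  unfolding cross_sign_def wsign_def
  using assms by (intro prod.cong refl if_cong ksign_cong) auto

lemma cross_sign_Un_left:
  "finite A \<Longrightarrow> finite A' \<Longrightarrow> A \<inter> A' = {} \<Longrightarrow> cross_sign d (A \<union> A') B = cross_sign d A B * cross_sign d A' B"
  by (simp add: cross_sign_def prod.union_disjoint)

lemma cross_sign_Un_right:
  "finite B \<Longrightarrow> finite B' \<Longrightarrow> B \<inter> B' = {} \<Longrightarrow> cross_sign d A (B \<union> B') = cross_sign d A B * cross_sign d A B'"
  by (simp add: cross_sign_def prod.union_disjoint prod.distrib)

lemma perm_sign_append:
  "distinct (xs @ ys) \<Longrightarrow>
    perm_sign d (xs @ ys) = perm_sign d xs * perm_sign d ys * cross_sign d (set xs) (set ys)"
  by (induction xs) (auto simp: prod.union_disjoint cross_sign_def)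

lemma perm_sign_sorted: "sorted xs \<Longrightarrow> perm_sign d xs = 1"
  by (induction xs) (auto simp: wsign_def intro!: prod.neutral)

text \<open>Connects the product over inverted positions in \<open>eps\<close> with a recursion on
  words. Pairs in order contribute 1 through \<open>wsign\<close>, so the index set may be enlarged
  to all pairs of positions, which split according to whether the first position is the
  head.\<close>

lemma perm_sign_eq_prod:
  "(\<Prod>p\<in>{(a, b). a < b \<and> b < length s \<and> s ! b < s ! a}. ksign (d (s ! fst p)) (d (s ! snd p)))
    = perm_sign d s" if "distinct s"
proof -
  have fin: "finite {(a, b). a < b \<and> b < length s}"
    by (rule finite_subset[of _ "{..<length s} \<times> {..<length s}"]) auto
  have "(\<Prod>p\<in>{(a, b). a < b \<and> b < length s \<and> s ! b < s ! a}. ksign (d (s ! fst p)) (d (s ! snd p)))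
     = (\<Prod>p\<in>{(a, b). a < b \<and> b < length s}. wsign d (s ! fst p) (s ! snd p))"
    by (rule prod.mono_neutral_cong_left[OF fin]) (auto simp: wsign_def)
  also have "\<dots> = perm_sign d s"
    using that
  proof (induction s)
    case Nil
    then show ?case by simp
  next
    case (Cons x s)
    let ?I = "\<lambda>n. {(a, b). a < b \<and> b < (n::nat)}"
    have fin': "finite (?I n)" for n
      by (rule finite_subset[of _ "{..<n} \<times> {..<n}"]) auto
    have split: "?I (Suc n) = (\<lambda>b. (0, Suc b)) ` {..<n} \<union> map_prod Suc Suc ` ?I n" (is "?L = ?R") for n
    proof (intro set_eqI iffI)
      fix p assume "p \<in> ?L"
      then obtain a b where "p = (a, b)" "a < b" "b < Suc n" by auto
      then show "p \<in> ?R" by (cases a; cases b) (auto simp: image_iff)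
    qed auto
    have "(\<Prod>p\<in>?I (length (x # s)). wsign d ((x # s) ! fst p) ((x # s) ! snd p))
      = (\<Prod>p\<in>(\<lambda>b. (0, Suc b)) ` {..<length s}. wsign d ((x # s) ! fst p) ((x # s) ! snd p))
       * (\<Prod>p\<in>map_prod Suc Suc ` ?I (length s). wsign d ((x # s) ! fst p) ((x # s) ! snd p))"
      unfolding list.size add_0_right add_Suc_right One_nat_def split
      by (rule prod.union_disjoint) (use fin'[of "length s"] in auto)
    also have "(\<Prod>p\<in>map_prod Suc Suc ` ?I (length s). wsign d ((x # s) ! fst p) ((x # s) ! snd p))
       = perm_sign d s"
      using Cons by (subst prod.reindex) (auto simp: inj_on_def)
    also have "(\<Prod>p\<in>(\<lambda>b. (0, Suc b)) ` {..<length s}. wsign d ((x # s) ! fst p) ((x # s) ! snd p))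
       = (\<Prod>b<length s. wsign d x (s ! b))"
      by (subst prod.reindex) (auto simp: inj_on_def)
    also have "\<dots> = (\<Prod>p\<in>set s. wsign d x p)"
      using Cons.prems
      by (intro prod.reindex_bij_betw[of "(!) s" "{..<length s}" "set s" "wsign d x"]) (auto intro: bij_betw_nth)
    finally show ?case by simp
  qed
  finally show ?thesis .
qed

section \<open>Lists and sets of disjoint blocks\<close>

definition disjoint_list :: "nat set list \<Rightarrow> bool" where
  "disjoint_list bs \<longleftrightarrow> distinct bs \<and> disjoint (set bs) \<and> (\<forall>B\<in>set bs. finite B \<and> B \<noteq> {})"

lemma disjoint_list_Cons:
  "disjoint_list (B # bs) \<longleftrightarrow> finite B \<and> B \<noteq> {} \<and> B \<inter> \<Union>(set bs) = {} \<and> disjoint_list bs"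
proof -
  have "disjoint (insert B (set bs)) \<and> B \<notin> set bs \<longleftrightarrow> B \<inter> \<Union>(set bs) = {} \<and> disjoint (set bs)"
    if "B \<noteq> {}"
    using that by (force simp: pairwise_insert disjnt_iff)
  then show ?thesis
    unfolding disjoint_list_def by (cases "B = {}") auto
qed

lemma concat_blocks:
  "disjoint_list bs \<Longrightarrow>
    distinct (concat (map sorted_list_of_set bs)) \<and> set (concat (map sorted_list_of_set bs)) = \<Union>(set bs)"
  by (induction bs) (auto simp: disjoint_list_Cons)

lemma perm_sign_concat:
  "disjoint_list bs \<Longrightarrow> perm_sign d (concat (map sorted_list_of_set bs)) = blocks_sign d bs"
proof (induction bs)
  case (Cons B bs)
  have "distinct (concat (map sorted_list_of_set (B # bs)))"
    using concat_blocks[OF Cons.prems] by blast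
  moreover have "set (concat (map sorted_list_of_set bs)) = \<Union>(set bs)" "finite B"
    using concat_blocks[of bs] Cons.prems by (auto simp: disjoint_list_Cons)
  ultimately show ?case
    using Cons by (simp add: perm_sign_append perm_sign_sorted disjoint_list_Cons)
qed simp

lemma eps_eq_blocks_sign: "disjoint_list bs \<Longrightarrow> eps ds bs = blocks_sign ((!) ds) bs"
  using perm_sign_eq_prod[of "concat (map sorted_list_of_set bs)" "(!) ds"] concat_blocks[of bs]
  by (simp add: eps_def Let_def perm_sign_concat)

text \<open>In a list sorted by maxima the blocks behind \<open>B\<close> are exactly those with a
  larger maximum, so the order of the list can be forgotten.\<close>

lemma blocks_sign_sorted:
  "disjoint_list bs \<Longrightarrow> sorted_wrt (\<lambda>A B. Max A < Max B) bs \<Longrightarrow> blocks_sign d bs = part_sign d (set bs)"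
proof (induction bs)
  case Nil
  then show ?case by (simp add: part_sign_def)
next
  case (Cons B bs)
  have dj: "disjoint_list bs" "B \<notin> set bs" using Cons.prems
    by (auto simp: disjoint_list_Cons)
  have lt: "\<And>C. C \<in> set bs \<Longrightarrow> Max B < Max C" using Cons.prems by simp
  have "part_sign d (set (B # bs)) = (\<Prod>C\<in>{C \<in> set (B # bs). Max B < Max C}. cross_sign d B C)
     * (\<Prod>A\<in>set bs. \<Prod>C\<in>{C \<in> set (B # bs). Max A < Max C}. cross_sign d A C)"
    using dj by (simp add: part_sign_def)
  also have "{C \<in> set (B # bs). Max B < Max C} = set bs" using lt by auto
  also have "(\<Prod>A\<in>set bs. \<Prod>C\<in>{C \<in> set (B # bs). Max A < Max C}. cross_sign d A C) = part_sign d (set bs)"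
    unfolding part_sign_def
    by (intro prod.cong refl) (use lt in \<open>auto dest: order.asym\<close>)
  also have "(\<Prod>C\<in>set bs. cross_sign d B C) = cross_sign d B (\<Union>(set bs))"
    using dj by (subst cross_sign_Union_right) (auto simp: disjoint_list_def)
  finally show ?case using Cons dj by simp
qed

definition blocks :: "nat set set \<Rightarrow> bool" where
  "blocks P \<longleftrightarrow> finite P \<and> disjoint P \<and> (\<forall>B\<in>P. finite B \<and> B \<noteq> {})"

lemma blocks_subset: "blocks P \<Longrightarrow> Q \<subseteq> P \<Longrightarrow> blocks Q"
  by (auto simp: blocks_def pairwise_def finite_subset)

lemma partition_on_blocks: "partition_on A P \<Longrightarrow> finite A \<Longrightarrow> blocks P"
  unfolding blocks_def
  by (metis finite_elements partition_on_def Sup_upper finite_subset)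

lemma blocks_partition_on: "blocks P \<Longrightarrow> partition_on (\<Union>P) P"
  by (auto simp: blocks_def partition_on_def)

lemma blocks_inj_on_Max: "blocks P \<Longrightarrow> inj_on Max P"
  unfolding blocks_def inj_on_def disjoint_def by (metis Max_in disjoint_iff)

lemma set_msort [simp]: "blocks P \<Longrightarrow> set (msort P) = P"
  by (simp add: msort_def blocks_inj_on_Max the_inv_into_onto blocks_def)

lemma map_Max_msort: "blocks P \<Longrightarrow> map Max (msort P) = sorted_list_of_set (Max ` P)"
  unfolding msort_def map_map
  by (rule map_idI) (auto simp: blocks_def intro!: f_the_inv_into_f blocks_inj_on_Max)

lemma sorted_wrt_msort: "blocks P \<Longrightarrow> sorted_wrt (\<lambda>A B. Max A < Max B) (msort P)"
  using map_Max_msort[of P] sorted_wrt_map[of "(<)" Max "msort P"] by simp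

lemma distinct_msort: "blocks P \<Longrightarrow> distinct (msort P)"
  using map_Max_msort[of P] by (metis distinct_map distinct_sorted_list_of_set)

lemma length_msort: "blocks P \<Longrightarrow> length (msort P) = card P"
  by (metis distinct_card distinct_msort set_msort)

lemma msort_unique:
  assumes "blocks P" "set bs = P" "sorted_wrt (\<lambda>A B. Max A < Max B) bs"
  shows "bs = msort P"
proof -
  have "map Max bs = map Max (msort P)"
    using assms map_Max_msort[OF assms(1)]
    by (intro strict_sorted_equal) (simp_all add: sorted_wrt_map blocks_def)
  then show ?thesis
    using assms blocks_inj_on_Max[OF assms(1)] by (intro map_inj_on[of Max]) auto
qed

lemma disjoint_list_msort: "blocks P \<Longrightarrow> disjoint_list (msort P)"
  by (simp add: disjoint_list_def distinct_msort blocks_def[of P] set_msort[unfolded blocks_def])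

lemma blocks_sign_msort: "blocks P \<Longrightarrow> blocks_sign d (msort P) = part_sign d P"
  by (simp add: blocks_sign_sorted disjoint_list_msort sorted_wrt_msort)

lemma eps_msort: "blocks P \<Longrightarrow> eps ds (msort P) = part_sign ((!) ds) P"
  by (simp add: eps_eq_blocks_sign disjoint_list_msort blocks_sign_msort)

lemma msort_empty [simp]: "msort {} = []"
  by (simp add: msort_def)

lemma msort_single: "finite B \<Longrightarrow> B \<noteq> {} \<Longrightarrow> msort {B} = [B]"
  by (rule msort_unique[symmetric]) (auto simp: blocks_def)

lemma part_sign_single [simp]: "part_sign d {B} = 1"
  by (auto simp: part_sign_def intro!: prod.neutral)

lemma part_sign_cong:
  assumes "\<And>a. a \<in> \<Union>P \<Longrightarrow> even (d a) = even (d' a)"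
  shows "part_sign d P = part_sign d' P"
  unfolding part_sign_def using assms by (intro prod.cong refl cross_sign_cong) auto

text \<open>Disjoint nonempty blocks have distinct maxima, so a partition has only one admissible
  order: \<open>set\<close> and \<open>msort\<close> are mutually inverse.\<close>

lemma sum_ord_partitions:
  "(\<Sum>bs\<in>ord_partitions n. f bs) = (\<Sum>P | partition_on {..<n} P. f (msort P))"
proof (rule sum.reindex_bij_witness[of _ msort set])
  fix bs assume "bs \<in> ord_partitions n"
  then have "partition_on {..<n} (set bs)" "sorted_wrt (\<lambda>A B. Max A < Max B) bs"
    by (auto simp: ord_partitions_def)
  moreover from this have "blocks (set bs)" by (simp add: partition_on_blocks)
  ultimately show "msort (set bs) = bs" "set bs \<in> {P. partition_on {..<n} P}"
    "f (msort (set bs)) = f bs"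
    using msort_unique[of "set bs" bs] by auto
next
  fix P assume "P \<in> {P. partition_on {..<n} P}"
  then have "partition_on {..<n} P" "blocks P" by (auto simp: partition_on_blocks)
  then show "set (msort P) = P" "msort P \<in> ord_partitions n"
    by (auto simp: ord_partitions_def sorted_wrt_msort)
qed

section \<open>Merging blocks\<close>

lemma sorted_list_of_set_image:
  fixes f :: "nat \<Rightarrow> nat"
  assumes "finite B" "strict_mono_on B f"
  shows "sorted_list_of_set (f ` B) = map f (sorted_list_of_set B)"
proof (rule strict_sorted_equal)
  have "sorted_wrt (<) (sorted_list_of_set B)" by simp
  then show "sorted_wrt (<) (map f (sorted_list_of_set B))"
    unfolding sorted_wrt_map
    by (rule sorted_wrt_mono_rel[rotated]) (use assms in \<open>auto dest: strict_mono_onD\<close>)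
qed (use assms in auto)

lemma Max_image_strict_mono:
  fixes f :: "nat \<Rightarrow> nat"
  assumes "finite B" "B \<noteq> {}" "strict_mono_on B f"
  shows "Max (f ` B) = f (Max B)"
proof (rule Max_eqI)
  fix y assume "y \<in> f ` B"
  then obtain b where "b \<in> B" "y = f b" by auto
  then show "y \<le> f (Max B)"
    using strict_mono_onD[OF assms(3), of b "Max B"] Max_ge[OF assms(1), of b] Max_in[OF assms(1,2)]
    by (cases "b = Max B") (auto simp: le_less simp del: Max_ge)
qed (use assms in auto)

text \<open>The form of \<open>eps_i\<close> when all blocks except \<open>R\<close> are singletons.
  A point \<open>a\<close> outside \<open>R\<close> and below its maximum is listed before
  \<open>R\<close>. It contributes its own degree, because the odd operation passes it, and one
  inversion with each smaller point of \<open>R\<close>.\<close>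

definition inner_sign :: "(nat \<Rightarrow> int) \<Rightarrow> nat set \<Rightarrow> int" where
  "inner_sign e R = (\<Prod>a\<in>{..<Max R} - R. deg_sign (e a) * (\<Prod>b\<in>R. wsign e a b))"

text \<open>The partitions with a distinguished block and otherwise only singletons correspond to the
  nonempty subsets \<open>R\<close>; the distinguished block precedes exactly the singletons beyond \<open>Max R\<close>.\<close>

definition one_block :: "nat \<Rightarrow> nat set \<Rightarrow> nat set list" where
  "one_block k R = map (\<lambda>a. {a}) (sorted_list_of_set ({..<Max R} - R))
     @ R # map (\<lambda>a. {a}) (sorted_list_of_set {Max R<..<k})"

context
  fixes k :: nat and R :: "nat set"
  assumes R: "R \<subseteq> {..<k}" "R \<noteq> {}"
begin

lemma fin_R: "finite R" using R(1) finite_subset by blast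

lemma Max_R: "Max R \<in> R" "\<And>b. b \<in> R \<Longrightarrow> b \<le> Max R" "Max R < k"
  using R fin_R by (auto simp: Max_in)

lemma compl_R: "{..<k} - R = ({..<Max R} - R) \<union> {Max R<..<k}"
proof (intro set_eqI iffI)
  fix a assume "a \<in> {..<k} - R"
  then show "a \<in> ({..<Max R} - R) \<union> {Max R<..<k}"
    using Max_R(1) linorder_neqE_nat[of a "Max R"] by auto
next
  fix a assume "a \<in> ({..<Max R} - R) \<union> {Max R<..<k}"
  then show "a \<in> {..<k} - R" using Max_R by fastforce
qed

lemma set_one_block: "set (one_block k R) = insert R ((\<lambda>a. {a}) ` ({..<k} - R))"
  by (simp add: one_block_def compl_R image_Un)

lemma sorted_one_block: "sorted_wrt (\<lambda>A B. Max A < Max B) (one_block k R)"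
  using Max_R by (auto simp: one_block_def sorted_wrt_append sorted_wrt_map)

lemma length_one_block: "length (one_block k R) = k - card R + 1"
proof -
  have "card ({..<k} - R) = card ({..<Max R} - R) + card {Max R<..<k}"
    unfolding compl_R by (rule card_Un_disjoint) auto
  moreover have "card ({..<k} - R) = k - card R" using R fin_R by (simp add: card_Diff_subset)
  ultimately show ?thesis by (simp add: one_block_def)
qed

lemma nth_one_block: "one_block k R ! card ({..<Max R} - R) = R"
  by (simp add: one_block_def nth_append)

lemma partition_one_block: "partition_on {..<k} (set (one_block k R))"
  unfolding set_one_block partition_on_def
  using R by (auto simp: pairwise_insert disjnt_iff pairwise_def)

lemma blocks_one_block: "blocks (set (one_block k R))"
  using partition_one_block partition_on_blocks by blast

text \<open>The word consists of the early singletons, \<open>R\<close> and the late singletons,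
  each part increasing. The late part lies above the other two, so inversions occur only between the
  early singletons and \<open>R\<close>.\<close>

lemma eps_i_one_block: "eps_i es (one_block k R) (card ({..<Max R} - R)) = inner_sign ((!) es) R"
proof -
  let ?A = "{..<Max R} - R" let ?C = "{Max R<..<k}"
  have "disjoint_list (one_block k R)"
    using disjoint_list_msort[OF blocks_one_block] msort_unique[OF blocks_one_block refl sorted_one_block]
    by simp
  then have sgn: "eps es (one_block k R) = perm_sign ((!) es) (concat (map sorted_list_of_set (one_block k R)))"
    and dist: "distinct (concat (map sorted_list_of_set (one_block k R)))"
    using concat_blocks by (simp_all add: eps_eq_blocks_sign perm_sign_concat)
  note sgn
  also have conc: "concat (map sorted_list_of_set (one_block k R))
      = sorted_list_of_set ?A @ sorted_list_of_set R @ sorted_list_of_set ?C"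
    by (simp add: one_block_def comp_def)
  also have "perm_sign ((!) es) \<dots> = cross_sign ((!) es) ?A (R \<union> ?C) * cross_sign ((!) es) R ?C"
    using dist fin_R unfolding conc by (simp add: perm_sign_append perm_sign_sorted)
  also have "cross_sign ((!) es) R ?C = 1"
    using Max_R by (intro cross_sign_eq_1) (metis greaterThanLessThan_iff order.strict_trans1)
  also have "cross_sign ((!) es) ?A (R \<union> ?C) = cross_sign ((!) es) ?A R * cross_sign ((!) es) ?A ?C"
    using Max_R(2) fin_R by (intro cross_sign_Un_right) (auto simp: not_le[symmetric])
  also have "cross_sign ((!) es) ?A ?C = 1"
    by (intro cross_sign_eq_1) auto
  finally have e: "eps es (one_block k R) = cross_sign ((!) es) ?A R" by simp
  have "(\<Sum>j<card ?A. bdeg es (one_block k R ! j)) = (\<Sum>j<card ?A. es ! (sorted_list_of_set ?A ! j))"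
    by (intro sum.cong refl) (simp add: one_block_def nth_append bdeg_def)
  also have "\<dots> = (\<Sum>a\<in>?A. es ! a)"
    by (intro sum.reindex_bij_betw[of "(!) (sorted_list_of_set ?A)" "{..<card ?A}" ?A "(!) es"] bij_betw_nth) auto
  finally have "deg_sign (\<Sum>j<card ?A. bdeg es (one_block k R ! j)) = (\<Prod>a\<in>?A. deg_sign (es ! a))"
    by (simp add: deg_sign_sum)
  then show ?thesis
    unfolding eps_i_def e deg_sign_def[symmetric]
    by (simp add: inner_sign_def cross_sign_def prod.distrib mult.commute)
qed

lemma inner_args_one_block:
  assumes "length xs = k"
  shows "inner_args xs (one_block k R) (card ({..<Max R} - R)) g
   = map ((!) xs) (sorted_list_of_set ({..<Max R} - R)) @ g (sub xs R)
       # map ((!) xs) (sorted_list_of_set {Max R<..<k})"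
  (is "?l = ?r")
proof (rule nth_equalityI)
  show "length ?l = length ?r" by (simp add: inner_args_def one_block_def)
  fix j assume "j < length ?l"
  then have j: "j < length (one_block k R)" by (simp add: inner_args_def)
  then consider "j < card ({..<Max R} - R)" | "j = card ({..<Max R} - R)"
    | i where "j = Suc (card ({..<Max R} - R) + i)"
    by (metis less_imp_Suc_add linorder_neqE_nat)
  then show "?l ! j = ?r ! j"
    using j by cases (simp_all add: inner_args_def one_block_def nth_append del: upt_Suc)
qed

end

text \<open>A counting argument: the prescribed size of the distinguished block leaves exactly as
  many points as there are other blocks, and these are nonempty, so each of them is a
  singleton.\<close>

lemma one_block_exhaust:
  assumes "bs \<in> ord_partitions k" "i < length bs" "card (bs ! i) = k - length bs + 1"
  defines "R \<equiv> bs ! i"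
  shows "R \<subseteq> {..<k}" "R \<noteq> {}" "bs = one_block k R" "i = card ({..<Max R} - R)"
proof -
  have P: "partition_on {..<k} (set bs)" and srt: "sorted_wrt (\<lambda>A B. Max A < Max B) bs"
    using assms by (auto simp: ord_partitions_def)
  have bl: "blocks (set bs)" using P partition_on_blocks by blast
  have dist: "distinct bs" using msort_unique[OF bl refl srt] distinct_msort[OF bl] by simp
  have Rin: "R \<in> set bs" using assms by simp
  show RK: "R \<subseteq> {..<k}" "R \<noteq> {}" using Rin P by (auto simp: partition_on_def)
  have finB: "\<And>B. B \<in> set bs \<Longrightarrow> finite B \<and> card B \<ge> 1"
    using bl by (auto simp: blocks_def Suc_le_eq card_gt_0_iff)
  have "k = (\<Sum>B\<in>set bs. card B)"
    using card_Union_disjoint[of "set bs"] P bl by (auto simp: partition_on_def blocks_def)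
  also have "\<dots> = card R + (\<Sum>B\<in>set bs - {R}. card B)"
    using Rin by (simp add: sum.remove)
  finally have k: "k = card R + (\<Sum>B\<in>set bs - {R}. card B)" .
  have "length bs - 1 = (\<Sum>B\<in>set bs - {R}. 1)" using Rin dist by (simp add: distinct_card)
  also have "\<dots> \<le> (\<Sum>B\<in>set bs - {R}. card B)" using finB by (intro sum_mono) auto
  finally have "length bs - 1 \<le> (\<Sum>B\<in>set bs - {R}. card B)" .
  moreover have "card R \<ge> 1" using finB Rin by blast
  \<comment> \<open>The two preceding bounds give \<open>length bs \<le> k\<close>, so the
    subtraction of natural numbers in the cardinality condition is not truncated.\<close>
  ultimately have "(\<Sum>B\<in>set bs - {R}. card B) = length bs - 1"
    using k assms(2,3) unfolding R_def[symmetric] by linarith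
  also have "\<dots> = (\<Sum>B\<in>set bs - {R}. 1)" using Rin dist by (simp add: distinct_card)
  finally have "(\<Sum>B\<in>set bs - {R}. card B) = (\<Sum>B\<in>set bs - {R}. 1)" .
  then have one: "card B = 1" if "B \<in> set bs - {R}" for B
    using sum_mono_inv[of "\<lambda>_. 1" "set bs - {R}" card B] finB that by simp
  have "set bs - {R} = (\<lambda>a. {a}) ` ({..<k} - R)"
  proof (intro set_eqI iffI)
    fix B assume B: "B \<in> set bs - {R}"
    then obtain a where "B = {a}" using one[OF B] by (auto simp: card_1_singleton_iff)
    moreover have "B \<inter> R = {}" "B \<subseteq> {..<k}" using B Rin P by (auto simp: partition_on_def disjoint_def)
    ultimately show "B \<in> (\<lambda>a. {a}) ` ({..<k} - R)" by auto
  next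
    fix B assume "B \<in> (\<lambda>a. {a}) ` ({..<k} - R)"
    then obtain a where a: "a < k" "a \<notin> R" "B = {a}" by auto
    then obtain C where C: "C \<in> set bs" "a \<in> C" using P by (auto simp: partition_on_def)
    then have "C \<in> set bs - {R}" using a by auto
    with one[OF this] C have "C = {a}" by (auto simp: card_1_singleton_iff)
    then show "B \<in> set bs - {R}" using C a by auto
  qed
  then have "set (one_block k R) = set bs"
    using Rin unfolding set_one_block[OF RK] by auto
  then show eq: "bs = one_block k R"
    using msort_unique[OF bl refl srt] msort_unique[OF bl _ sorted_one_block[OF RK]] by metis
  have "card ({..<Max R} - R) < length bs" unfolding eq by (simp add: one_block_def)
  then show "i = card ({..<Max R} - R)"
    using nth_one_block[OF RK] assms(2) dist eq[symmetric] R_def by (metis nth_eq_iff_index_eq)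
qed

lemma inner_sum_subsets:
  "inner_sum sc es xs F g = (\<Sum>R\<in>Pow {..<length xs} - {{}}. sc (of_int (inner_sign ((!) es) R))
     (F (map ((!) xs) (sorted_list_of_set ({..<Max R} - R)) @ g (sub xs R)
       # map ((!) xs) (sorted_list_of_set {Max R<..<length xs}))))"
proof -
  let ?k = "length xs"
  let ?h = "\<lambda>R. (one_block ?k R, card ({..<Max R} - R))"
  have "{(bs, i). bs \<in> ord_partitions ?k \<and> i < length bs \<and> card (bs ! i) = ?k - length bs + 1}
     = ?h ` (Pow {..<?k} - {{}})" (is "?S = ?T")
  proof (intro set_eqI iffI)
    fix p assume "p \<in> ?S"
    then obtain bs i where p: "p = (bs, i)" "bs \<in> ord_partitions ?k" "i < length bs"
      "card (bs ! i) = ?k - length bs + 1" by auto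
    note e = one_block_exhaust[OF p(2-4)]
    show "p \<in> ?T"
      using e by (intro image_eqI[of _ _ "bs ! i"]) (auto simp: p(1))
  next
    fix p assume "p \<in> ?T"
    then obtain R where R: "R \<subseteq> {..<?k}" "R \<noteq> {}" "p = ?h R" by auto
    have "card R \<le> ?k" "card R \<ge> 1"
      using card_mono[OF _ R(1)] R by (auto simp: Suc_le_eq card_gt_0_iff finite_subset)
    then show "p \<in> ?S"
      using partition_one_block[OF R(1,2)] sorted_one_block[OF R(1,2)] length_one_block[OF R(1,2)]
        nth_one_block[OF R(1,2)] R(3)
      by (auto simp: ord_partitions_def) (simp add: one_block_def)
  qed
  moreover have "inj_on ?h (Pow {..<?k} - {{}})"
  proof (rule inj_onI)
    fix R R' assume *: "R \<in> Pow {..<?k} - {{}}" "R' \<in> Pow {..<?k} - {{}}" "?h R = ?h R'"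
    then show "R = R'" using nth_one_block[of R ?k] nth_one_block[of R' ?k] by (metis DiffD1 DiffD2 PowD insertI1 prod.inject)
  qed
  ultimately have "inner_sum sc es xs F g
    = (\<Sum>R\<in>Pow {..<?k} - {{}}. sc (of_int (eps_i es (fst (?h R)) (snd (?h R))))
        (F (inner_args xs (fst (?h R)) (snd (?h R)) g)))"
    unfolding inner_sum_def by (simp add: sum.reindex)
  also have "\<dots> = (\<Sum>R\<in>Pow {..<length xs} - {{}}. sc (of_int (inner_sign ((!) es) R))
     (F (map ((!) xs) (sorted_list_of_set ({..<Max R} - R)) @ g (sub xs R)
       # map ((!) xs) (sorted_list_of_set {Max R<..<length xs}))))"
    by (intro sum.cong refl) (auto simp: eps_i_one_block inner_args_one_block)
  finally show ?thesis .
qed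

text \<open>The analogue of \<open>inner_sign\<close> one level up: points are replaced by blocks
  compared by their maxima, \<open>R\<close> collects the blocks fed to the inner operation and
  \<open>T\<close> the remaining ones.\<close>

definition block_inner_sign :: "(nat set \<Rightarrow> int) \<Rightarrow> nat set set \<Rightarrow> nat set set \<Rightarrow> int" where
  "block_inner_sign e T R = (\<Prod>B\<in>{B\<in>T. Max B < Max (\<Union>R)}.
      deg_sign (e B) * (\<Prod>C\<in>R. if Max C < Max B then ksign (e B) (e C) else 1))"

text \<open>The position in \<open>msort Q\<close> identifies an initial segment of the naturals
  with \<open>Q\<close> ordered by maxima, and the maximum of a union of blocks is that of its last
  block. Hence the sum over sets of positions becomes a sum over sets of blocks in which positions
  no longer appear.\<close>

lemma inner_sum_blocks:
  assumes Q: "blocks Q"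
  shows "inner_sum sc (map e (msort Q)) (map y (msort Q)) F g
   = (\<Sum>R\<in>Pow Q - {{}}. sc (of_int (block_inner_sign e (Q - R) R))
       (F (map y (msort {B\<in>Q - R. Max B < Max (\<Union>R)}) @ g (map y (msort R))
           # map y (msort {B\<in>Q - R. Max (\<Union>R) < Max B}))))"
proof -
  let ?bs = "msort Q" let ?k = "length (msort Q)"
  let ?N = "(!) ?bs"
  have bij: "bij_betw ?N {..<?k} Q"
    using Q by (intro bij_betw_nth) (auto simp: distinct_msort)
  have inj: "inj_on ?N {..<?k}" and img: "?N ` {..<?k} = Q" using bij by (auto simp: bij_betw_def)
  have mono: "Max (?N a) < Max (?N b)" if "a < b" "b < ?k" for a b
    using sorted_wrt_nth_less[OF sorted_wrt_msort[OF Q] that] .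
  have mono_iff: "Max (?N a) < Max (?N b) \<longleftrightarrow> a < b" if "a < ?k" "b < ?k" for a b
    using mono[of a b] mono[of b a] that by (metis linorder_neqE_nat order.asym)
  have map_msort: "map ?N (sorted_list_of_set X) = msort (?N ` X)" if "X \<subseteq> {..<?k}" for X
  proof (rule msort_unique)
    have finX: "finite X" using that finite_subset by blast
    show "blocks (?N ` X)" using blocks_subset[OF Q] image_mono[OF that, of ?N] unfolding img .
    show "set (map ?N (sorted_list_of_set X)) = ?N ` X" using finX by simp
    have "sorted_wrt (<) (sorted_list_of_set X)" by simp
    then show "sorted_wrt (\<lambda>A B. Max A < Max B) (map ?N (sorted_list_of_set X))"
      unfolding sorted_wrt_map
    proof (rule sorted_wrt_mono_rel[rotated])
      fix a b assume "a \<in> set (sorted_list_of_set X)" "b \<in> set (sorted_list_of_set X)" "a < b"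
      then show "Max (?N a) < Max (?N b)" using that finX by (intro mono) auto
    qed
  qed
  have fin: "finite (?N a)" "?N a \<noteq> {}" if "a < ?k" for a
    using Q img that by (auto simp: blocks_def)
  have MaxU: "Max (\<Union>(?N ` X)) = Max (?N (Max X))" if X: "X \<subseteq> {..<?k}" "X \<noteq> {}" for X
  proof (rule Max_eqI)
    have finX: "finite X" using that finite_subset by blast
    have mX: "Max X \<in> X" using finX X by simp
    show "finite (\<Union>(?N ` X))" using finX X fin by auto
    show "Max (?N (Max X)) \<in> \<Union>(?N ` X)" using mX fin[of "Max X"] X by (meson Max_in UN_I lessThan_iff subsetD)
    fix x assume "x \<in> \<Union>(?N ` X)"
    then obtain b where b: "b \<in> X" "x \<in> ?N b" by auto
    have "b \<le> Max X" "Max X < ?k" using b finX mX X by auto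
    have "x \<le> Max (?N b)" using b fin X by auto
    also from \<open>b \<le> Max X\<close> \<open>Max X < ?k\<close> have "Max (?N b) \<le> Max (?N (Max X))"
      using mono[of b "Max X"] by (cases "b = Max X") (auto simp: le_less)
    finally show "x \<le> Max (?N (Max X))" .
  qed
  have pre: "?N ` ({..<Max X} - X) = {B \<in> Q - ?N ` X. Max B < Max (\<Union>(?N ` X))}"
    and post: "?N ` {Max X<..<?k} = {B \<in> Q - ?N ` X. Max (\<Union>(?N ` X)) < Max B}"
    if X: "X \<subseteq> {..<?k}" "X \<noteq> {}" for X
  proof -
    have finX: "finite X" using that finite_subset by blast
    have mX: "Max X < ?k" "\<And>b. b \<in> X \<Longrightarrow> b \<le> Max X" using finX X by auto
    have "Q - ?N ` X = ?N ` ({..<?k} - X)"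
      using inj_on_image_set_diff[OF inj, of "{..<?k}" X] X img by auto
    then have sel: "{B \<in> Q - ?N ` X. p B} = ?N ` {a \<in> {..<?k} - X. p (?N a)}" for p by auto
    have "{a \<in> {..<?k} - X. Max (?N a) < Max (?N (Max X))} = {..<Max X} - X"
      using mX(1) mono_iff[OF _ mX(1)] by auto
    then show "?N ` ({..<Max X} - X) = {B \<in> Q - ?N ` X. Max B < Max (\<Union>(?N ` X))}"
      unfolding sel MaxU[OF X] by simp
    have "{a \<in> {..<?k} - X. Max (?N (Max X)) < Max (?N a)} = {Max X<..<?k}"
      using mX mono_iff[OF mX(1)] by (auto simp: not_le[symmetric])
    then show "?N ` {Max X<..<?k} = {B \<in> Q - ?N ` X. Max (\<Union>(?N ` X)) < Max B}"
      unfolding sel MaxU[OF X] by simp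
  qed
  have sign: "inner_sign ((!) (map e ?bs)) X = block_inner_sign e (Q - ?N ` X) (?N ` X)"
    if X: "X \<subseteq> {..<?k}" "X \<noteq> {}" for X
  proof -
    have finX: "finite X" using that finite_subset by blast
    have mX: "Max X < ?k" using finX X by auto
    have "inj_on ?N ({..<Max X} - X)" "inj_on ?N X" using inj X mX
      by (auto intro: inj_on_subset)
    have w: "wsign ((!) (map e ?bs)) a b = (if Max (?N b) < Max (?N a) then ksign (e (?N a)) (e (?N b)) else 1)"
      if "a < Max X" "b \<in> X" for a b
    proof -
      have "a < ?k" "b < ?k" using that mX X by auto
      then show ?thesis by (simp add: wsign_def mono_iff)
    qed
    show ?thesis
      unfolding inner_sign_def block_inner_sign_def pre[OF X, symmetric] prod.reindex[OF \<open>inj_on ?N X\<close>]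
        prod.reindex[OF \<open>inj_on ?N ({..<Max X} - X)\<close>]
      using mX by (intro prod.cong refl) (simp add: w)
  qed
  have "bij_betw ((`) ?N) (Pow {..<?k}) (Pow Q)" using bij by (rule bij_betw_Pow)
  then have "bij_betw ((`) ?N) (Pow {..<?k} - {{}}) (Pow Q - {{}})"
    by (rule bij_betw_DiffI) (auto simp: bij_betw_def)
  then have bijP: "bij_betw ((`) ?N) (Pow {..<length (map y ?bs)} - {{}}) (Pow Q - {{}})" by simp
  show ?thesis
    unfolding inner_sum_subsets sum.reindex_bij_betw[OF bijP, symmetric]
  proof (intro sum.cong refl)
    fix X assume "X \<in> Pow {..<length (map y ?bs)} - {{}}"
    then have X: "X \<subseteq> {..<?k}" "X \<noteq> {}" by auto
    have finX: "finite X" using X finite_subset by blast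
    have mX: "Max X < ?k" using finX X by auto
    have m: "map ((!) (map y ?bs)) (sorted_list_of_set Z) = map y (msort (?N ` Z))" if "Z \<subseteq> {..<?k}" for Z
    proof -
      have "finite Z" using that finite_subset by blast
      then have "map ((!) (map y ?bs)) (sorted_list_of_set Z) = map y (map ?N (sorted_list_of_set Z))"
        using that by auto
      then show ?thesis using map_msort[OF that] by simp
    qed
    have "{..<Max X} - X \<subseteq> {..<?k}" "{Max X<..<?k} \<subseteq> {..<?k}" using mX by auto
    then show "sc (of_int (inner_sign ((!) (map e ?bs)) X))
          (F (map ((!) (map y ?bs)) (sorted_list_of_set ({..<Max X} - X)) @ g (sub (map y ?bs) X)
            # map ((!) (map y ?bs)) (sorted_list_of_set {Max X<..<length (map y ?bs)})))
      = sc (of_int (block_inner_sign e (Q - ?N ` X) (?N ` X)))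
          (F (map y (msort {B \<in> Q - ?N ` X. Max B < Max (\<Union>(?N ` X))}) @ g (map y (msort (?N ` X)))
            # map y (msort {B \<in> Q - ?N ` X. Max (\<Union>(?N ` X)) < Max B})))"
      unfolding sign[OF X] pre[OF X, symmetric] post[OF X, symmetric] sub_def length_map
      using m X by simp
  qed
qed

text \<open>The sign of the configuration in which the blocks of \<open>R\<close> have been merged to \<open>S = \<Union>R\<close> next to the
  blocks \<open>T\<close>, with an odd operator acting on \<open>S\<close>. It does not depend on how \<open>S\<close> is subdivided, which is
  what makes the grouping by \<open>S\<close> possible.\<close>

definition merge_sign :: "(nat \<Rightarrow> int) \<Rightarrow> nat set \<Rightarrow> nat set set \<Rightarrow> int" where
  "merge_sign d S T = part_sign d T * (\<Prod>B\<in>T. if Max B < Max S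
      then deg_sign (\<Sum>a\<in>B. d a) * cross_sign d B S else cross_sign d S B)"

lemma cross_sign_sq: "cross_sign d A B * cross_sign d A B = 1"
  unfolding cross_sign_def prod.distrib[symmetric]
  by (intro prod.neutral ballI) (simp add: wsign_def ksign_sq)

lemma part_sign_Un:
  assumes "blocks (R \<union> T)" "R \<inter> T = {}"
  shows "part_sign d (R \<union> T) = part_sign d R * part_sign d T
    * (\<Prod>B\<in>T. \<Prod>C\<in>R. if Max B < Max C then cross_sign d B C else cross_sign d C B)"
proof -
  \<comment> \<open>Padding with 1 turns the product over ordered pairs into one over a full square,
    which can be split along \<open>R\<close> and \<open>T\<close>.\<close>
  define h where "h = (\<lambda>B C. if Max B < Max C then cross_sign d B C else 1)"
  have fin: "finite R" "finite T" using assms by (auto simp: blocks_def)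
  have ps: "part_sign d P = (\<Prod>B\<in>P. \<Prod>C\<in>P. h B C)" if "finite P" for P
    unfolding part_sign_def h_def
    using that by (intro prod.cong refl prod.mono_neutral_cong_left) auto
  have "part_sign d (R \<union> T) = (\<Prod>B\<in>R. \<Prod>C\<in>R. h B C) * (\<Prod>B\<in>R. \<Prod>C\<in>T. h B C)
     * ((\<Prod>B\<in>T. \<Prod>C\<in>R. h B C) * (\<Prod>B\<in>T. \<Prod>C\<in>T. h B C))"
    using fin assms by (simp add: ps prod.union_disjoint prod.distrib)
  also have "(\<Prod>B\<in>R. \<Prod>C\<in>T. h B C) = (\<Prod>B\<in>T. \<Prod>C\<in>R. h C B)" by (rule prod.swap)
  also have "(\<Prod>B\<in>R. \<Prod>C\<in>R. h B C) * (\<Prod>B\<in>T. \<Prod>C\<in>R. h C B)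
     * ((\<Prod>B\<in>T. \<Prod>C\<in>R. h B C) * (\<Prod>B\<in>T. \<Prod>C\<in>T. h B C))
     = part_sign d R * part_sign d T * (\<Prod>B\<in>T. \<Prod>C\<in>R. h B C * h C B)"
    using fin by (simp add: ps prod.distrib mult_ac)
  also have "(\<Prod>B\<in>T. \<Prod>C\<in>R. h B C * h C B)
     = (\<Prod>B\<in>T. \<Prod>C\<in>R. if Max B < Max C then cross_sign d B C else cross_sign d C B)"
  proof (intro prod.cong refl)
    fix B C assume BC: "B \<in> T" "C \<in> R"
    then have "Max B \<noteq> Max C"
      using inj_onD[OF blocks_inj_on_Max[OF assms(1)], of B C] assms(2) by auto
    then show "h B C * h C B = (if Max B < Max C then cross_sign d B C else cross_sign d C B)"
      by (auto simp: h_def)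
  qed
  finally show ?thesis .
qed

text \<open>The factors are compared separately for each \<open>B\<close> in \<open>T\<close>. If
  \<open>B\<close> precedes the union, \<open>block_inner_sign\<close> carries it past the blocks
  \<open>C\<close> of \<open>R\<close> that it followed, and \<open>ksign\<close> converts
  \<open>cross_sign d C B\<close> into \<open>cross_sign d B C\<close>; the factors then combine to
  the crossing of \<open>B\<close> with the whole union. If \<open>B\<close> follows the union, it
  already follows every block of \<open>R\<close>.\<close>

lemma merge_sign_eq:
  assumes bl: "blocks (R \<union> T)" and RT: "R \<inter> T = {}" and "R \<noteq> {}"
  shows "part_sign d (R \<union> T) * block_inner_sign (\<lambda>B. \<Sum>a\<in>B. d a) T R
    = merge_sign d (\<Union>R) T * part_sign d R"
proof -
  let ?e = "\<lambda>B. \<Sum>a\<in>B. d a"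
  have fin: "finite R" "finite T" and finB: "\<And>B. B \<in> R \<union> T \<Longrightarrow> finite B \<and> B \<noteq> {}"
    and dj: "disjoint (R \<union> T)" using bl by (auto simp: blocks_def)
  have djR: "disjoint R" using dj by (auto simp: pairwise_def)
  have U: "finite (\<Union>R)" "\<Union>R \<noteq> {}" using fin finB assms(3) by auto
  have factor: "(\<Prod>C\<in>R. if Max B < Max C then cross_sign d B C else cross_sign d C B)
       * (if Max B < Max (\<Union>R) then deg_sign (?e B) * (\<Prod>C\<in>R. if Max C < Max B then ksign (?e B) (?e C) else 1) else 1)
     = (if Max B < Max (\<Union>R) then deg_sign (?e B) * cross_sign d B (\<Union>R) else cross_sign d (\<Union>R) B)"
    if B: "B \<in> T" for B
  proof (cases "Max B < Max (\<Union>R)")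
    case True
    have "(\<Prod>C\<in>R. (if Max B < Max C then cross_sign d B C else cross_sign d C B)
        * (if Max C < Max B then ksign (?e B) (?e C) else 1)) = (\<Prod>C\<in>R. cross_sign d B C)"
    proof (intro prod.cong refl)
      fix C assume C: "C \<in> R"
      then have "Max B \<noteq> Max C"
        using inj_onD[OF blocks_inj_on_Max[OF bl], of B C] RT B by auto
      moreover have "disjnt B C" using pairwiseD[OF dj, of B C] B C RT by blast
      then have "ksign (?e B) (?e C) = cross_sign d B C * cross_sign d C B"
        using finB B C by (simp add: cross_sign_mult_swap)
      ultimately show "(if Max B < Max C then cross_sign d B C else cross_sign d C B)
        * (if Max C < Max B then ksign (?e B) (?e C) else 1) = cross_sign d B C"
        using cross_sign_sq[of d C B] by auto
    qed
    then show ?thesis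
      using True fin finB djR by (simp add: cross_sign_Union_right prod.distrib mult_ac)
  next
    case False
    have "Max C \<le> Max (\<Union>R)" if "C \<in> R" for C
      using that U finB by (intro Max_mono) auto
    then have "\<not> Max B < Max C" if "C \<in> R" for C using False that by fastforce
    then show ?thesis using False fin finB djR by (simp add: cross_sign_Union_left)
  qed
  have "block_inner_sign ?e T R = (\<Prod>B\<in>T. if Max B < Max (\<Union>R) then deg_sign (?e B)
      * (\<Prod>C\<in>R. if Max C < Max B then ksign (?e B) (?e C) else 1) else 1)"
    unfolding block_inner_sign_def using fin by (intro prod.mono_neutral_cong_left) auto
  then have "part_sign d (R \<union> T) * block_inner_sign ?e T R
     = part_sign d R * part_sign d T * (\<Prod>B\<in>T. if Max B < Max (\<Union>R)
          then deg_sign (?e B) * cross_sign d B (\<Union>R) else cross_sign d (\<Union>R) B)"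
    by (simp add: part_sign_Un[OF bl RT] prod.distrib[symmetric] mult.assoc factor)
  then show ?thesis by (simp add: merge_sign_def mult_ac)
qed

section \<open>Restriction to a subset of the indices\<close>

lemma sub_sub:
  assumes S: "finite S" and "B \<subseteq> {..<card S}"
  shows "sub (sub xs S) B = sub xs ((!) (sorted_list_of_set S) ` B)"
proof -
  have finB: "finite B" using assms finite_subset by blast
  have "strict_mono_on B ((!) (sorted_list_of_set S))"
    using assms(2) sorted_wrt_nth_less[of "(<)" "sorted_list_of_set S"]
    by (intro strict_mono_onI) auto
  then show ?thesis
    using assms finB by (auto simp: sub_def sorted_list_of_set_image)
qed

text \<open>The increasing enumeration of \<open>S\<close> transports partitions and preserves
  order, hence maxima, inversions and signs. Sums over sublists can thus be taken over subsets of
  the original index set.\<close>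

lemma outer_sum_sub:
  assumes S: "finite S" "S \<subseteq> {..<length ds}"
  shows "outer_sum sc (sub ds S) (sub xs S) F g
    = (\<Sum>P | partition_on S P. sc (of_int (part_sign ((!) ds) P)) (F (map (\<lambda>B. g (sub xs B)) (msort P))))"
proof -
  define m where "m = card S"
  define f where "f = (!) (sorted_list_of_set S)"
  have bij: "bij_betw f {..<m} S"
    unfolding f_def m_def using S by (intro bij_betw_nth) auto
  then have inj: "inj_on f {..<m}" and img: "f ` {..<m} = S" by (auto simp: bij_betw_def)
  have mono: "f a < f b" if "a < b" "b < m" for a b
    using sorted_wrt_nth_less[of "(<)" "sorted_list_of_set S"] that by (simp add: f_def m_def)
  then have smono: "strict_mono_on {..<m} f" by (intro strict_mono_onI) auto
  have mono_iff: "f a < f b \<longleftrightarrow> a < b" if "a < m" "b < m" for a b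
    using mono[of a b] mono[of b a] that by (metis linorder_neqE_nat order.asym)
  have part: "partition_on S ((`) f ` P)" if P: "partition_on {..<m} P" for P
  proof -
    have "{} \<notin> (`) f ` P" using P by (auto simp: partition_on_def)
    then show ?thesis using partition_on_inj_image[OF P inj] img by simp
  qed
  have part': "partition_on {..<m} ((`) (the_inv_into {..<m} f) ` P)" if P: "partition_on S P" for P
  proof -
    have "{} \<notin> (`) (the_inv_into {..<m} f) ` P" using P by (auto simp: partition_on_def)
    then show ?thesis using partition_on_inj_image[OF P, of "the_inv_into {..<m} f"] bij
      bij_betw_the_inv_into[OF bij] by (simp add: bij_betw_def)
  qed
  have bl: "B \<subseteq> {..<m} \<and> finite B \<and> B \<noteq> {}" if "partition_on {..<m} P" "B \<in> P" for P B
    using that by (auto simp: partition_on_def intro: finite_subset[of _ "{..<m}"])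
  have Max_f: "Max (f ` B) = f (Max B) \<and> Max B < m" if "partition_on {..<m} P" "B \<in> P" for P B
    using bl[OF that] Max_image_strict_mono[of B f] smono Max_in[of B]
    by (metis lessThan_iff monotone_on_subset subsetD)
  have injP: "inj_on ((`) f) P" if "partition_on {..<m} P" for P
    using bl[OF that] by (intro inj_on_subset[OF inj_on_image_Pow[OF inj]]) auto
  have cs: "cross_sign ((!) ds) (f ` A) (f ` B) = cross_sign ((!) (sub ds S)) A B"
    if AB: "A \<subseteq> {..<m}" "B \<subseteq> {..<m}" for A B
  proof -
    have "inj_on f A" "inj_on f B" using inj AB inj_on_subset by blast+
    moreover have "sub ds S ! a = ds ! f a" if "a < m" for a
      using that S by (simp add: sub_def f_def m_def)
    ultimately show ?thesis
      unfolding cross_sign_def wsign_def using AB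
      by (auto simp: prod.reindex mono_iff subset_iff intro!: prod.cong)
  qed
  have ps: "part_sign ((!) ds) ((`) f ` P) = part_sign ((!) (sub ds S)) P" if P: "partition_on {..<m} P" for P
  proof -
    have "{C \<in> (`) f ` P. Max (f ` B) < Max C} = (`) f ` {C \<in> P. Max B < Max C}" if "B \<in> P" for B
      using that Max_f[OF P] mono_iff by auto
    then show ?thesis
      unfolding part_sign_def
      using injP[OF P] bl[OF P] cs
      by (simp add: prod.reindex inj_on_subset[OF injP[OF P]])
  qed
  have ms: "msort ((`) f ` P) = map ((`) f) (msort P)" if P: "partition_on {..<m} P" for P
  proof (rule msort_unique[symmetric])
    have blP: "blocks P" using P partition_on_blocks by blast
    show "blocks ((`) f ` P)" using part[OF P] S partition_on_blocks by blast
    show "set (map ((`) f) (msort P)) = (`) f ` P" using blP by simp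
    show "sorted_wrt (\<lambda>A B. Max A < Max B) (map ((`) f) (msort P))"
      unfolding sorted_wrt_map
      using sorted_wrt_msort[OF blP] Max_f[OF P] mono_iff blP
      by (auto intro!: sorted_wrt_mono_rel[rotated, OF sorted_wrt_msort[OF blP]])
  qed
  have len: "length (sub xs S) = m" by (simp add: sub_def m_def)
  have "outer_sum sc (sub ds S) (sub xs S) F g
    = (\<Sum>P | partition_on {..<m} P. sc (of_int (part_sign ((!) (sub ds S)) P))
        (F (map (\<lambda>B. g (sub (sub xs S) B)) (msort P))))"
    unfolding outer_sum_def sum_ord_partitions len
    by (intro sum.cong refl) (auto simp: eps_msort partition_on_blocks)
  also have "\<dots> = (\<Sum>P | partition_on S P. sc (of_int (part_sign ((!) ds) P)) (F (map (\<lambda>B. g (sub xs B)) (msort P))))"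
  proof (rule sum.reindex_bij_witness[of _ "(`) ((`) (the_inv_into {..<m} f))" "(`) ((`) f)"])
    fix P assume "P \<in> {P. partition_on {..<m} P}"
    then have P: "partition_on {..<m} P" by simp
    show "(`) (the_inv_into {..<m} f) ` (`) f ` P = P"
    proof -
      have "the_inv_into {..<m} f ` f ` B = B" if "B \<in> P" for B
        using bl[OF P that] inj by (force simp: image_image the_inv_into_f_f subset_iff)
      then show ?thesis by (simp add: image_image)
    qed
    show "(`) f ` P \<in> {P. partition_on S P}" using part[OF P] by simp
    have "map (\<lambda>B. g (sub xs B)) (map ((`) f) (msort P)) = map (\<lambda>B. g (sub (sub xs S) B)) (msort P)"
      using bl[OF P] partition_on_blocks[OF P] S
      by (auto simp: sub_sub f_def m_def)
    then show "sc (of_int (part_sign ((!) ds) ((`) f ` P))) (F (map (\<lambda>B. g (sub xs B)) (msort ((`) f ` P))))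
       = sc (of_int (part_sign ((!) (sub ds S)) P)) (F (map (\<lambda>B. g (sub (sub xs S) B)) (msort P)))"
      unfolding ps[OF P] ms[OF P] by (simp only:)
  next
    fix P assume "P \<in> {P. partition_on S P}"
    then have P: "partition_on S P" by simp
    have "f ` the_inv_into {..<m} f ` B = B" if "B \<in> P" for B
    proof -
      have "B \<subseteq> S" using P that by (auto simp: partition_on_def)
      then have "\<And>b. b \<in> B \<Longrightarrow> f (the_inv_into {..<m} f b) = b"
        using img inj by (intro f_the_inv_into_f) auto
      then show ?thesis by (simp add: image_image)
    qed
    then show "(`) f ` (`) (the_inv_into {..<m} f) ` P = P" by (simp add: image_image)
    show "(`) (the_inv_into {..<m} f) ` P \<in> {P. partition_on {..<m} P}" using part'[OF P] by simp
  qed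
  finally show ?thesis .
qed

section \<open>Multilinear families and inversion of the composition\<close>

abbreviation lin :: "('k::field \<Rightarrow> 'v::ab_group_add \<Rightarrow> 'v) \<Rightarrow> ('k \<Rightarrow> 'w::ab_group_add \<Rightarrow> 'w) \<Rightarrow> ('v \<Rightarrow> 'w) \<Rightarrow> bool" where
  "lin \<equiv> Vector_Spaces.linear"

lemma lin_iff: "lin s1 s2 f \<longleftrightarrow> vector_space s1 \<and> vector_space s2
    \<and> (\<forall>x y. f (x + y) = f x + f y) \<and> (\<forall>c x. f (s1 c x) = s2 c (f x))"
  by (rule linear_iff)

lemma lin_zero: "lin s1 s2 f \<Longrightarrow> f 0 = 0"
  unfolding lin_iff by (metis add_cancel_right_right)

lemma lin_add: "lin s1 s2 f \<Longrightarrow> f (x + y) = f x + f y"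
  by (simp add: lin_iff)

lemma lin_sum:
  assumes "lin s1 s2 f"
  shows "f (sum g A) = (\<Sum>a\<in>A. f (g a))"
  by (induction A rule: infinite_finite_induct)
    (simp_all add: lin_zero[OF assms] lin_add[OF assms])

lemma lin_diff: "lin s1 s2 f \<Longrightarrow> f (x - y) = f x - f y"
  unfolding lin_iff by (metis diff_add_cancel eq_diff_eq)

lemma lin_scale: "lin s1 s2 f \<Longrightarrow> f (s1 c x) = s2 c (f x)"
  by (simp add: lin_iff)

lemma lin_comp: "lin s1 s2 f \<Longrightarrow> lin s2 s3 g \<Longrightarrow> lin s1 s3 (\<lambda>x. g (f x))"
  by (simp add: lin_iff)

lemma vector_space_simps:
  assumes "vector_space s"
  shows "s a (x + y) = s a x + s a y" "s (a + b) x = s a x + s b x" "s a (s b x) = s (a * b) x"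
    "s 1 x = x" "s a 0 = 0" "s 0 x = 0" "s a (x - y) = s a x - s a y" "s a (sum f A) = (\<Sum>i\<in>A. s a (f i))"
    "s (a - b) x = s a x - s b x" "s (- a) x = - s a x"
proof -
  interpret vector_space s by fact
  show "s a (x + y) = s a x + s a y" "s (a + b) x = s a x + s b x" "s a (s b x) = s (a * b) x"
    "s 1 x = x" "s a 0 = 0" "s 0 x = 0" "s a (x - y) = s a x - s a y" "s a (sum f A) = (\<Sum>i\<in>A. s a (f i))"
    "s (a - b) x = s a x - s b x" "s (- a) x = - s a x"
    by (simp_all add: scale_right_distrib scale_left_distrib scale_right_diff_distrib
        scale_left_diff_distrib scale_sum_right)
qed

lemma lin_vs: "lin s1 s2 f \<Longrightarrow> vector_space s1" "lin s1 s2 f \<Longrightarrow> vector_space s2"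
  by (simp_all add: lin_iff)

lemma lin_minus_fun:
  assumes "lin s1 s2 f" "lin s1 s2 g"
  shows "lin s1 s2 (\<lambda>x. f x - g x)"
  unfolding lin_iff
  by (simp add: lin_vs[OF assms(1)] lin_add[OF assms(1)] lin_add[OF assms(2)]
      lin_scale[OF assms(1)] lin_scale[OF assms(2)] vector_space_simps(7)[OF lin_vs(2)[OF assms(1)]])

lemma lin_scale_fun:
  assumes "lin s1 s2 f"
  shows "lin s1 s2 (\<lambda>x. s2 c (f x))"
  unfolding lin_iff
  by (simp add: lin_vs[OF assms] lin_add[OF assms] lin_scale[OF assms]
      vector_space_simps(1,3)[OF lin_vs(2)[OF assms]] mult.commute)

lemma lin_sum_fun:
  assumes "vector_space s1" "vector_space s2" "\<And>i. i \<in> A \<Longrightarrow> lin s1 s2 (f i)"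
  shows "lin s1 s2 (\<lambda>x. \<Sum>i\<in>A. f i x)"
  unfolding lin_iff using assms(1,2) lin_add[OF assms(3)] lin_scale[OF assms(3)]
  by (simp add: vector_space_simps(8)[OF assms(2)] sum.distrib)

text \<open>Linearity is kept apart from degree and symmetry because the inverse family is first
  constructed as a multilinear one; the other two properties are proved afterwards.\<close>

definition multilin :: "('k::field \<Rightarrow> 'v::ab_group_add \<Rightarrow> 'v) \<Rightarrow> ('k \<Rightarrow> 'w::ab_group_add \<Rightarrow> 'w) \<Rightarrow> nat \<Rightarrow> ('v list \<Rightarrow> 'w) \<Rightarrow> bool" where
  "multilin s1 s2 n f \<longleftrightarrow> (\<forall>xs j. length xs = n \<and> j < n \<longrightarrow> lin s1 s2 (\<lambda>v. f (xs[j := v])))"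

lemma multilin_zero:
  assumes "multilin s1 s2 (length xs) f" "j < length xs" "xs ! j = 0"
  shows "f xs = 0"
proof -
  have "lin s1 s2 (\<lambda>v. f (xs[j := v]))" using assms by (simp add: multilin_def)
  from lin_zero[OF this] show ?thesis using assms(3) by (metis list_update_id)
qed

section \<open>Evaluation of a family on the blocks of a partition\<close>

lemma length_sub [simp]: "length (sub xs B) = card B"
  by (simp add: sub_def)

lemma sub_all: "sub xs {..<length xs} = xs"
  by (auto simp: sub_def lessThan_atLeast0 intro: map_nth)

lemma sub_update_other: "finite B \<Longrightarrow> j \<notin> B \<Longrightarrow> sub (xs[j := v]) B = sub xs B"
  by (auto simp: sub_def intro!: nth_list_update_neq)

lemma sub_update:
  assumes "finite B" "j \<in> B" "B \<subseteq> {..<length xs}"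
  shows "\<exists>p<card B. \<forall>v. sub (xs[j := v]) B = (sub xs B)[p := v]"
proof -
  obtain p where p: "p < card B" "sorted_list_of_set B ! p = j"
    using assms by (metis in_set_conv_nth length_sorted_list_of_set set_sorted_list_of_set)
  have "sub (xs[j := v]) B = (sub xs B)[p := v]" for v
  proof (rule nth_equalityI)
    fix i assume "i < length (sub (xs[j := v]) B)"
    then have i: "i < card B" by simp
    have "sorted_list_of_set B ! i = j \<longleftrightarrow> i = p"
      using p i by (metis distinct_sorted_list_of_set length_sorted_list_of_set nth_eq_iff_index_eq)
    moreover have "j < length xs" using assms by auto
    ultimately show "sub (xs[j := v]) B ! i = (sub xs B)[p := v] ! i"
      using i p by (auto simp: sub_def nth_list_update)
  qed simp
  with p show ?thesis by blast
qed

lemma partition_block: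
  fixes n :: nat
  assumes "partition_on {..<n} P" "B \<in> P"
  shows "B \<subseteq> {..<n}" "finite B" "B \<noteq> {}"
proof -
  show sub: "B \<subseteq> {..<n}" using partition_onD1[OF assms(1)] assms(2) by blast
  show "B \<noteq> {}" using partition_onD3[OF assms(1)] assms(2) by blast
  show "finite B" using finite_subset[OF sub] by simp
qed

text \<open>Provides the descent for the recursion that inverts the composition and for the
  inductions about its result.\<close>

lemma partition_card_less:
  assumes "partition_on {..<n} P" "B \<in> P" "P \<noteq> {{..<n}}"
  shows "card B < n"
proof -
  have "B \<noteq> {..<n}"
  proof
    assume B: "B = {..<n}"
    have "C = B" if "C \<in> P" for C
    proof (rule ccontr)
      assume "C \<noteq> B"
      then have "C \<inter> B = {}" using partition_onD2[OF assms(1)] assms(2) that by (auto simp: disjoint_def)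
      then show False using partition_block(1,3)[OF assms(1) that] B by blast
    qed
    then have "P = {B}" using assms(2) by blast
    then show False using B assms by simp
  qed
  then have "B \<subset> {..<n}" using partition_block(1)[OF assms(1,2)] by blast
  then show ?thesis using psubset_card_mono[of "{..<n}" B] by simp
qed

text \<open>An index lies in exactly one block, so changing one entry changes exactly one argument
  of the outer map. This is why the composite is linear in each entry.\<close>

lemma map_blocks_update:
  assumes P: "partition_on {..<length zs} P" and j: "j < length zs"
  obtains i B p where "i < card P" "B \<in> P" "j \<in> B" "p < card B"
    "\<And>v. map (\<lambda>B. f (sub (zs[j := v]) B)) (msort P) = (map (\<lambda>B. f (sub zs B)) (msort P))[i := f ((sub zs B)[p := v])]"
proof -
  have bl: "blocks P" using P partition_on_blocks by blast
  obtain B where B: "B \<in> P" "j \<in> B" using P j by (auto simp: partition_on_def)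
  obtain i where i: "i < card P" "msort P ! i = B"
    using B bl by (metis in_set_conv_nth length_msort set_msort)
  note fB = partition_block[OF P]
  obtain p where p: "p < card B" "\<And>v. sub (zs[j := v]) B = (sub zs B)[p := v]"
    using sub_update[of B j zs] fB[OF B(1)] B by blast
  have "map (\<lambda>B. f (sub (zs[j := v]) B)) (msort P) = (map (\<lambda>B. f (sub zs B)) (msort P))[i := f ((sub zs B)[p := v])]" for v
  proof (rule nth_equalityI)
    fix a assume "a < length (map (\<lambda>B. f (sub (zs[j := v]) B)) (msort P))"
    then have a: "a < card P" using bl by (simp add: length_msort)
    show "map (\<lambda>B. f (sub (zs[j := v]) B)) (msort P) ! a
       = (map (\<lambda>B. f (sub zs B)) (msort P))[i := f ((sub zs B)[p := v])] ! a"
    proof (cases "a = i")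
      case True
      then show ?thesis using a i p bl by (simp add: length_msort)
    next
      case False
      have "msort P ! a \<in> P" using a bl by (metis length_msort nth_mem set_msort)
      moreover have "msort P ! a \<noteq> B"
        using False a i bl by (metis distinct_msort length_msort nth_eq_iff_index_eq)
      ultimately have "j \<notin> msort P ! a" "finite (msort P ! a)"
        using B fB partition_onD2[OF P] unfolding disjoint_def by blast+
      then show ?thesis using False a bl by (simp add: length_msort sub_update_other)
    qed
  qed simp
  then show thesis by (rule that[OF i(1) B p(1)])
qed

lemma lin_blocks:
  assumes P: "partition_on {..<length zs} P" and j: "j < length zs"
    and M: "\<And>n. 1 \<le> n \<Longrightarrow> multilin s2 s3 n M"
    and f: "\<And>B. B \<in> P \<Longrightarrow> multilin s1 s2 (card B) f"
  shows "lin s1 s3 (\<lambda>v. M (map (\<lambda>B. f (sub (zs[j := v]) B)) (msort P)))"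
proof -
  obtain i B p where *: "i < card P" "B \<in> P" "j \<in> B" "p < card B"
    and eq: "\<And>v. map (\<lambda>B. f (sub (zs[j := v]) B)) (msort P) = (map (\<lambda>B. f (sub zs B)) (msort P))[i := f ((sub zs B)[p := v])]"
    by (rule map_blocks_update[OF P j, where f = f]) (rule that)
  have "multilin s2 s3 (card P) M" using * by (intro M) simp
  then have l1: "lin s2 s3 (\<lambda>w. M ((map (\<lambda>B. f (sub zs B)) (msort P))[i := w]))"
    using * P by (simp add: multilin_def length_msort partition_on_blocks)
  have l2: "lin s1 s2 (\<lambda>v. f ((sub zs B)[p := v]))"
    using f[OF *(2)] * by (simp add: multilin_def)
  show ?thesis unfolding eq by (rule lin_comp[OF l2 l1])
qed

text \<open>The grading is given only by existence and independence of finite decompositions, so the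
  projection onto the degrees in \<open>J\<close> starts as the relation \<open>r\<close>.
  Components are required to be zero outside \<open>I\<close>, which lets two decompositions be
  combined over the union of their index sets; \<open>r\<close> is then linear, and independence
  makes it single-valued.\<close>

lemma graded_projection:
  fixes sc :: "'k::field \<Rightarrow> 'v::ab_group_add \<Rightarrow> 'v"
  assumes "graded_vs sc G"
  obtains p where "lin sc sc p" "\<And>i v. i \<in> J \<Longrightarrow> v \<in> G i \<Longrightarrow> p v = v"
    "\<And>i v. i \<notin> J \<Longrightarrow> v \<in> G i \<Longrightarrow> p v = 0"
proof -
  note gr = assms[unfolded graded_vs_def]
  have vs: "vector_space sc" using gr by (rule conjunct1)
  have ss: "module.subspace sc (G i)" for i
    using gr[THEN conjunct2, THEN conjunct1] by (rule spec)
  have ex: "\<exists>I f. finite I \<and> (\<forall>i. f i \<in> G i) \<and> v = sum f I" for v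
    using gr[THEN conjunct2, THEN conjunct2, THEN conjunct1] by (rule spec)
  have ind: "\<forall>i\<in>I. f i = 0" if "finite I" "\<forall>i\<in>I. f i \<in> G i" "sum f I = 0" for I f
    using gr[THEN conjunct2, THEN conjunct2, THEN conjunct2, rule_format, of I f] that by blast
  interpret vector_space sc by fact
  define r where "r v w \<longleftrightarrow> (\<exists>I f. finite I \<and> (\<forall>i. f i \<in> G i) \<and> (\<forall>i. i \<notin> I \<longrightarrow> f i = 0)
      \<and> v = sum f I \<and> w = sum f (I \<inter> J))" for v w
  have G0: "0 \<in> G i" for i using ss subspace_0 by blast
  have r_ex: "\<exists>w. r v w" for v
  proof -
    obtain I f where If: "finite I" "\<forall>i. f i \<in> G i" "v = sum f I" using ex by blast
    let ?f = "\<lambda>i. if i \<in> I then f i else 0"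
    have "r v (sum ?f (I \<inter> J))" unfolding r_def
      by (rule exI[of _ I], rule exI[of _ ?f]) (use If G0 in auto)
    then show ?thesis by blast
  qed
  have r_add: "r (sc a v + sc b v') (sc a w + sc b w')" if rs: "r v w" "r v' w'" for v w v' w' a b
  proof -
    obtain I f where 1: "finite I" "\<forall>i. f i \<in> G i" "\<forall>i. i \<notin> I \<longrightarrow> f i = 0" "v = sum f I" "w = sum f (I \<inter> J)"
      using rs(1) unfolding r_def by blast
    obtain I' f' where 2: "finite I'" "\<forall>i. f' i \<in> G i" "\<forall>i. i \<notin> I' \<longrightarrow> f' i = 0" "v' = sum f' I'" "w' = sum f' (I' \<inter> J)"
      using rs(2) unfolding r_def by blast
    let ?g = "\<lambda>i. sc a (f i) + sc b (f' i)" let ?U = "I \<union> I'"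
    have e: "v = sum f ?U" "w = sum f (?U \<inter> J)" "v' = sum f' ?U" "w' = sum f' (?U \<inter> J)"
      using 1 2 by (auto intro!: sum.mono_neutral_left)
    have "finite ?U" "\<forall>i. ?g i \<in> G i" "\<forall>i. i \<notin> ?U \<longrightarrow> ?g i = 0"
      using 1 2 ss by (auto intro!: subspace_add subspace_scale)
    moreover have "sc a v + sc b v' = sum ?g ?U" "sc a w + sc b w' = sum ?g (?U \<inter> J)"
      unfolding e sum.distrib scale_sum_right by (rule refl)+
    ultimately show ?thesis unfolding r_def by (intro exI[of _ ?U] exI[of _ ?g] conjI)
  qed
  have r_0: "w = 0" if rv: "r v w" and v0: "v = 0" for v w
  proof -
    obtain I f where If: "finite I" "\<forall>i. f i \<in> G i" "\<forall>i. i \<notin> I \<longrightarrow> f i = 0" "v = sum f I" "w = sum f (I \<inter> J)"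
      using rv unfolding r_def by blast
    have "\<forall>i\<in>I. f i = 0" using If(1,2,4) v0 by (intro ind) auto
    then show ?thesis unfolding If(5) by (intro sum.neutral) auto
  qed
  have r_un: "w = w'" if "r v w" "r v w'" for v w w'
    using r_0[OF r_add[OF that, of 1 "- 1"]] by simp
  define p where "p v = (SOME w. r v w)" for v
  have rp: "r v (p v)" for v unfolding p_def using r_ex by (rule someI_ex)
  have p_eq: "p v = w" if "r v w" for v w using r_un[OF rp that] .
  have "lin sc sc p"
    unfolding lin_iff
  proof (intro conjI allI vs)
    show "p (x + y) = p x + p y" for x y using r_add[OF rp rp, of 1 x 1 y] by (intro p_eq) simp
    show "p (sc c x) = sc c (p x)" for c x using r_add[OF rp rp, of c x 0 x] by (intro p_eq) simp
  qed
  moreover have rg: "r v (if i \<in> J then v else 0)" if "v \<in> G i" for i v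
    unfolding r_def
    by (rule exI[of _ "{i}"], rule exI[of _ "\<lambda>j. if j = i then v else 0"]) (use that G0 in auto)
  have "\<And>i v. i \<in> J \<Longrightarrow> v \<in> G i \<Longrightarrow> p v = v" using p_eq[OF rg] by simp
  moreover have "\<And>i v. i \<notin> J \<Longrightarrow> v \<in> G i \<Longrightarrow> p v = 0" using p_eq[OF rg] by simp
  ultimately show thesis by (rule that)
qed

lemma outer_sum_eq:
  "outer_sum sc ds xs F g = (\<Sum>P | partition_on {..<length xs} P.
     sc (of_int (part_sign ((!) ds) P)) (F (map (\<lambda>B. g (sub xs B)) (msort P))))"
  unfolding outer_sum_def sum_ord_partitions
  by (intro sum.cong refl) (auto simp: eps_msort partition_on_blocks)

text \<open>The signs need homogeneous arguments but depend only on parities, so on arbitrary arguments the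
  recursion for \<open>\<phi>\<close> sums over the finitely many ways to replace every argument by its even or odd part.\<close>

lemma exists_compositional_preimage:
  fixes scH :: "'k::field \<Rightarrow> 'h::ab_group_add \<Rightarrow> 'h" and sc :: "'k \<Rightarrow> 'v::ab_group_add \<Rightarrow> 'v"
  assumes gr: "graded_vs scH GH" and vs: "vector_space sc"
    and M: "\<And>n. 1 \<le> n \<Longrightarrow> multilin sc sc n M" and M1: "\<And>x. M [x] = x"
    and \<Phi>: "\<And>n. 1 \<le> n \<Longrightarrow> multilin scH sc n \<Phi>"
  obtains \<phi> where "\<And>n. 1 \<le> n \<Longrightarrow> multilin scH sc n \<phi>"
    "\<And>xs ds. xs \<noteq> [] \<Longrightarrow> homog GH xs ds \<Longrightarrow> outer_sum sc ds xs M \<phi> = \<Phi> xs"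
proof -
  have vsH: "vector_space scH" using gr[unfolded graded_vs_def] by (rule conjunct1)
  have "\<exists>p. lin scH scH p \<and> (\<forall>i v. i mod 2 = a \<longrightarrow> v \<in> GH i \<longrightarrow> p v = v)
     \<and> (\<forall>i v. i mod 2 \<noteq> a \<longrightarrow> v \<in> GH i \<longrightarrow> p v = 0)" for a :: int
    by (rule graded_projection[OF gr, of "{i. i mod 2 = a}"]) auto
  then obtain par where par: "\<And>a. lin scH scH (par a)"
    "\<And>a i v. i mod 2 = a \<Longrightarrow> v \<in> GH i \<Longrightarrow> par a v = v"
    "\<And>a i v. i mod 2 \<noteq> a \<Longrightarrow> v \<in> GH i \<Longrightarrow> par a v = 0"
    by metis
  \<comment> \<open>The one-block partition is left out: its term is \<open>\<phi> xs\<close>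
    itself, because \<open>M\<close> is the identity on one argument. All other terms evaluate
    \<open>\<phi>\<close> on shorter lists.\<close>
  define proper where "proper n = {P. partition_on {..<n} P} - {{{..<n}}}" for n :: nat
  define pars where "pars n = {ps. set ps \<subseteq> {0, 1 :: int} \<and> length ps = n}" for n
  \<comment> \<open>The parity list also serves as the list of degrees, so the sign is a constant
    coefficient and the term is linear in each entry of \<open>xs\<close>.\<close>
  define T where "T f xs P ps = sc (of_int (part_sign ((!) ps) P)) (M (map (\<lambda>B. f (sub (map2 par ps xs) B)) (msort P)))"
    for f :: "'h list \<Rightarrow> 'v" and xs P ps
  define F where "F f xs = \<Phi> xs - (\<Sum>P\<in>proper (length xs). \<Sum>ps\<in>pars (length xs). T f xs P ps)"
    for f :: "'h list \<Rightarrow> 'v" and xs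
  have fin: "finite (pars n)" "finite {P. partition_on {..<n} P}" for n
    unfolding pars_def by (auto intro: finite_lists_length_eq finitely_many_partition_on)
  have "adm_wf (measure length) F"
    unfolding adm_wf_def
  proof (intro allI impI)
    fix f g :: "'h list \<Rightarrow> 'v" and xs :: "'h list"
    assume fg: "\<forall>z. (z, xs) \<in> measure length \<longrightarrow> f z = g z"
    have "T f xs P ps = T g xs P ps" if "P \<in> proper (length xs)" "ps \<in> pars (length xs)" for P ps
    proof -
      have "f (sub (map2 par ps xs) B) = g (sub (map2 par ps xs) B)" if "B \<in> P" for B
        using fg partition_card_less[of "length xs" P B] \<open>P \<in> _\<close> that by (simp add: proper_def)
      moreover have "set (msort P) = P" using that partition_on_blocks[of "{..<length xs}" P] by (simp add: proper_def)
      ultimately show ?thesis unfolding T_def by (metis (mono_tags, lifting) map_cong)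
    qed
    then show "F f xs = F g xs" unfolding F_def by simp
  qed
  then obtain \<phi> where "\<phi> = F \<phi>" using wfrec_fixpoint[OF wf_measure] by metis
  then have \<phi>: "\<phi> xs = F \<phi> xs" for xs by metis
  have ml: "multilin scH sc n \<phi>" if "1 \<le> n" for n
    using that
  proof (induction n rule: less_induct)
    case (less n)
    show ?case unfolding multilin_def
    proof (intro allI impI)
      fix xs :: "'h list" and j assume "length xs = n \<and> j < n"
      then have len: "length xs = n" and j: "j < n" by auto
      have T: "lin scH sc (\<lambda>v. T \<phi> (xs[j := v]) P ps)" if P: "P \<in> proper n" and ps: "ps \<in> pars n" for P ps
      proof -
        have P': "partition_on {..<n} P" "P \<noteq> {{..<n}}" using P by (auto simp: proper_def)
        have eq: "map2 par ps (xs[j := v]) = (map2 par ps xs)[j := par (ps ! j) v]" for v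
          using len ps j by (intro nth_equalityI) (auto simp: pars_def nth_list_update)
        have "lin scH sc (\<lambda>v. M (map (\<lambda>B. \<phi> (sub ((map2 par ps xs)[j := v]) B)) (msort P)))"
        proof (rule lin_blocks[OF _ _ M])
          fix B assume B: "B \<in> P"
          then show "multilin scH sc (card B) \<phi>"
            using partition_card_less[OF P'(1) B P'(2)] partition_block[OF P'(1) B]
            by (intro less.IH) (auto simp: Suc_le_eq card_gt_0_iff)
        qed (use P' len ps j in \<open>auto simp: pars_def\<close>)
        from lin_comp[OF par(1) this] show ?thesis unfolding T_def eq by (rule lin_scale_fun)
      qed
      have "lin scH sc (\<lambda>v. \<Phi> (xs[j := v]))" using \<Phi>[OF less.prems] len j by (simp add: multilin_def)
      then have "lin scH sc (\<lambda>v. \<Phi> (xs[j := v]) - (\<Sum>P\<in>proper n. \<Sum>ps\<in>pars n. T \<phi> (xs[j := v]) P ps))"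
        by (intro lin_minus_fun lin_sum_fun vs vsH T)
      then show "lin scH sc (\<lambda>v. \<phi> (xs[j := v]))"
        unfolding \<phi>[of "_[_ := _]"] unfolding F_def by (simp add: len)
    qed
  qed
  have "outer_sum sc ds xs M \<phi> = \<Phi> xs" if "xs \<noteq> []" and h: "homog GH xs ds" for xs ds
  proof -
    let ?n = "length xs"
    let ?ps = "map (\<lambda>d. d mod 2) ds"
    let ?t = "\<lambda>P. sc (of_int (part_sign ((!) ds) P)) (M (map (\<lambda>B. \<phi> (sub xs B)) (msort P)))"
    have n: "1 \<le> ?n" using that by (simp add: Suc_le_eq)
    have hd: "length ds = ?n" "\<And>j. j < ?n \<Longrightarrow> xs ! j \<in> GH (ds ! j)" using h by (auto simp: homog_def)
    have whole: "partition_on {..<?n} {{..<?n}}" using that(1) by (intro partition_on_space) auto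
    have T: "(\<Sum>ps\<in>pars ?n. T \<phi> xs P ps) = ?t P" if P: "P \<in> proper ?n" for P
    proof -
      have P': "partition_on {..<?n} P" using P by (auto simp: proper_def)
      have ps0: "?ps \<in> pars ?n" using hd(1) by (auto simp: pars_def)
      \<comment> \<open>A parity list that disagrees with the degrees at some place replaces a
        homogeneous argument by its component of the wrong parity, which is zero.\<close>
      have "T \<phi> xs P ps = 0" if ps: "ps \<in> pars ?n - {?ps}" for ps
      proof -
        let ?zs = "map2 par ps xs"
        have lps: "length ps = ?n" using ps by (simp add: pars_def)
        obtain j where j: "j < ?n" "ps ! j \<noteq> ds ! j mod 2"
          using ps hd(1) lps nth_equalityI[of ps ?ps] by (metis DiffD2 insertI1 length_map nth_map)
        have z: "?zs ! j = 0" using j lps par(3)[OF j(2)[symmetric] hd(2)[OF j(1)]] by simp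
        have "lin scH sc (\<lambda>v. M (map (\<lambda>B. \<phi> (sub (?zs[j := v]) B)) (msort P)))"
        proof (rule lin_blocks[OF _ _ M])
          fix B assume "B \<in> P"
          then show "multilin scH sc (card B) \<phi>"
            using partition_block[OF P'] by (intro ml) (auto simp: Suc_le_eq card_gt_0_iff)
        qed (use P' j lps in auto)
        from lin_zero[OF this] have "M (map (\<lambda>B. \<phi> (sub ?zs B)) (msort P)) = 0"
          using z by (metis list_update_id)
        then show ?thesis by (simp add: T_def vector_space_simps(5)[OF vs])
      qed
      then have "(\<Sum>ps\<in>pars ?n. T \<phi> xs P ps) = T \<phi> xs P ?ps"
        using ps0 fin(1) by (simp add: sum.remove[of _ ?ps])
      moreover have "map2 par ?ps xs = xs"
        using hd par(2) by (intro nth_equalityI) auto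
      moreover have "part_sign ((!) ?ps) P = part_sign ((!) ds) P"
        using P' hd(1) by (intro part_sign_cong) (auto simp: partition_on_def even_iff_mod_2_eq_zero)
      ultimately show ?thesis by (simp add: T_def)
    qed
    have "outer_sum sc ds xs M \<phi> = ?t {{..<?n}} + (\<Sum>P\<in>proper ?n. ?t P)"
      unfolding outer_sum_eq proper_def using whole fin(2) by (subst sum.remove) auto
    also have "?t {{..<?n}} = \<phi> xs"
      using msort_single[of "{..<?n}"] that(1) by (simp add: M1 sub_all vector_space_simps(4)[OF vs] lessThan_empty_iff)
    also have "(\<Sum>P\<in>proper ?n. ?t P) = \<Phi> xs - \<phi> xs"
      using \<phi>[of xs] T by (simp add: F_def)
    finally show ?thesis by simp
  qed
  with ml show thesis by (rule that)
qed

section \<open>Permutation of blocks\<close>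

lemma blocks_sign_append:
  "disjoint_list (u @ w) \<Longrightarrow>
    blocks_sign d (u @ w) = blocks_sign d u * cross_sign d (\<Union>(set u)) (\<Union>(set w)) * blocks_sign d w"
proof (induction u)
  case (Cons A u)
  have dj: "disjoint_list (u @ w)" and A: "finite A" "A \<inter> (\<Union>(set u) \<union> \<Union>(set w)) = {}"
    using Cons.prems by (auto simp: disjoint_list_Cons)
  have fin: "finite (\<Union>(set u))" "finite (\<Union>(set w))" using dj by (auto simp: disjoint_list_def)
  have "X \<inter> Y = {}" if "X \<in> set u" "Y \<in> set w" for X Y
  proof -
    have "X \<noteq> Y" using dj that by (auto simp: disjoint_list_def)
    then show ?thesis using dj that by (simp add: disjoint_list_def disjoint_def)
  qed
  then have djuw: "\<Union>(set u) \<inter> \<Union>(set w) = {}" by blast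
  show ?case
    using Cons.IH[OF dj] A fin djuw
    by (simp add: cross_sign_Un_right cross_sign_Un_left Int_Un_distrib mult_ac)
qed simp

lemma sym_mapD:
  assumes "sym_family s1 G1 s2 G2 k f" "1 \<le> length xs"
  shows "multilin s1 s2 (length xs) f"
    "homog G1 xs ds \<Longrightarrow> f xs \<in> G2 (sum_list ds + k)"
    "homog G1 xs ds \<Longrightarrow> Suc j < length xs \<Longrightarrow>
      f (swap_adj j xs) = s2 (of_int (ksign (ds ! j) (ds ! Suc j))) (f xs)"
proof -
  have sm: "sym_map s1 G1 s2 G2 k (length xs) f" using assms by (simp add: sym_family_def)
  show "multilin s1 s2 (length xs) f" using sm by (simp add: sym_map_def multilin_def)
  show "f xs \<in> G2 (sum_list ds + k)" if "homog G1 xs ds" using sm that by (simp add: sym_map_def)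
  show "f (swap_adj j xs) = s2 (of_int (ksign (ds ! j) (ds ! Suc j))) (f xs)"
    if "homog G1 xs ds" "Suc j < length xs"
    using sm[unfolded sym_map_def, THEN conjunct2, THEN conjunct2, rule_format, of xs ds j] that by simp
qed

lemma swap_adj_append: "swap_adj (length u) (u @ a # b # v) = u @ b # a # v"
  by (simp add: swap_adj_def nth_append list_update_append)

context
  fixes s1 :: "'k::field \<Rightarrow> 'v::ab_group_add \<Rightarrow> 'v" and s2 :: "'k \<Rightarrow> 'w::ab_group_add \<Rightarrow> 'w"
    and G1 G2 k F and y :: "nat set \<Rightarrow> 'v" and d :: "nat \<Rightarrow> int"
  assumes F: "sym_family s1 G1 s2 G2 k F" and vs2: "vector_space s2"
begin

text \<open>The sign of the word and the value of \<open>F\<close> change by the same factor, the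
  Koszul sign of the total degrees of \<open>A\<close> and \<open>B\<close>, and this factor squares
  to 1.\<close>

lemma sym_blocks_swap:
  assumes dj: "disjoint_list (u @ A # B # v)"
    and y: "\<And>C. C \<in> set (u @ A # B # v) \<Longrightarrow> y C \<in> G1 (\<Sum>a\<in>C. d a)"
  shows "s2 (of_int (blocks_sign d (u @ B # A # v))) (F (map y (u @ B # A # v)))
     = s2 (of_int (blocks_sign d (u @ A # B # v))) (F (map y (u @ A # B # v)))"
proof -
  let ?k = "ksign (\<Sum>a\<in>A. d a) (\<Sum>b\<in>B. d b)"
  let ?xs = "map y (u @ A # B # v)" and ?ds = "map (\<lambda>B. \<Sum>a\<in>B. d a) (u @ A # B # v)"
  have "homog G1 ?xs ?ds"
    unfolding homog_def
  proof (intro conjI allI impI)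
    fix j assume j: "j < length ?xs"
    then have "(u @ A # B # v) ! j \<in> set (u @ A # B # v)" by (intro nth_mem) simp
    from y[OF this] show "?xs ! j \<in> G1 (?ds ! j)" using j by (simp del: map_append list.map)
  qed simp
  from sym_mapD(3)[OF F _ this, of "length u"]
  have sw: "F (map y (u @ B # A # v)) = s2 (of_int ?k) (F ?xs)"
    using swap_adj_append[of "map y u" "y A" "y B" "map y v"] by (simp add: nth_append)
  have dj2: "disjoint_list (u @ B # A # v)"
    using dj by (auto simp: disjoint_list_def insert_commute)
  have djv: "disjoint_list (A # B # v)" using dj
    by (auto simp: disjoint_list_def pairwise_def)
  have AB: "finite A" "finite B" "A \<inter> B = {}" "A \<inter> \<Union>(set v) = {}" "B \<inter> \<Union>(set v) = {}" "finite (\<Union>(set v))"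
    using djv by (auto simp: disjoint_list_Cons) (auto simp: disjoint_list_def)
  have "?k = cross_sign d A B * cross_sign d B A"
    using AB by (simp add: cross_sign_mult_swap disjnt_def)
  then have k: "cross_sign d B A = ?k * cross_sign d A B"
    using cross_sign_sq[of d A B] by (simp add: mult.commute mult.left_commute)
  have "blocks_sign d (u @ B # A # v) = ?k * blocks_sign d (u @ A # B # v)"
    unfolding blocks_sign_append[OF dj] blocks_sign_append[OF dj2]
    using AB by (simp add: cross_sign_Un_right Int_commute k Un_left_commute mult_ac)
  moreover have "?k * blocks_sign d (u @ A # B # v) * ?k = blocks_sign d (u @ A # B # v)"
    using ksign_sq[of "\<Sum>a\<in>A. d a" "\<Sum>b\<in>B. d b"] by (simp add: mult_ac)
  ultimately show ?thesis
    unfolding sw vector_space_simps(3)[OF vs2] of_int_mult[symmetric] by (simp only:)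
qed

lemma sym_blocks_move:
  assumes "disjoint_list (u @ a @ x # b)"
    and "\<And>B. B \<in> set (u @ a @ x # b) \<Longrightarrow> y B \<in> G1 (\<Sum>a\<in>B. d a)"
  shows "s2 (of_int (blocks_sign d (u @ a @ x # b))) (F (map y (u @ a @ x # b)))
     = s2 (of_int (blocks_sign d (u @ x # a @ b))) (F (map y (u @ x # a @ b)))"
  using assms
proof (induction a arbitrary: b rule: rev_induct)
  case (snoc c a)
  have 1: "s2 (of_int (blocks_sign d ((u @ a) @ x # c # b))) (F (map y ((u @ a) @ x # c # b)))
     = s2 (of_int (blocks_sign d ((u @ a) @ c # x # b))) (F (map y ((u @ a) @ c # x # b)))"
    by (rule sym_blocks_swap) (use snoc.prems in auto)
  have "disjoint_list (u @ a @ x # c # b)"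
    using snoc.prems(1) by (auto simp: disjoint_list_def insert_commute)
  moreover have "y B \<in> G1 (\<Sum>a\<in>B. d a)" if "B \<in> set (u @ a @ x # c # b)" for B
    using snoc.prems(2)[of B] that by auto
  ultimately show ?case using snoc.IH[of "c # b"] 1 by simp
qed simp

lemma sym_blocks_perm_aux:
  assumes "mset bs = mset bs'" "disjoint_list (u @ bs)"
    and "\<And>B. B \<in> set (u @ bs) \<Longrightarrow> y B \<in> G1 (\<Sum>a\<in>B. d a)"
  shows "s2 (of_int (blocks_sign d (u @ bs))) (F (map y (u @ bs)))
     = s2 (of_int (blocks_sign d (u @ bs'))) (F (map y (u @ bs')))"
  using assms
proof (induction bs arbitrary: bs' u)
  case (Cons x xs)
  have "x \<in> set bs'" using Cons.prems(1) by (metis list.set_intros(1) mset_eq_setD)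
  then obtain a b where ab: "bs' = a @ x # b" by (meson split_list)
  have m: "mset xs = mset (a @ b)" using Cons.prems(1) ab by simp
  have st: "set bs' = set (x # xs)" "distinct (u @ bs') = distinct (u @ x # xs)"
    using Cons.prems(1) mset_eq_setD[OF Cons.prems(1)] mset_eq_imp_distinct_iff[of "u @ bs'" "u @ x # xs"] by auto
  have "disjoint_list (u @ a @ x # b)"
    using Cons.prems(2) st unfolding ab disjoint_list_def by simp
  moreover have "y B \<in> G1 (\<Sum>a\<in>B. d a)" if "B \<in> set (u @ a @ x # b)" for B
    using Cons.prems(3)[of B] that st(1) unfolding ab by auto
  ultimately
  have "s2 (of_int (blocks_sign d (u @ bs'))) (F (map y (u @ bs')))
     = s2 (of_int (blocks_sign d (u @ x # a @ b))) (F (map y (u @ x # a @ b)))"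
    unfolding ab by (rule sym_blocks_move)
  moreover have "s2 (of_int (blocks_sign d ((u @ [x]) @ xs))) (F (map y ((u @ [x]) @ xs)))
     = s2 (of_int (blocks_sign d ((u @ [x]) @ a @ b))) (F (map y ((u @ [x]) @ a @ b)))"
    by (rule Cons.IH[OF m]) (use Cons.prems in auto)
  ultimately show ?case by simp
qed simp

text \<open>Frees the signed value from the order of the blocks, so that it belongs to the partition
  as a set.\<close>

lemma sym_blocks_perm:
  assumes "distinct bs'" "set bs = set bs'" "disjoint_list bs"
    and "\<And>B. B \<in> set bs \<Longrightarrow> y B \<in> G1 (\<Sum>a\<in>B. d a)"
  shows "s2 (of_int (blocks_sign d bs)) (F (map y bs)) = s2 (of_int (blocks_sign d bs')) (F (map y bs'))"
  using sym_blocks_perm_aux[of bs bs' "[]"] assms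
  by (simp add: set_eq_iff_mset_eq_distinct disjoint_list_def)

end

section \<open>Adjacent transpositions of the arguments\<close>

definition adj_transp :: "nat \<Rightarrow> nat \<Rightarrow> nat" where
  "adj_transp j a = (if a = j then Suc j else if a = Suc j then j else a)"

lemma adj_transp_invol [simp]: "adj_transp j (adj_transp j a) = a"
  by (simp add: adj_transp_def)

lemma adj_transp_image_invol [simp]: "adj_transp j ` adj_transp j ` A = A"
  by (simp add: image_image)

lemma inj_adj_transp: "inj_on (adj_transp j) A"
  by (metis adj_transp_invol inj_onI)

lemma adj_transp_image_atMost: "Suc j < n \<Longrightarrow> adj_transp j ` {..<n} = {..<n}"
proof -
  assume "Suc j < n"
  then have *: "adj_transp j ` {..<n} \<subseteq> {..<n}" by (auto simp: adj_transp_def)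
  then have "adj_transp j ` adj_transp j ` {..<n} \<subseteq> adj_transp j ` {..<n}" by blast
  with * show ?thesis by simp
qed

lemma adj_transp_image_eq: "(j \<in> A \<longleftrightarrow> Suc j \<in> A) \<Longrightarrow> adj_transp j ` A = A"
proof -
  assume "j \<in> A \<longleftrightarrow> Suc j \<in> A"
  then have *: "adj_transp j ` A \<subseteq> A" by (auto simp: adj_transp_def)
  then have "adj_transp j ` adj_transp j ` A \<subseteq> adj_transp j ` A" by blast
  with * show ?thesis by simp
qed

lemma nth_swap_adj: "Suc j < length xs \<Longrightarrow> a < length xs \<Longrightarrow> swap_adj j xs ! a = xs ! adj_transp j a"
  by (simp add: swap_adj_def adj_transp_def nth_list_update)

lemma length_swap_adj [simp]: "length (swap_adj j xs) = length xs"
  by (simp add: swap_adj_def)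

lemma adj_transp_less: "Suc j < n \<Longrightarrow> a < n \<Longrightarrow> adj_transp j a < n"
  by (simp add: adj_transp_def)

text \<open>No index lies strictly between \<open>j\<close> and \<open>Suc j\<close>, so their
  transposition is increasing on every set that does not contain both.\<close>

lemma sub_swap_separate:
  assumes "B \<subseteq> {..<length xs}" "Suc j < length xs" "\<not> (j \<in> B \<and> Suc j \<in> B)"
  shows "sub (swap_adj j xs) (adj_transp j ` B) = sub xs B"
proof -
  have fin: "finite B" using finite_subset[OF assms(1)] by simp
  have "strict_mono_on B (adj_transp j)"
    using assms(3) by (intro strict_mono_onI) (auto simp: adj_transp_def split: if_splits)
  from sorted_list_of_set_image[OF fin this] show ?thesis
    using assms fin adj_transp_less[OF assms(2)]
    by (auto simp: sub_def nth_swap_adj subset_iff)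
qed

text \<open>For the same reason \<open>j\<close> and \<open>Suc j\<close> are consecutive in the
  enumeration of a block containing both, so the symmetry of the inner map can be applied
  there.\<close>

lemma sub_swap_together:
  assumes B: "B \<subseteq> {..<length xs}" "j \<in> B" "Suc j \<in> B" "length ds = length xs"
  obtains p where "Suc p < card B" "sub (swap_adj j xs) B = swap_adj p (sub xs B)"
    "sub ds B ! p = ds ! j" "sub ds B ! Suc p = ds ! Suc j"
proof -
  let ?l = "sorted_list_of_set B"
  have fin: "finite B" using finite_subset[OF assms(1)] by simp
  have mono: "?l ! a < ?l ! b" if "a < b" "b < card B" for a b
    using sorted_wrt_nth_less[of "(<)" ?l a b] that by simp
  obtain p q where p: "p < card B" "?l ! p = j" and q: "q < card B" "?l ! q = Suc j"
    using B fin by (metis in_set_conv_nth length_sorted_list_of_set set_sorted_list_of_set)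
  have "p < q" using mono[of q p] p q by (metis lessI less_asym linorder_neqE_nat n_not_Suc_n)
  moreover have "\<not> Suc p < q"
  proof
    assume "Suc p < q"
    then have "j < ?l ! Suc p" "?l ! Suc p < Suc j" using mono[of p "Suc p"] mono[of "Suc p" q] p q by auto
    then show False by simp
  qed
  ultimately have qp: "q = Suc p" by simp
  have "sub (swap_adj j xs) B = swap_adj p (sub xs B)"
  proof (rule nth_equalityI)
    fix i assume "i < length (sub (swap_adj j xs) B)"
    then have i: "i < card B" by simp
    have mem: "?l ! i \<in> B" using i fin by (metis length_sorted_list_of_set nth_mem set_sorted_list_of_set)
    have eqs: "?l ! i = j \<longleftrightarrow> i = p" "?l ! i = Suc j \<longleftrightarrow> i = Suc p"
      using mono[of i p] mono[of p i] mono[of i q] mono[of q i] i p q qp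
      by (metis linorder_neqE_nat less_irrefl)+
    have "sub (swap_adj j xs) B ! i = xs ! adj_transp j (?l ! i)"
      using i mem B by (simp add: sub_def nth_swap_adj subset_iff)
    also have "\<dots> = xs ! (?l ! adj_transp p i)"
      using eqs p q qp by (auto simp: adj_transp_def)
    also have "\<dots> = sub xs B ! adj_transp p i"
      using i adj_transp_less[of p "card B" i] q qp by (simp add: sub_def)
    also have "\<dots> = swap_adj p (sub xs B) ! i"
      using i q qp by (simp add: nth_swap_adj)
    finally show "sub (swap_adj j xs) B ! i = swap_adj p (sub xs B) ! i" .
  qed simp
  then show thesis using that[of p] p q qp by (simp add: sub_def)
qed

text \<open>Only the pair \<open>j\<close>, \<open>Suc j\<close> changes its relative order, and it
  contributes to the crossing only when its members lie on different sides.\<close>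

lemma cross_sign_adj_transp:
  assumes fin: "finite A" "finite B" and dj: "A \<inter> B = {}"
    and d': "\<And>a. a \<in> A \<union> B \<Longrightarrow> d' (adj_transp j a) = d a"
  shows "cross_sign d' (adj_transp j ` A) (adj_transp j ` B) = cross_sign d A B
    * (if j \<in> A \<and> Suc j \<in> B \<or> Suc j \<in> A \<and> j \<in> B then ksign (d j) (d (Suc j)) else 1)"
proof -
  let ?k = "ksign (d j) (d (Suc j))"
  have w: "wsign d' (adj_transp j q) (adj_transp j p) = wsign d q p
      * ((if q = j then if p = Suc j then ?k else 1 else 1) * (if q = Suc j then if p = j then ?k else 1 else 1))"
    if "q \<in> A" "p \<in> B" for q p
  proof -
    have "d' (adj_transp j q) = d q" "d' (adj_transp j p) = d p" "q \<noteq> p" using that d' dj by auto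
    then show ?thesis
      by (auto simp: wsign_def adj_transp_def ksign_sq ksign_comm[of "d (Suc j)"])
  qed
  have "cross_sign d' (adj_transp j ` A) (adj_transp j ` B)
     = (\<Prod>q\<in>A. \<Prod>p\<in>B. wsign d' (adj_transp j q) (adj_transp j p))"
    by (simp add: cross_sign_def prod.reindex[OF inj_adj_transp])
  also have "\<dots> = (\<Prod>q\<in>A. \<Prod>p\<in>B. wsign d q p
      * ((if q = j then if p = Suc j then ?k else 1 else 1) * (if q = Suc j then if p = j then ?k else 1 else 1)))"
    by (intro prod.cong refl w)
  also have "\<dots> = cross_sign d A B
     * ((\<Prod>q\<in>A. if q = j then (\<Prod>p\<in>B. if p = Suc j then ?k else 1) else 1)
      * (\<Prod>q\<in>A. if q = Suc j then (\<Prod>p\<in>B. if p = j then ?k else 1) else 1))"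
    unfolding prod.distrib cross_sign_def
    by (intro arg_cong2[where f = "(*)"] prod.cong refl) auto
  also have "\<dots> = cross_sign d A B
    * (if j \<in> A \<and> Suc j \<in> B \<or> Suc j \<in> A \<and> j \<in> B then ?k else 1)"
    using fin dj by (auto simp: prod.delta')
  finally show ?thesis .
qed

text \<open>If the pair shares a block, the sign of the blocks is unchanged; in that case the inner
  map will supply the Koszul sign.\<close>

lemma blocks_sign_adj_transp:
  assumes "disjoint_list bs" "\<And>a. a \<in> \<Union>(set bs) \<Longrightarrow> d' (adj_transp j a) = d a"
  shows "blocks_sign d' (map ((`) (adj_transp j)) bs) = blocks_sign d bs
    * (if j \<in> \<Union>(set bs) \<and> Suc j \<in> \<Union>(set bs) \<and> \<not> (\<exists>B\<in>set bs. j \<in> B \<and> Suc j \<in> B)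
        then ksign (d j) (d (Suc j)) else 1)"
  using assms
proof (induction bs)
  case (Cons A bs)
  have dj: "disjoint_list bs" "finite A" "A \<inter> \<Union>(set bs) = {}"
    using Cons.prems(1) by (auto simp: disjoint_list_Cons)
  have "finite (\<Union>(set bs))" using dj by (auto simp: disjoint_list_def)
  note cs = cross_sign_adj_transp[OF dj(2) this dj(3), of d' j d]
  have "\<Union>(set (map ((`) (adj_transp j)) bs)) = adj_transp j ` \<Union>(set bs)" by auto
  moreover have "j \<notin> A \<or> j \<notin> \<Union>(set bs)" "Suc j \<notin> A \<or> Suc j \<notin> \<Union>(set bs)"
    using dj(3) by auto
  ultimately show ?case
    using Cons.IH[OF dj(1)] Cons.prems(2) cs by auto
qed simp

section \<open>Degree and symmetry of the inverted family\<close>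

lemma homog_sub: "homog G xs ds \<Longrightarrow> S \<subseteq> {..<length xs} \<Longrightarrow> homog G (sub xs S) (sub ds S)"
proof -
  assume h: "homog G xs ds" and S: "S \<subseteq> {..<length xs}"
  have fin: "finite S" using finite_subset[OF S] by simp
  show ?thesis unfolding homog_def
  proof (intro conjI allI impI)
    fix i assume "i < length (sub xs S)"
    then have i: "i < card S" by simp
    then have "sorted_list_of_set S ! i \<in> S"
      using fin by (metis length_sorted_list_of_set nth_mem set_sorted_list_of_set)
    then show "sub xs S ! i \<in> G (sub ds S ! i)" using h S i by (auto simp: sub_def homog_def)
  qed simp
qed

lemma sum_list_sub: "finite S \<Longrightarrow> sum_list (sub ds S) = (\<Sum>a\<in>S. ds ! a)"
  by (simp add: sub_def sum_list_distinct_conv_sum_set)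

lemma sum_partition:
  fixes f :: "nat \<Rightarrow> int"
  assumes "partition_on {..<n} P"
  shows "(\<Sum>B\<in>P. \<Sum>a\<in>B. f a) = (\<Sum>a<n. f a)"
proof -
  have "(\<Sum>a\<in>\<Union>P. f a) = (\<Sum>B\<in>P. \<Sum>a\<in>B. f a)"
    using partition_onD2[OF assms] partition_block[OF assms]
    by (subst sum.Union_disjoint) (auto simp: disjoint_def)
  then show ?thesis using partition_onD1[OF assms] by simp
qed

lemma subspace_closed:
  assumes "graded_vs sc G"
  shows "0 \<in> G i" "x \<in> G i \<Longrightarrow> y \<in> G i \<Longrightarrow> x + y \<in> G i" "x \<in> G i \<Longrightarrow> sc a x \<in> G i"
    "x \<in> G i \<Longrightarrow> y \<in> G i \<Longrightarrow> x - y \<in> G i" "(\<And>j. j \<in> A \<Longrightarrow> f j \<in> G i) \<Longrightarrow> sum f A \<in> G i"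
proof -
  note gr = assms[unfolded graded_vs_def]
  interpret vector_space sc using gr by (rule conjunct1)
  have ss: "subspace (G i)"
    using gr[THEN conjunct2, THEN conjunct1] by (rule spec)
  show "0 \<in> G i" by (rule subspace_0[OF ss])
  show "x + y \<in> G i" if "x \<in> G i" "y \<in> G i" by (rule subspace_add[OF ss that])
  show "sc a x \<in> G i" if "x \<in> G i" by (rule subspace_scale[OF ss that])
  show "x - y \<in> G i" if "x \<in> G i" "y \<in> G i" by (rule subspace_diff[OF ss that])
  show "sum f A \<in> G i" if "\<And>j. j \<in> A \<Longrightarrow> f j \<in> G i" by (rule subspace_sum[OF ss that])
qed

text \<open>The last two assumptions are what \<open>exists_compositional_preimage\<close> provides.
  They determine \<open>\<phi>\<close> on homogeneous arguments, so its degree and symmetry can be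
  derived inductively from those of \<open>M\<close> and \<open>\<Phi>\<close>.\<close>

locale compositional_preimage =
  fixes scH :: "'k::field \<Rightarrow> 'h::ab_group_add \<Rightarrow> 'h" and GH :: "int \<Rightarrow> 'h set"
    and sc :: "'k \<Rightarrow> 'v::ab_group_add \<Rightarrow> 'v" and G :: "int \<Rightarrow> 'v set"
    and M :: "'v list \<Rightarrow> 'v" and \<Phi> :: "'h list \<Rightarrow> 'v" and \<phi> :: "'h list \<Rightarrow> 'v"
  assumes grH: "graded_vs scH GH" and grG: "graded_vs sc G"
    and M: "sym_family sc G sc G 0 M" and M1: "M [x] = x"
    and \<Phi>: "sym_family scH GH sc G 0 \<Phi>"
    and \<phi>: "1 \<le> n \<Longrightarrow> multilin scH sc n \<phi>"
    and star: "xs \<noteq> [] \<Longrightarrow> homog GH xs ds \<Longrightarrow> outer_sum sc ds xs M \<phi> = \<Phi> xs"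
begin

lemma vs: "vector_space sc" using grG[unfolded graded_vs_def] by (rule conjunct1)

lemma vsH: "vector_space scH" using grH[unfolded graded_vs_def] by (rule conjunct1)

definition summand :: "int list \<Rightarrow> 'h list \<Rightarrow> nat set set \<Rightarrow> 'v" where
  "summand ds xs P = sc (of_int (part_sign ((!) ds) P)) (M (map (\<lambda>B. \<phi> (sub xs B)) (msort P)))"

definition proper :: "nat \<Rightarrow> nat set set set" where
  "proper n = {P. partition_on {..<n} P} - {{{..<n}}}"

lemma M_multilin: "1 \<le> n \<Longrightarrow> multilin sc sc n M"
  using sym_mapD(1)[OF M] by (metis Ex_list_of_length)

lemma sum_summand_sub:
  assumes "S \<subseteq> {..<length xs}" "S \<noteq> {}" "homog GH xs ds"
  shows "(\<Sum>P | partition_on S P. summand ds xs P) = \<Phi> (sub xs S)"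
proof -
  have fin: "finite S" using finite_subset[OF assms(1)] by simp
  have "sub xs S \<noteq> []" using assms fin by (metis card_eq_0_iff length_0_conv length_sub)
  moreover have "S \<subseteq> {..<length ds}" using assms by (simp add: homog_def)
  ultimately show ?thesis
    using outer_sum_sub[OF fin, of ds sc xs M \<phi>] star[OF _ homog_sub[OF assms(3,1)]]
    by (simp add: summand_def)
qed

text \<open>Recovers the defining recursion on homogeneous arguments, with the actual degrees in
  place of parities.\<close>

lemma \<phi>_eq:
  assumes "xs \<noteq> []" "homog GH xs ds"
  shows "\<phi> xs = \<Phi> xs - (\<Sum>P\<in>proper (length xs). summand ds xs P)"
proof -
  let ?n = "length xs"
  have whole: "partition_on {..<?n} {{..<?n}}" using assms(1) by (intro partition_on_space) auto
  have "\<Phi> xs = (\<Sum>P | partition_on {..<?n} P. summand ds xs P)"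
    using star[OF assms] by (simp add: outer_sum_eq summand_def)
  also have "\<dots> = summand ds xs {{..<?n}} + (\<Sum>P\<in>proper ?n. summand ds xs P)"
    unfolding proper_def using whole by (subst sum.remove) (auto intro: finitely_many_partition_on)
  also have "summand ds xs {{..<?n}} = \<phi> xs"
    using msort_single[of "{..<?n}"] assms(1)
    by (simp add: summand_def M1 sub_all vector_space_simps(4)[OF vs] lessThan_empty_iff)
  finally show ?thesis by simp
qed

lemma homog_blocks:
  assumes bl: "blocks P"
    and \<phi>P: "\<And>B. B \<in> P \<Longrightarrow> \<phi> (sub xs B) \<in> G (\<Sum>a\<in>B. ds ! a)"
  shows "homog G (map (\<lambda>B. \<phi> (sub xs B)) (msort P)) (map (\<lambda>B. \<Sum>a\<in>B. ds ! a) (msort P))"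
  unfolding homog_def
proof (intro conjI allI impI)
  fix j assume j: "j < length (map (\<lambda>B. \<phi> (sub xs B)) (msort P))"
  have "msort P ! j \<in> P" using bl j by (metis length_map nth_mem set_msort)
  then show "map (\<lambda>B. \<phi> (sub xs B)) (msort P) ! j \<in> G (map (\<lambda>B. \<Sum>a\<in>B. ds ! a) (msort P) ! j)"
    using \<phi>P j by simp
qed simp

lemma \<phi>_degree: "xs \<noteq> [] \<Longrightarrow> homog GH xs ds \<Longrightarrow> \<phi> xs \<in> G (sum_list ds)"
proof (induction "length xs" arbitrary: xs ds rule: less_induct)
  case less
  let ?n = "length xs"
  have len: "length ds = ?n" and n: "1 \<le> ?n" using less.prems by (auto simp: homog_def Suc_le_eq)
  have "summand ds xs P \<in> G (sum_list ds)" if "P \<in> proper ?n" for P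
  proof -
    have P: "partition_on {..<?n} P" "P \<noteq> {{..<?n}}" using that by (auto simp: proper_def)
    have bl: "blocks P" using P(1) partition_on_blocks by blast
    have "\<phi> (sub xs B) \<in> G (\<Sum>a\<in>B. ds ! a)" if B: "B \<in> P" for B
    proof -
      note pb = partition_block[OF P(1) B]
      have "sub xs B \<noteq> []" using pb by (metis card_eq_0_iff length_0_conv length_sub)
      moreover have "length (sub xs B) < ?n" using partition_card_less[OF P(1) B P(2)] by simp
      ultimately show ?thesis
        using less.hyps[of "sub xs B" "sub ds B"] homog_sub[OF less.prems(2) pb(1)]
          sum_list_sub[OF pb(2), of ds] by simp
    qed
    note h = homog_blocks[OF bl this]
    have "0 \<in> {..<?n}" using less.prems(1) by simp
    then have "P \<noteq> {}" using partition_onD1[OF P(1)] by blast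
    then have "1 \<le> length (map (\<lambda>B. \<phi> (sub xs B)) (msort P))"
      using bl by (simp add: length_msort Suc_le_eq card_gt_0_iff blocks_def)
    from sym_mapD(2)[OF M this h]
    have "M (map (\<lambda>B. \<phi> (sub xs B)) (msort P)) \<in> G (sum_list (map (\<lambda>B. \<Sum>a\<in>B. ds ! a) (msort P)))"
      by simp
    also have "sum_list (map (\<lambda>B. \<Sum>a\<in>B. ds ! a) (msort P)) = (\<Sum>B\<in>P. \<Sum>a\<in>B. ds ! a)"
      using bl by (simp add: sum_list_distinct_conv_sum_set distinct_msort)
    also have "\<dots> = sum_list ds"
      unfolding sum_partition[OF P(1)] by (simp add: sum_list_sum_nth len lessThan_atLeast0)
    finally show ?thesis unfolding summand_def by (rule subspace_closed(3)[OF grG])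
  qed
  moreover have "\<Phi> xs \<in> G (sum_list ds)" using sym_mapD(2)[OF \<Phi> n less.prems(2)] by simp
  ultimately show ?case
    unfolding \<phi>_eq[OF less.prems] by (intro subspace_closed[OF grG])
qed

lemma \<phi>_sub_degree:
  assumes "homog GH xs ds" "B \<subseteq> {..<length xs}" "B \<noteq> {}"
  shows "\<phi> (sub xs B) \<in> G (\<Sum>a\<in>B. ds ! a)"
proof -
  have fin: "finite B" using finite_subset[OF assms(2)] by simp
  have "sub xs B \<noteq> []" using assms fin by (metis card_eq_0_iff length_0_conv length_sub)
  from \<phi>_degree[OF this homog_sub[OF assms(1,2)]] show ?thesis by (simp add: sum_list_sub fin)
qed

lemma homog_swap_adj:
  assumes "homog GH xs ds" "Suc j < length xs"
  shows "homog GH (swap_adj j xs) (swap_adj j ds)"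
  using assms adj_transp_less[OF assms(2)] by (simp add: homog_def nth_swap_adj)

text \<open>The same Koszul sign arises in two ways. If \<open>j\<close> and \<open>Suc j\<close>
  lie in different blocks, the inner values are unchanged and the sign comes from the order of the
  blocks. If they share a block, all blocks are fixed, and the sign comes from the symmetry of
  \<open>\<phi>\<close> on that shorter block, pulled out by linearity of \<open>M\<close>.\<close>

lemma summand_adj_transp:
  assumes h: "homog GH xs ds" and j: "Suc j < length xs" and P: "P \<in> proper (length xs)"
    and IH: "\<And>zs es i. length zs < length xs \<Longrightarrow> homog GH zs es \<Longrightarrow> Suc i < length zs \<Longrightarrow>
        \<phi> (swap_adj i zs) = sc (of_int (ksign (es ! i) (es ! Suc i))) (\<phi> zs)"
  shows "summand (swap_adj j ds) (swap_adj j xs) ((`) ((`) (adj_transp j)) P)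
     = sc (of_int (ksign (ds ! j) (ds ! Suc j))) (summand ds xs P)"
proof -
  let ?n = "length xs" and ?t = "adj_transp j" and ?k = "ksign (ds ! j) (ds ! Suc j)"
  let ?xs = "swap_adj j xs" and ?ds = "swap_adj j ds"
  let ?bs = "msort P" and ?P = "(`) ((`) ?t) P"
  let ?bs' = "map ((`) ?t) ?bs"
  have len: "length ds = ?n" using h by (simp add: homog_def)
  have P': "partition_on {..<?n} P" "P \<noteq> {{..<?n}}" using P by (auto simp: proper_def)
  have bl: "blocks P" using P'(1) partition_on_blocks by blast
  have "{} \<notin> ?P" using partition_onD3[OF P'(1)] by auto
  then have Pt: "partition_on {..<?n} ?P"
    using partition_on_inj_image[OF P'(1) inj_adj_transp, of j] adj_transp_image_atMost[OF j] by simp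
  have blt: "blocks ?P" using Pt partition_on_blocks by blast
  have inj_im: "inj_on ((`) ?t) P" by (metis adj_transp_image_invol inj_onI)
  have set_bs': "set ?bs' = ?P" using bl by simp
  have dist: "distinct ?bs'" using bl inj_im by (simp add: distinct_map distinct_msort)
  note hs = homog_swap_adj[OF h j]
  \<comment> \<open>The transposition may disturb the order of the maxima, so the transported list
    \<open>?bs'\<close> need not be sorted; graded symmetry of \<open>M\<close> allows it to be used
    all the same.\<close>
  have perm: "summand ?ds ?xs ?P
     = sc (of_int (blocks_sign ((!) ?ds) ?bs')) (M (map (\<lambda>B. \<phi> (sub ?xs B)) ?bs'))"
    unfolding summand_def blocks_sign_msort[OF blt, symmetric]
  proof (rule sym_blocks_perm[OF M vs dist])
    show "set (msort ?P) = set ?bs'" using blt set_bs' by simp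
    show "disjoint_list (msort ?P)" by (rule disjoint_list_msort[OF blt])
    fix B assume "B \<in> set (msort ?P)"
    then have "B \<in> ?P" using blt by simp
    then show "\<phi> (sub ?xs B) \<in> G (\<Sum>a\<in>B. ?ds ! a)"
      using partition_block[OF Pt] by (intro \<phi>_sub_degree[OF hs]) auto
  qed
  have dj: "disjoint_list ?bs" by (rule disjoint_list_msort[OF bl])
  have U: "\<Union>(set ?bs) = {..<?n}" using bl partition_onD1[OF P'(1)] by simp
  have "?ds ! ?t a = ds ! a" if "a \<in> \<Union>(set ?bs)" for a
    using that len j adj_transp_less[OF j] unfolding U by (simp add: nth_swap_adj)
  note bsign = blocks_sign_adj_transp[of ?bs "(!) ?ds" j "(!) ds", OF dj this]
  have summ: "summand ds xs P = sc (of_int (blocks_sign ((!) ds) ?bs)) (M (map (\<lambda>B. \<phi> (sub xs B)) ?bs))"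
    by (simp add: summand_def blocks_sign_msort[OF bl])
  show ?thesis
  proof (cases "\<exists>B\<in>P. j \<in> B \<and> Suc j \<in> B")
    case False
    have "blocks_sign ((!) ?ds) ?bs' = blocks_sign ((!) ds) ?bs * ?k"
      using bsign False bl j unfolding U by simp
    moreover have "map (\<lambda>B. \<phi> (sub ?xs B)) ?bs' = map (\<lambda>B. \<phi> (sub xs B)) ?bs"
      using False bl j partition_block[OF P'(1)] by (auto simp: sub_swap_separate)
    ultimately show ?thesis
      unfolding perm summ vector_space_simps(3)[OF vs] of_int_mult[symmetric] by (simp only: mult.commute)
  next
    case True
    then obtain B where B: "B \<in> P" "j \<in> B" "Suc j \<in> B" by blast
    note pb = partition_block[OF P'(1) B(1)]
    have "?t ` C = C" if "C \<in> P" for C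
    proof (cases "C = B")
      case False
      then have "C \<inter> B = {}" using partition_onD2[OF P'(1)] B(1) that by (auto simp: disjoint_def)
      then show ?thesis using B by (intro adj_transp_image_eq) auto
    qed (use B in \<open>simp add: adj_transp_image_eq\<close>)
    then have bs': "?bs' = ?bs" using bl by (intro map_idI) simp
    have "blocks_sign ((!) ?ds) ?bs' = blocks_sign ((!) ds) ?bs"
      using bsign True bl by auto
    moreover obtain i where i: "i < card P" "?bs ! i = B"
      using B bl by (metis in_set_conv_nth length_msort set_msort)
    have \<phi>B: "\<phi> (sub ?xs B) = sc (of_int ?k) (\<phi> (sub xs B))"
    proof -
      obtain p where p: "Suc p < card B" "sub (swap_adj j xs) B = swap_adj p (sub xs B)"
        "sub ds B ! p = ds ! j" "sub ds B ! Suc p = ds ! Suc j"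
        by (rule sub_swap_together[OF pb(1) B(2,3) len])
      show ?thesis
        using IH[OF _ homog_sub[OF h pb(1)], of p] p partition_card_less[OF P'(1) B(1) P'(2)] by simp
    qed
    let ?l = "map (\<lambda>B. \<phi> (sub xs B)) ?bs"
    have "map (\<lambda>B. \<phi> (sub ?xs B)) ?bs = ?l[i := sc (of_int ?k) (?l ! i)]"
    proof (rule nth_equalityI)
      fix a assume "a < length (map (\<lambda>B. \<phi> (sub ?xs B)) ?bs)"
      then have a: "a < card P" using bl by (simp add: length_msort)
      show "map (\<lambda>B. \<phi> (sub ?xs B)) ?bs ! a = ?l[i := sc (of_int ?k) (?l ! i)] ! a"
      proof (cases "a = i")
        case True
        then show ?thesis using a i \<phi>B bl by (simp add: length_msort)
      next
        case False
        have C: "?bs ! a \<in> P" using a bl by (metis length_msort nth_mem set_msort)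
        have "?bs ! a \<noteq> B"
          using False a i bl by (metis distinct_msort length_msort nth_eq_iff_index_eq)
        then have disj: "?bs ! a \<inter> B = {}" using partition_onD2[OF P'(1)] B(1) C by (auto simp: disjoint_def)
        then have nj: "j \<notin> ?bs ! a" "Suc j \<notin> ?bs ! a" using B by auto
        then have "?t ` (?bs ! a) = ?bs ! a" by (intro adj_transp_image_eq) auto
        then have "sub ?xs (?bs ! a) = sub xs (?bs ! a)"
          using sub_swap_separate[of "?bs ! a" xs j] partition_block[OF P'(1) C] j nj by simp
        then show ?thesis using False a bl by (simp add: length_msort)
      qed
    qed simp
    moreover have "M (?l[i := sc (of_int ?k) (?l ! i)]) = sc (of_int ?k) (M ?l)"
    proof -
      have "lin sc sc (\<lambda>v. M (?l[i := v]))"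
        using M_multilin[of "card P"] i bl by (simp add: multilin_def length_msort)
      from lin_scale[OF this] show ?thesis by simp
    qed
    ultimately show ?thesis
      unfolding perm summ bs'
      by (simp add: vector_space_simps(3)[OF vs] mult.commute)
  qed
qed

lemma \<phi>_sym:
  "homog GH xs ds \<Longrightarrow> Suc j < length xs \<Longrightarrow>
    \<phi> (swap_adj j xs) = sc (of_int (ksign (ds ! j) (ds ! Suc j))) (\<phi> xs)"
proof (induction "length xs" arbitrary: xs ds j rule: less_induct)
  case less
  let ?n = "length xs" and ?k = "ksign (ds ! j) (ds ! Suc j)"
  let ?im = "(`) ((`) (adj_transp j))"
  note h = less.prems(1) and j = less.prems(2)
  have ne: "xs \<noteq> []" "swap_adj j xs \<noteq> []" using j by (auto simp: swap_adj_def)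
  have n: "1 \<le> ?n" using j by simp
  have im: "?im P \<in> proper ?n" if "P \<in> proper ?n" for P
  proof -
    have P: "partition_on {..<?n} P" "P \<noteq> {{..<?n}}" using that by (auto simp: proper_def)
    have "{} \<notin> ?im P" using partition_onD3[OF P(1)] by auto
    then have "partition_on {..<?n} (?im P)"
      using partition_on_inj_image[OF P(1) inj_adj_transp, of j] adj_transp_image_atMost[OF j] by simp
    moreover have "?im P \<noteq> {{..<?n}}"
    proof
      assume "?im P = {{..<?n}}"
      then have "?im (?im P) = {{..<?n}}" by (simp add: adj_transp_image_atMost[OF j])
      then show False using P(2) by (simp add: image_image)
    qed
    ultimately show ?thesis by (simp add: proper_def)
  qed
  have "(\<Sum>P\<in>proper ?n. summand (swap_adj j ds) (swap_adj j xs) P)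
      = (\<Sum>P\<in>proper ?n. summand (swap_adj j ds) (swap_adj j xs) (?im P))"
    by (rule sum.reindex_bij_witness[of _ ?im ?im]) (use im in \<open>auto simp: image_image\<close>)
  also have "\<dots> = (\<Sum>P\<in>proper ?n. sc (of_int ?k) (summand ds xs P))"
    using less.hyps by (intro sum.cong refl summand_adj_transp[OF h j]) auto
  finally have "(\<Sum>P\<in>proper ?n. summand (swap_adj j ds) (swap_adj j xs) P)
      = sc (of_int ?k) (\<Sum>P\<in>proper ?n. summand ds xs P)"
    by (simp add: vector_space_simps(8)[OF vs])
  moreover have "\<Phi> (swap_adj j xs) = sc (of_int ?k) (\<Phi> xs)" by (rule sym_mapD(3)[OF \<Phi> n h j])
  ultimately show ?case
    unfolding \<phi>_eq[OF ne(1) h] \<phi>_eq[OF ne(2) homog_swap_adj[OF h j]]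
    by (simp add: vector_space_simps(7)[OF vs])
qed

lemma \<phi>_sym_family: "sym_family scH GH sc G 0 \<phi>"
  unfolding sym_family_def sym_map_def
proof (intro allI impI conjI)
  fix n :: nat and xs :: "'h list" and j
  assume n: "1 \<le> n" and "length xs = n \<and> j < n"
  then show "lin scH sc (\<lambda>v. \<phi> (xs[j := v]))" using \<phi>[OF n] by (simp add: multilin_def)
next
  fix n :: nat and xs :: "'h list" and ds
  assume n: "1 \<le> n" and "length xs = n \<and> homog GH xs ds"
  then show "\<phi> xs \<in> G (sum_list ds + 0)" using \<phi>_degree[of xs ds] by (cases xs) auto
next
  fix n :: nat and xs :: "'h list" and ds j
  assume n: "1 \<le> n" and "length xs = n \<and> homog GH xs ds \<and> Suc j < n"
  then show "\<phi> (swap_adj j xs) = sc (of_int (ksign (ds ! j) (ds ! Suc j))) (\<phi> xs)"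
    by (intro \<phi>_sym) auto
qed

end

section \<open>Unit and morphism equation\<close>

text \<open>Signs require degrees, so identities are first available on homogeneous lists only. This
  extends them to all lists by decomposing one entry after another; the induction is on the number
  \<open>k\<close> of leading entries allowed to be inhomogeneous.\<close>

lemma multilin_vanish:
  assumes gr: "graded_vs s1 G1" and f: "multilin s1 s2 n f"
    and hom: "\<And>xs ds. length xs = n \<Longrightarrow> homog G1 xs ds \<Longrightarrow> f xs = 0"
    and len: "length xs = n"
  shows "f xs = 0"
proof -
  have "\<forall>xs. length xs = n \<and> (\<forall>j<n. k \<le> j \<longrightarrow> (\<exists>d. xs ! j \<in> G1 d)) \<longrightarrow> f xs = 0" if "k \<le> n" for k
    using that
  proof (induction k)
    case 0
    show ?case
    proof (intro allI impI)
      fix xs assume xs: "length xs = n \<and> (\<forall>j<n. 0 \<le> j \<longrightarrow> (\<exists>d. xs ! j \<in> G1 d))"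
      have "xs ! j \<in> G1 (SOME d. xs ! j \<in> G1 d)" if "j < n" for j
      proof -
        have "\<exists>d. xs ! j \<in> G1 d" using xs that by simp
        then show ?thesis by (rule someI_ex)
      qed
      then have "homog G1 xs (map (\<lambda>j. SOME d. xs ! j \<in> G1 d) [0..<n])"
        using xs by (simp add: homog_def)
      then show "f xs = 0" using hom xs by blast
    qed
  next
    case (Suc k)
    show ?case
    proof (intro allI impI)
      fix xs assume xs: "length xs = n \<and> (\<forall>j<n. Suc k \<le> j \<longrightarrow> (\<exists>d. xs ! j \<in> G1 d))"
      have "\<exists>I g. finite I \<and> (\<forall>i. g i \<in> G1 i) \<and> xs ! k = sum g I"
        using gr[unfolded graded_vs_def, THEN conjunct2, THEN conjunct2, THEN conjunct1] by (rule spec)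
      then obtain I g where g: "finite I" "\<forall>i. g i \<in> G1 i" "xs ! k = sum g I" by blast
      have l: "lin s1 s2 (\<lambda>v. f (xs[k := v]))" using f xs Suc.prems by (simp add: multilin_def)
      have "f (xs[k := g i]) = 0" for i
      proof -
        have "\<exists>d. xs[k := g i] ! j \<in> G1 d" if "j < n" "k \<le> j" for j
          using that xs g(2) by (cases "j = k") auto
        then show ?thesis using Suc.IH Suc.prems xs by simp
      qed
      then have "f (xs[k := sum g I]) = 0" by (simp add: lin_sum[OF l])
      then show "f xs = 0" by (simp flip: g(3))
    qed
  qed
  from this[of n] show ?thesis using len by simp
qed

lemma sub_snoc:
  assumes "C \<subseteq> {..<length xs}"
  shows "sub (xs @ [x]) (insert (length xs) C) = sub xs C @ [x]"
    "sub (xs @ [x]) C = sub xs C"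
proof -
  have fin: "finite C" using finite_subset[OF assms] by simp
  define I where "I = insert (length xs) C"
  have "finite I" using fin by (simp add: I_def)
  then have "sorted_list_of_set I = sorted_list_of_set C @ [length xs]"
  proof (intro strict_sorted_equal)
    show "sorted_wrt (<) (sorted_list_of_set C @ [length xs])"
      using fin assms by (auto simp: sorted_wrt_append)
    show "sorted_wrt (<) (sorted_list_of_set I)" by simp
    assume "finite I"
    then have "set (sorted_list_of_set I) = I" by simp
    then show "set (sorted_list_of_set I) = set (sorted_list_of_set C @ [length xs])"
      using fin by (simp add: I_def)
  qed
  moreover have *: "map ((!) (xs @ [x])) (sorted_list_of_set C) = map ((!) xs) (sorted_list_of_set C)"
    using assms fin by (auto simp: nth_append)
  ultimately show "sub (xs @ [x]) (insert (length xs) C) = sub xs C @ [x]"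
    unfolding I_def[symmetric] by (simp add: sub_def)
  show "sub (xs @ [x]) C = sub xs C" using * by (simp add: sub_def)
qed

context compositional_preimage
begin

lemma \<phi>_single: "\<phi> [x] = \<Phi> [x]"
proof -
  have proper1: "proper 1 = {}"
  proof -
    have "P = {{..<1}}" if P: "partition_on {..<1} P" for P :: "nat set set"
    proof -
      have "B = {..<1}" if "B \<in> P" for B using partition_block[OF P that] by auto
      moreover have "P \<noteq> {}" using partition_onD1[OF P] by auto
      ultimately show ?thesis by blast
    qed
    then show ?thesis by (auto simp: proper_def)
  qed
  have "multilin scH sc 1 (\<lambda>xs. \<phi> xs - \<Phi> xs)"
    unfolding multilin_def
  proof (intro allI impI)
    fix xs :: "'h list" and j :: nat assume "length xs = 1 \<and> j < 1"
    then show "lin scH sc (\<lambda>v. \<phi> (xs[j := v]) - \<Phi> (xs[j := v]))"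
      using \<phi>[of 1] sym_mapD(1)[OF \<Phi>, of xs] by (intro lin_minus_fun) (auto simp: multilin_def)
  qed
  then have "\<phi> [x] - \<Phi> [x] = 0"
  proof (rule multilin_vanish[OF grH])
    fix xs :: "'h list" and ds assume xs: "length xs = 1" "homog GH xs ds"
    then have "xs \<noteq> []" by auto
    from \<phi>_eq[OF this xs(2)] show "\<phi> xs - \<Phi> xs = 0" using xs(1) proper1 by simp
  qed simp
  then show ?thesis by simp
qed

text \<open>Consider the proper partitions of the enlarged index set. If the new index is a
  singleton, \<open>M\<close> receives the unit as its last argument and drops it, so these terms
  add up to \<open>\<Phi> xs\<close>. Otherwise the unit shares a block with other arguments, where
  \<open>\<phi>\<close> vanishes by induction. Hence the recursion gives
  \<open>\<Phi> (xs @ [oneH]) - \<Phi> xs\<close>, which is zero.\<close>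

lemma \<phi>_unit:
  assumes oneH: "oneH \<in> GH 0" and Mone: "\<And>xs. xs \<noteq> [] \<Longrightarrow> M (xs @ [one]) = M xs"
    and \<Phi>one: "\<And>xs. xs \<noteq> [] \<Longrightarrow> \<Phi> (xs @ [oneH]) = \<Phi> xs" and \<Phi>1: "\<Phi> [oneH] = one"
    and ne: "xs \<noteq> []"
  shows "\<phi> (xs @ [oneH]) = 0"
proof -
  have hom: "xs \<noteq> [] \<Longrightarrow> homog GH xs ds \<Longrightarrow> \<phi> (xs @ [oneH]) = 0" for xs ds
  proof (induction "length xs" arbitrary: xs ds rule: less_induct)
    case less
    let ?n = "length xs" and ?xs = "xs @ [oneH]" and ?ds = "ds @ [0]"
    note h = less.prems(2)
    have len: "length ds = ?n" using h by (simp add: homog_def)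
    have hs: "homog GH ?xs ?ds" using h oneH by (auto simp: homog_def nth_append less_Suc_eq)
    let ?A = "insert {?n} ` {P. partition_on {..<?n} P}"
    have notin: "{?n} \<notin> P" if "partition_on {..<?n} P" for P using partition_onD1[OF that] by auto
    have A: "insert {?n} P \<in> proper (Suc ?n)" if P: "partition_on {..<?n} P" for P
    proof -
      have "disjnt {?n} (\<Union>P)" using partition_onD1[OF P] by auto
      moreover have "{..<Suc ?n} - {?n} = {..<?n}" by auto
      ultimately have "partition_on {..<Suc ?n} (insert {?n} P)"
        using P by (simp add: partition_on_insert)
      moreover have "{..<Suc ?n} \<noteq> {?n}" using less.prems(1) by (metis insertI1 lessThan_iff length_greater_0_conv less_SucI less_not_refl singletonD)
      then have "insert {?n} P \<noteq> {{..<Suc ?n}}" by auto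
      ultimately show ?thesis by (simp add: proper_def)
    qed
    have zero: "summand ?ds ?xs P = 0" if P: "P \<in> proper (Suc ?n) - ?A" for P
    proof -
      have P': "partition_on {..<Suc ?n} P" "P \<noteq> {{..<Suc ?n}}" using P by (auto simp: proper_def)
      have bl: "blocks P" using P'(1) partition_on_blocks by blast
      obtain B where B: "B \<in> P" "?n \<in> B" using partition_onD1[OF P'(1)] by blast
      note pb = partition_block[OF P'(1) B(1)]
      have "B \<noteq> {?n}"
      proof
        assume "B = {?n}"
        define P0 where "P0 = P - {{?n}}"
        have Pn: "P = insert {?n} P0" using B \<open>B = {?n}\<close> by (auto simp: P0_def)
        have "A \<inter> {?n} = {}" if "A \<in> P0" for A
          using disjointD[OF partition_onD2[OF P'(1)], of A "{?n}"] B(1) that \<open>B = {?n}\<close> by (simp add: P0_def)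
        then have dj: "disjnt {?n} (\<Union>P0)" by (auto simp: disjnt_def)
        have "{..<Suc ?n} - {?n} = {..<?n}" by auto
        then have "partition_on {..<?n} P0"
          using P'(1) partition_on_insert[OF dj, of "{..<Suc ?n}"] unfolding Pn by simp
        then show False using P unfolding Pn by blast
      qed
      define C where "C = B - {?n}"
      have BC: "B = insert ?n C" using B by (auto simp: C_def)
      have C: "C \<subseteq> {..<?n}" "C \<noteq> {}" using pb \<open>B \<noteq> {?n}\<close> B by (auto simp: C_def less_Suc_eq)
      have finC: "finite C" using pb by (simp add: C_def)
      have "?n \<notin> C" by (simp add: C_def)
      then have "card C < ?n"
        using partition_card_less[OF P'(1) B(1) P'(2)] finC by (simp add: BC)
      moreover have "sub xs C \<noteq> []" using C finC by (metis card_eq_0_iff length_0_conv length_sub)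
      ultimately have "\<phi> (sub xs C @ [oneH]) = 0"
        using less.hyps[of "sub xs C" "sub ds C"] homog_sub[OF h C(1)] by simp
      then have z: "\<phi> (sub ?xs B) = 0" using sub_snoc(1)[OF C(1)] by (simp add: BC)
      obtain i where i: "i < card P" "msort P ! i = B"
        using B bl by (metis in_set_conv_nth length_msort set_msort)
      have "M (map (\<lambda>B. \<phi> (sub ?xs B)) (msort P)) = 0"
      proof (rule multilin_zero[OF M_multilin])
        show "i < length (map (\<lambda>B. \<phi> (sub ?xs B)) (msort P))" using i bl by (simp add: length_msort)
        then show "1 \<le> length (map (\<lambda>B. \<phi> (sub ?xs B)) (msort P))"
          and "map (\<lambda>B. \<phi> (sub ?xs B)) (msort P) ! i = 0"
          using i z by simp_all
      qed
      then show ?thesis by (simp add: summand_def vector_space_simps(5)[OF vs])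
    qed
    have same: "summand ?ds ?xs (insert {?n} P) = summand ds xs P" if P: "partition_on {..<?n} P" for P
    proof -
      have bl: "blocks P" using P partition_on_blocks by blast
      have bl': "blocks (insert {?n} P)"
        using A[OF P] partition_on_blocks[of "{..<Suc ?n}"] by (auto simp: proper_def)
      have Pne: "P \<noteq> {}" using partition_onD1[OF P] less.prems(1) by auto
      have lt: "Max B < ?n" if "B \<in> P" for B using partition_block[OF P that] by auto
      have ms: "msort (insert {?n} P) = msort P @ [{?n}]"
        by (rule msort_unique[OF bl', symmetric]) (use bl lt sorted_wrt_msort[OF bl] in \<open>auto simp: sorted_wrt_append\<close>)
      \<comment> \<open>The new index exceeds all others and its block comes last, so it creates no
        inversion.\<close>
      have "part_sign ((!) ?ds) (P \<union> {{?n}}) = part_sign ((!) ?ds) P"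
      proof -
        have "cross_sign ((!) ?ds) C {?n} = 1" if "C \<in> P" for C
          using partition_block(1)[OF P that] by (intro cross_sign_eq_1) auto
        moreover have "\<not> ?n < Max C" if "C \<in> P" for C using lt[OF that] by simp
        ultimately show ?thesis
          using bl' notin[OF P] by (subst part_sign_Un) auto
      qed
      also have "\<dots> = part_sign ((!) ds) P"
        using partition_onD1[OF P] len by (intro part_sign_cong) (auto simp: nth_append)
      finally have ps: "part_sign ((!) ?ds) (insert {?n} P) = part_sign ((!) ds) P" by simp
      have "sub ?xs {?n} = [oneH]" by (simp add: sub_def)
      then have "\<phi> (sub ?xs {?n}) = one" using \<phi>_single \<Phi>1 by simp
      moreover have "map (\<lambda>B. \<phi> (sub ?xs B)) (msort P) = map (\<lambda>B. \<phi> (sub xs B)) (msort P)"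
        using bl partition_block(1)[OF P] by (auto simp: sub_snoc(2))
      moreover have "map (\<lambda>B. \<phi> (sub xs B)) (msort P) \<noteq> []" using bl Pne by (metis map_is_Nil_conv set_empty set_msort)
      ultimately show ?thesis unfolding summand_def ms ps map_append by (simp only: list.map Mone not_False_eq_True)
    qed
    have "(\<Sum>P\<in>proper (Suc ?n). summand ?ds ?xs P) = (\<Sum>P\<in>?A. summand ?ds ?xs P)"
    proof (rule sum.mono_neutral_right)
      show "finite (proper (Suc ?n))" by (simp add: proper_def finitely_many_partition_on)
      show "?A \<subseteq> proper (Suc ?n)" using A by blast
      show "\<forall>P\<in>proper (Suc ?n) - ?A. summand ?ds ?xs P = 0" using zero by blast
    qed
    also have "\<dots> = (\<Sum>P | partition_on {..<?n} P. summand ?ds ?xs (insert {?n} P))"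
    proof (subst sum.reindex)
      show "inj_on (insert {?n}) {P. partition_on {..<?n} P}"
      proof (rule inj_onI)
        fix P Q assume PQ: "P \<in> {P. partition_on {..<?n} P}" "Q \<in> {P. partition_on {..<?n} P}"
          "insert {?n} P = insert {?n} Q"
        then have "{?n} \<notin> P" "{?n} \<notin> Q" using notin by blast+
        from insert_ident[OF this] PQ(3) show "P = Q" by (rule iffD1)
      qed
    qed simp
    also have "\<dots> = (\<Sum>P | partition_on {..<?n} P. summand ds xs P)"
      using same by (intro sum.cong refl) auto
    also have "\<dots> = \<Phi> xs"
      using sum_summand_sub[of "{..<?n}" xs ds] less.prems by (simp add: sub_all lessThan_empty_iff)
    finally show ?case
      using \<phi>_eq[OF _ hs] \<Phi>one[OF less.prems(1)] by simp
  qed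
  have "multilin scH sc (length xs) (\<lambda>xs. \<phi> (xs @ [oneH]))"
    unfolding multilin_def
  proof (intro allI impI)
    fix zs :: "'h list" and j assume "length zs = length xs \<and> j < length xs"
    then show "lin scH sc (\<lambda>v. \<phi> (zs[j := v] @ [oneH]))"
      using \<phi>[of "Suc (length xs)", unfolded multilin_def, rule_format, of "zs @ [oneH]" j]
      by (simp add: list_update_append1)
  qed
  then show ?thesis
  proof (rule multilin_vanish[OF grH])
    fix zs :: "'h list" and ds assume "length zs = length xs" "homog GH zs ds"
    then show "\<phi> (zs @ [oneH]) = 0" using hom[of zs ds] ne by (cases zs) auto
  qed simp
qed

text \<open>Stated for every nonempty set of indices because the induction meets the same sum on the
  union of the merged blocks. Proper unions drop out by induction. For the full union no block is
  left beside it, so \<open>M\<close> has a single argument and returns the sum for \<open>S\<close>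
  itself.\<close>

lemma descendant_outer_sum_zero:
  assumes K: "graded_map sc G sc G 1 K" and desc: "is_descendant sc G M K lK"
    and K\<Phi>: "\<And>xs. xs \<noteq> [] \<Longrightarrow> K (\<Phi> xs) = 0"
    and h: "homog GH xs ds"
  shows "S \<subseteq> {..<length xs} \<Longrightarrow> S \<noteq> {} \<Longrightarrow>
    (\<Sum>R | partition_on S R. sc (of_int (part_sign ((!) ds) R)) (lK (map (\<lambda>B. \<phi> (sub xs B)) (msort R)))) = 0"
proof (induction "card S" arbitrary: S rule: less_induct)
  case less
  define y where "y = (\<lambda>B. \<phi> (sub xs B))"
  let ?d = "(!) ds"
  let ?e = "\<lambda>B. \<Sum>a\<in>B. ds ! a"
  define \<Lambda> where "\<Lambda> U = (\<Sum>R | partition_on U R. sc (of_int (part_sign ?d R)) (lK (map y (msort R))))" for U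
  \<comment> \<open>\<open>v\<close> stands for the result of the operation on the merged blocks,
    placed according to the maximum of \<open>U\<close>. The expression is linear in
    \<open>v\<close>, so a sum over the subdivisions of \<open>U\<close> can be pulled
    inside.\<close>
  define X where "X U T v = M (map y (msort {B\<in>T. Max B < Max U}) @ v # map y (msort {B\<in>T. Max U < Max B}))"
    for U :: "nat set" and T v
  have linK: "lin sc sc K" using K by (simp add: graded_map_def)
  have finS: "finite S" using finite_subset[OF less.prems(1)] by simp
  have finP: "finite {Q. partition_on U Q}" if "U \<subseteq> S" for U
    using finite_subset[OF that finS] by (rule finitely_many_partition_on)
  have linX: "lin sc sc (X U T)" for U T
  proof -
    let ?p = "map y (msort {B\<in>T. Max B < Max U})" and ?q = "map y (msort {B\<in>T. Max U < Max B})"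
    have "lin sc sc (\<lambda>v. M ((?p @ 0 # ?q)[length ?p := v]))"
      by (rule M_multilin[of "length (?p @ 0 # ?q)", unfolded multilin_def, rule_format]) auto
    then show ?thesis unfolding X_def list_update_length .
  qed
  have KM: "K (M (map y (msort Q)))
      = (\<Sum>R\<in>Pow Q - {{}}. sc (of_int (block_inner_sign ?e (Q - R) R)) (X (\<Union>R) (Q - R) (lK (map y (msort R)))))"
    if Q: "partition_on S Q" for Q
  proof -
    have bl: "blocks Q" using partition_on_blocks[OF Q finS] .
    have "\<phi> (sub xs B) \<in> G (?e B)" if "B \<in> Q" for B
      using partition_onD1[OF Q] partition_onD3[OF Q] that less.prems(1)
      by (intro \<phi>_sub_degree[OF h]) auto
    from homog_blocks[OF bl this]
    have hb: "homog G (map y (msort Q)) (map ?e (msort Q))" by (simp add: y_def)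
    have "Q \<noteq> {}" using partition_onD1[OF Q] less.prems(2) by auto
    then have "map y (msort Q) \<noteq> []" using bl by (metis map_is_Nil_conv set_empty set_msort)
    then have "K (M (map y (msort Q))) = inner_sum sc (map ?e (msort Q)) (map y (msort Q)) M lK"
      using desc hb unfolding is_descendant_def by blast
    then show ?thesis unfolding inner_sum_blocks[OF bl] X_def .
  qed
  have SS: "(0::'v) = (\<Sum>U\<in>Pow S - {{}}. \<Sum>T | partition_on (S - U) T.
       sc (of_int (merge_sign ?d U T)) (X U T (\<Lambda> U)))"
  proof -
    have "sub xs S \<noteq> []" using less.prems(2) finS by (metis card_eq_0_iff length_0_conv length_sub)
    then have "0 = K (\<Phi> (sub xs S))" using K\<Phi> by simp
    also have "\<dots> = K (\<Sum>Q | partition_on S Q. sc (of_int (part_sign ?d Q)) (M (map y (msort Q))))"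
      using sum_summand_sub[OF less.prems h] by (simp add: summand_def y_def)
    also have "\<dots> = (\<Sum>Q | partition_on S Q. \<Sum>R\<in>Pow Q - {{}}. sc (of_int (part_sign ?d Q))
        (sc (of_int (block_inner_sign ?e (Q - R) R)) (X (\<Union>R) (Q - R) (lK (map y (msort R))))))"
      unfolding lin_sum[OF linK] lin_scale[OF linK]
      by (intro sum.cong refl) (simp add: KM vector_space_simps(8)[OF vs])
    also have "\<dots> = (\<Sum>(Q, R)\<in>(SIGMA Q:{Q. partition_on S Q}. Pow Q - {{}}). sc (of_int (part_sign ?d Q))
        (sc (of_int (block_inner_sign ?e (Q - R) R)) (X (\<Union>R) (Q - R) (lK (map y (msort R))))))"
      by (rule sum.Sigma) (use finP[OF order.refl] finite_elements[OF finS] in auto)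
    also have "\<dots> = (\<Sum>(U, T, R)\<in>(SIGMA U:Pow S - {{}}. {T. partition_on (S - U) T} \<times> {R. partition_on U R}).
        sc (of_int (merge_sign ?d U T)) (X U T (sc (of_int (part_sign ?d R)) (lK (map y (msort R))))))"
    \<comment> \<open>Choosing a partition \<open>Q\<close> of \<open>S\<close> and a nonempty
      subset \<open>R\<close> amounts to choosing the union \<open>U\<close> of \<open>R\<close>, a
      partition of \<open>U\<close> and a partition of its complement.\<close>
    proof (rule sum.reindex_bij_witness[where i = "\<lambda>(U, T, R). (R \<union> T, R)" and j = "\<lambda>(Q, R). (\<Union>R, Q - R, R)"], goal_cases)
      case (1 a)
      then show ?case by (auto simp: split_beta)
    next
      case (2 a)
      then obtain Q R where a: "a = (Q, R)" "partition_on S Q" "R \<subseteq> Q" "R \<noteq> {}" by auto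
      have bl: "blocks Q" using partition_on_blocks[OF a(2) finS] .
      have "A \<inter> B = {}" if "A \<in> Q - R" "B \<in> R" for A B
        using disjointD[OF partition_onD2[OF a(2)], of A B] a(3) that by blast
      then have "\<Union>(Q - R) = S - \<Union>R"
        using partition_onD1[OF a(2)] a(3) by blast
      moreover have "\<Union>R \<noteq> {}"
      proof -
        obtain B where "B \<in> R" using a(4) by blast
        moreover from this have "B \<noteq> {}" using a(3) partition_onD3[OF a(2)] by blast
        ultimately show ?thesis by blast
      qed
      moreover have "\<Union>R \<subseteq> S" using a(3) partition_onD1[OF a(2)] by blast
      ultimately show ?case
        using blocks_partition_on[OF blocks_subset[OF bl, of R]] blocks_partition_on[OF blocks_subset[OF bl, of "Q - R"]] a(1,3)
        by auto
    next
      case (3 b)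
      then obtain U T R where b: "b = (U, T, R)" "U \<subseteq> S" "U \<noteq> {}" "partition_on (S - U) T" "partition_on U R"
        by auto
      have "C \<notin> T" if "C \<in> R" for C
      proof
        assume "C \<in> T"
        then have "C \<subseteq> S - U" "C \<subseteq> U" using partition_onD1[OF b(4)] partition_onD1[OF b(5)] that by blast+
        then have "C = {}" by blast
        then show False using that partition_onD3[OF b(5)] by blast
      qed
      then have "R \<union> T - R = T" by blast
      then show ?case using partition_onD1[OF b(5)] b(1) by simp
    next
      case (4 b)
      then obtain U T R where b: "b = (U, T, R)" "U \<subseteq> S" "U \<noteq> {}" "partition_on (S - U) T" "partition_on U R"
        by auto
      have "partition_on S (R \<union> T)"
      proof (rule partition_onI)
        show "\<Union>(R \<union> T) = S" using partition_onD1[OF b(4)] partition_onD1[OF b(5)] b(2) by auto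
        show "{} \<notin> R \<union> T" using partition_onD3[OF b(4)] partition_onD3[OF b(5)] by blast
        fix p q assume "p \<in> R \<union> T" "q \<in> R \<union> T" "p \<noteq> q"
        moreover have "disjnt p q" "disjnt q p" if "p \<in> R" "q \<in> T" for p q
          using that partition_onD1[OF b(4)] partition_onD1[OF b(5)] by (auto simp: disjnt_iff)
        ultimately show "disjnt p q"
          using pairwiseD[OF partition_onD2[OF b(4)], of p q] pairwiseD[OF partition_onD2[OF b(5)], of p q]
          by blast
      qed
      moreover have "R \<noteq> {}" using partition_onD1[OF b(5)] b(3) by auto
      ultimately show ?case using b(1) by auto
    next
      case (5 a)
      then obtain Q R where a: "a = (Q, R)" "partition_on S Q" "R \<subseteq> Q" "R \<noteq> {}" by auto
      have bl: "blocks Q" using partition_on_blocks[OF a(2) finS] .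
      have "R \<union> (Q - R) = Q" using a(3) by blast
      then have "part_sign ?d Q * block_inner_sign ?e (Q - R) R = merge_sign ?d (\<Union>R) (Q - R) * part_sign ?d R"
        using merge_sign_eq[of R "Q - R" ?d] bl a(4) by simp
      then show ?case
        by (simp add: a(1) lin_scale[OF linX] vector_space_simps(3)[OF vs] flip: of_int_mult)
    qed
    also have "\<dots> = (\<Sum>U\<in>Pow S - {{}}. \<Sum>(T, R)\<in>{T. partition_on (S - U) T} \<times> {R. partition_on U R}.
        sc (of_int (merge_sign ?d U T)) (X U T (sc (of_int (part_sign ?d R)) (lK (map y (msort R))))))"
      by (rule sum.Sigma[symmetric]) (use finS finP in auto)
    also have "\<dots> = (\<Sum>U\<in>Pow S - {{}}. \<Sum>T | partition_on (S - U) T. \<Sum>R | partition_on U R.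
        sc (of_int (merge_sign ?d U T)) (X U T (sc (of_int (part_sign ?d R)) (lK (map y (msort R))))))"
      by (simp add: sum.cartesian_product)
    also have "\<dots> = (\<Sum>U\<in>Pow S - {{}}. \<Sum>T | partition_on (S - U) T.
       sc (of_int (merge_sign ?d U T)) (X U T (\<Lambda> U)))"
      unfolding \<Lambda>_def lin_sum[OF linX] vector_space_simps(8)[OF vs] ..
    finally show ?thesis .
  qed
  have "\<Lambda> U = 0" if "U \<in> Pow S - {{}} - {S}" for U
    unfolding \<Lambda>_def y_def
    using that less.prems(1) finS by (intro less.hyps psubset_card_mono) auto
  then have "(\<Sum>T | partition_on (S - U) T. sc (of_int (merge_sign ?d U T)) (X U T (\<Lambda> U))) = 0"
    if "U \<in> Pow S - {{}} - {S}" for U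
    using that by (simp add: lin_zero[OF linX] vector_space_simps(5)[OF vs])
  then have "(0::'v) = (\<Sum>T | partition_on (S - S) T. sc (of_int (merge_sign ?d S T)) (X S T (\<Lambda> S)))"
    using SS less.prems(2) finS by (simp add: sum.remove[of "Pow S - {{}}" S])
  also have "\<dots> = \<Lambda> S"
    by (simp add: partition_on_empty merge_sign_def part_sign_def X_def M1 vector_space_simps(4)[OF vs])
  finally show ?case by (simp add: \<Lambda>_def y_def)
qed

end

section \<open>Section and first order family\<close>

lemma graded_decomp:
  assumes "graded_vs sc G"
  obtains I f where "finite I" "\<And>i. f i \<in> G i" "v = sum f I"
proof -
  have "\<exists>I f. finite I \<and> (\<forall>i. f i \<in> G i) \<and> v = sum f I"
    using assms[unfolded graded_vs_def, THEN conjunct2, THEN conjunct2, THEN conjunct1] by (rule spec)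
  then show thesis using that by blast
qed

lemma lin_eq_on_graded:
  assumes gr: "graded_vs sc G" and f: "lin sc s2 f" and g: "lin sc s2 g"
    and eq: "\<And>i v. v \<in> G i \<Longrightarrow> f v = g v"
  shows "f v = g v"
proof -
  obtain I h where h: "finite I" "\<And>i. h i \<in> G i" "v = sum h I" by (rule graded_decomp[OF gr, of v]) (rule that)
  show ?thesis unfolding h(3) lin_sum[OF f] lin_sum[OF g] using eq h(2) by (intro sum.cong refl) blast
qed

lemma component_projection:
  assumes gr: "graded_vs sc G"
  obtains p where "lin sc sc p" "\<And>v. v \<in> G i \<Longrightarrow> p v = v" "\<And>j v. j \<noteq> i \<Longrightarrow> v \<in> G j \<Longrightarrow> p v = 0"
    "\<And>v. p v \<in> G i"
proof -
  obtain p where p: "lin sc sc p" "\<And>j v. j \<in> {i} \<Longrightarrow> v \<in> G j \<Longrightarrow> p v = v"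
    "\<And>j v. j \<notin> {i} \<Longrightarrow> v \<in> G j \<Longrightarrow> p v = 0"
    by (rule graded_projection[OF gr, of "{i}"]) (rule that)
  have "p v \<in> G i" for v
  proof -
    obtain I h where h: "finite I" "\<And>i. h i \<in> G i" "v = sum h I" by (rule graded_decomp[OF gr, of v]) (rule that)
    have "p (h j) \<in> G i" for j
      using p(2)[of i "h i"] p(3)[of j "h j"] h(2) subspace_closed(1)[OF gr] by (cases "j = i") auto
    then show ?thesis unfolding h(3) lin_sum[OF p(1)] by (rule subspace_closed(5)[OF gr])
  qed
  with p show thesis by (intro that[of p]) auto
qed

text \<open>Every homogeneous class has a homogeneous cocycle representative, because component
  projections commute with \<open>pr\<close> and, up to the degree shift, with \<open>K\<close>.
  Choosing such representatives on a homogeneous basis containing the class of the unit makes the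
  section graded and unital at once.\<close>

lemma cohomology_section:
  fixes sc :: "'k::field \<Rightarrow> 'v::ab_group_add \<Rightarrow> 'v" and scH :: "'k \<Rightarrow> 'h::ab_group_add \<Rightarrow> 'h"
  assumes grG: "graded_vs sc G" and K: "graded_map sc G sc G 1 K"
    and coh: "is_cohomology sc G K scH GH pr"
    and one: "one \<in> G 0" "K one = 0" "pr one \<noteq> 0"
  obtains s where "lin scH sc s" "\<And>i h. h \<in> GH i \<Longrightarrow> s h \<in> G i" "\<And>h. K (s h) = 0"
    "\<And>h. pr (s h) = h" "s (pr one) = one"
proof -
  have grH: "graded_vs scH GH" and prm: "graded_map sc G scH GH 0 pr"
    and surj: "\<And>h. \<exists>v. K v = 0 \<and> pr v = h"
    using coh unfolding is_cohomology_def by blast+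
  have linK: "lin sc sc K" and Kdeg: "\<And>i v. v \<in> G i \<Longrightarrow> K v \<in> G (i + 1)"
    using K by (auto simp: graded_map_def)
  have linpr: "lin sc scH pr" and prdeg: "\<And>i v. v \<in> G i \<Longrightarrow> pr v \<in> GH i"
    using prm by (auto simp: graded_map_def)
  have vsH: "vector_space scH" and vs: "vector_space sc" using lin_vs[OF linpr] by auto
  have lift: "\<exists>v. v \<in> G i \<and> K v = 0 \<and> pr v = h" if h: "h \<in> GH i" for h i
  proof -
    obtain w where w: "K w = 0" "pr w = h" using surj by blast
    obtain p where p: "lin sc sc p" "\<And>v. v \<in> G i \<Longrightarrow> p v = v" "\<And>j v. j \<noteq> i \<Longrightarrow> v \<in> G j \<Longrightarrow> p v = 0"
      "\<And>v. p v \<in> G i" by (rule component_projection[OF grG, of i]) (rule that)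
    obtain q where q: "lin sc sc q" "\<And>v. v \<in> G (i + 1) \<Longrightarrow> q v = v" "\<And>j v. j \<noteq> i + 1 \<Longrightarrow> v \<in> G j \<Longrightarrow> q v = 0"
      "\<And>v. q v \<in> G (i + 1)" by (rule component_projection[OF grG, of "i + 1"]) (rule that)
    obtain r where r: "lin scH scH r" "\<And>v. v \<in> GH i \<Longrightarrow> r v = v" "\<And>j v. j \<noteq> i \<Longrightarrow> v \<in> GH j \<Longrightarrow> r v = 0"
      "\<And>v. r v \<in> GH i" by (rule component_projection[OF grH, of i]) (rule that)
    \<comment> \<open>\<open>K\<close> raises the degree by one, so the projection matching
      \<open>p\<close> on the target is the one onto degree \<open>i + 1\<close>. Thus the degree
      \<open>i\<close> part of a cocycle is again a cocycle.\<close>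
    have "K (p w) = q (K w)"
    proof (rule lin_eq_on_graded[OF grG lin_comp[OF p(1) linK] lin_comp[OF linK q(1)]])
      fix j v assume v: "v \<in> G j"
      show "K (p v) = q (K v)"
        using p(2,3) q(2) q(3)[of "j + 1" "K v"] v Kdeg[OF v] lin_zero[OF linK] by (cases "j = i") auto
    qed
    moreover have "pr (p w) = r (pr w)"
    proof (rule lin_eq_on_graded[OF grG lin_comp[OF p(1) linpr] lin_comp[OF linpr r(1)]])
      fix j v assume v: "v \<in> G j"
      show "pr (p v) = r (pr v)"
        using p(2,3) r(2,3) v prdeg[OF v] lin_zero[OF linpr] by (cases "j = i") auto
    qed
    ultimately show ?thesis using w p(4) lin_zero[OF q(1)] r(2)[OF h] by metis
  qed
  interpret vector_space_pair scH sc using vsH vs by (simp add: vector_space_pair_def)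
  \<comment> \<open>The class of the unit enters the basis so that its lift can be prescribed.
    Extending it inside the union of the \<open>GH i\<close> keeps every basis vector
    homogeneous.\<close>
  have "vs1.independent {pr one}" using one(3) by simp
  then obtain B where B: "{pr one} \<subseteq> B" "B \<subseteq> (\<Union>i. GH i)" "vs1.independent B" "(\<Union>i. GH i) \<subseteq> vs1.span B"
    using vs1.maximal_independent_subset_extend[of "{pr one}" "\<Union>i. GH i"] prdeg[OF one(1)] by blast
  have span: "h \<in> vs1.span B" for h
  proof -
    obtain I f where "finite I" "\<And>i. f i \<in> GH i" "h = sum f I" by (rule graded_decomp[OF grH, of h]) (rule that)
    then show ?thesis using B(4) by (auto intro!: vs1.span_sum)
  qed
  define t where "t b = (if b = pr one then one else SOME v. \<exists>i. b \<in> GH i \<and> v \<in> G i \<and> K v = 0 \<and> pr v = b)" for b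
  have t: "\<exists>i. b \<in> GH i \<and> t b \<in> G i \<and> K (t b) = 0 \<and> pr (t b) = b" if b: "b \<in> B" for b
  proof (cases "b = pr one")
    case True
    then show ?thesis using one prdeg[OF one(1)] by (auto simp: t_def)
  next
    case False
    obtain i where "b \<in> GH i" using b B(2) by blast
    then have "\<exists>v i. b \<in> GH i \<and> v \<in> G i \<and> K v = 0 \<and> pr v = b" using lift by blast
    from someI_ex[OF this] show ?thesis using False by (simp add: t_def)
  qed
  define s where "s = construct B t"
  have lins: "lin scH sc s" unfolding s_def by (rule linear_construct[OF B(3)])
  have sB: "s b = t b" if "b \<in> B" for b unfolding s_def by (rule construct_basis[OF B(3) that])
  have "K (s h) = 0" for h
  proof -
    have "lin scH sc (\<lambda>h. 0)" using vsH vs by (simp add: lin_iff vector_space_simps(5)[OF vs])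
    from linear_eq_on[OF lin_comp[OF lins linK] this span] show ?thesis using t sB by metis
  qed
  moreover have "pr (s h) = h" for h
  proof -
    interpret HH: vector_space_pair scH scH using vsH by (simp add: vector_space_pair_def)
    have "lin scH scH (\<lambda>h. h)" using vsH by (simp add: lin_iff)
    from HH.linear_eq_on[OF lin_comp[OF lins linpr] this span] show ?thesis using t sB by metis
  qed
  moreover have "s h \<in> G i" if h: "h \<in> GH i" for h i
  proof -
    obtain p where p: "lin sc sc p" "\<And>v. v \<in> G i \<Longrightarrow> p v = v" "\<And>j v. j \<noteq> i \<Longrightarrow> v \<in> G j \<Longrightarrow> p v = 0"
      "\<And>v. p v \<in> G i" by (rule component_projection[OF grG, of i]) (rule that)
    obtain r where r: "lin scH scH r" "\<And>v. v \<in> GH i \<Longrightarrow> r v = v" "\<And>j v. j \<noteq> i \<Longrightarrow> v \<in> GH j \<Longrightarrow> r v = 0"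
      "\<And>v. r v \<in> GH i" by (rule component_projection[OF grH, of i]) (rule that)
    \<comment> \<open>Preservation of degree is not linear in form; commuting with the component
      projections is, so it can be checked on the basis.\<close>
    have "s (r h) = p (s h)"
    proof (rule linear_eq_on[OF lin_comp[OF r(1) lins] lin_comp[OF lins p(1)] span])
      fix b assume b: "b \<in> B"
      then obtain j where "b \<in> GH j" "t b \<in> G j" using t by blast
      then show "s (r b) = p (s b)"
        using sB[OF b] p(2,3) r(2,3) lin_zero[OF lins] by (cases "j = i") auto
    qed
    then show ?thesis using r(2)[OF h] p(4) by metis
  qed
  moreover have "s (pr one) = one" using sB[of "pr one"] B(1) by (simp add: t_def)
  ultimately show thesis using lins by (intro that[of s]) auto
qed

section \<open>The first order family\<close>

definition first_order :: "('k::field \<Rightarrow> 'v::ab_group_add \<Rightarrow> 'v) \<Rightarrow> ('h \<Rightarrow> 'k) \<Rightarrow> ('h \<Rightarrow> 'v) \<Rightarrow> 'v \<Rightarrow> 'h list \<Rightarrow> 'v" where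
  "first_order sc e u one xs = (\<Sum>i<length xs. sc (\<Prod>j\<in>{..<length xs} - {i}. e (xs ! j)) (u (xs ! i)))
     + sc (\<Prod>j<length xs. e (xs ! j)) one"

lemma first_order_snoc:
  assumes "vector_space sc" "e x = 1" "u x = 0"
  shows "first_order sc e u one (xs @ [x]) = first_order sc e u one xs"
proof -
  let ?n = "length xs"
  have "(\<Sum>i<?n. sc (\<Prod>j\<in>{..<Suc ?n} - {i}. e ((xs @ [x]) ! j)) (u ((xs @ [x]) ! i)))
    = (\<Sum>i<?n. sc (\<Prod>j\<in>{..<?n} - {i}. e (xs ! j)) (u (xs ! i)))"
  proof (intro sum.cong refl)
    fix i assume i: "i \<in> {..<?n}"
    then have eq: "{..<Suc ?n} - {i} = insert ?n ({..<?n} - {i})" by auto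
    have "(\<Prod>j\<in>{..<Suc ?n} - {i}. e ((xs @ [x]) ! j)) = (\<Prod>j\<in>{..<?n} - {i}. e ((xs @ [x]) ! j))"
      unfolding eq using assms(2) by simp
    also have "\<dots> = (\<Prod>j\<in>{..<?n} - {i}. e (xs ! j))" by (intro prod.cong refl) (auto simp: nth_append)
    finally show "sc (\<Prod>j\<in>{..<Suc ?n} - {i}. e ((xs @ [x]) ! j)) (u ((xs @ [x]) ! i))
      = sc (\<Prod>j\<in>{..<?n} - {i}. e (xs ! j)) (u (xs ! i))" using i by (simp add: nth_append)
  qed
  moreover have "(\<Prod>j<?n. e ((xs @ [x]) ! j)) = (\<Prod>j<?n. e (xs ! j))"
    by (intro prod.cong refl) (simp add: nth_append)
  ultimately show ?thesis
    using assms vector_space_simps(5)[OF assms(1)] by (simp add: first_order_def)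
qed

lemma lin_plus_fun: "lin s1 s2 f \<Longrightarrow> lin s1 s2 g \<Longrightarrow> lin s1 s2 (\<lambda>x. f x + g x)"
  \<comment> \<open>The sum is \<open>f - (0 - g)\<close>, with the zero map obtained as
    \<open>g - g\<close>.\<close>
  using lin_minus_fun[of s1 s2 f "\<lambda>x. - g x"] lin_minus_fun[of s1 s2 "\<lambda>x. g x - g x" g] lin_minus_fun[of s1 s2 g g]
  by simp

text \<open>The formula is invariant under permutations without any sign. Since \<open>e\<close>
  vanishes outside degree 0, a nonzero term has at most one argument of nonzero degree, namely the
  one under \<open>u\<close>; this gives the total degree. If two odd neighbours are exchanged,
  every term contains \<open>e\<close> of one of them, so both sides vanish.\<close>

lemma first_order_sym_family:
  fixes sc :: "'k::field \<Rightarrow> 'v::ab_group_add \<Rightarrow> 'v" and scH :: "'k \<Rightarrow> 'h::ab_group_add \<Rightarrow> 'h"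
  assumes grG: "graded_vs sc G" and e: "lin scH (*) e" "\<And>i h. i \<noteq> 0 \<Longrightarrow> h \<in> GH i \<Longrightarrow> e h = 0"
    and u: "lin scH sc u" "\<And>i h. h \<in> GH i \<Longrightarrow> u h \<in> G i" and one: "one \<in> G 0"
  shows "sym_family scH GH sc G 0 (first_order sc e u one)"
proof -
  let ?\<Phi> = "first_order sc e u one"
  have vs: "vector_space sc" and vsH: "vector_space scH" using lin_vs[OF u(1)] by auto
  have lin_e: "lin scH sc (\<lambda>v. sc (e v * a) w)" for a w
    unfolding lin_iff
    by (simp add: vs vsH lin_add[OF e(1)] lin_scale[OF e(1)] distrib_right vector_space_simps(2)[OF vs]
        vector_space_simps(3)[OF vs] mult.assoc)
  have prod_upd: "(\<Prod>k\<in>A. e (xs[j := v] ! k)) = e v * (\<Prod>k\<in>A - {j}. e (xs ! k))"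
    if "finite A" "j \<in> A" "j < length xs" for A xs j v
    using that by (simp add: prod.remove[of A j] nth_list_update)
  have ml: "lin scH sc (\<lambda>v. ?\<Phi> (xs[j := v]))" if j: "j < length xs" for xs j
  proof -
    let ?n = "length xs"
    have "lin scH sc (\<lambda>v. sc (\<Prod>k\<in>{..<?n} - {i}. e (xs[j := v] ! k)) (u (xs[j := v] ! i)))" if "i < ?n" for i
    proof (cases "i = j")
      case True
      have "(\<Prod>k\<in>{..<?n} - {i}. e (xs[j := v] ! k)) = (\<Prod>k\<in>{..<?n} - {i}. e (xs ! k))" for v
        using True by (intro prod.cong refl) auto
      then show ?thesis using True j lin_scale_fun[OF u(1)] by simp
    next
      case False
      then show ?thesis using j lin_e by (simp add: prod_upd)
    qed
    moreover have "lin scH sc (\<lambda>v. sc (\<Prod>k<?n. e (xs[j := v] ! k)) one)"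
      using j lin_e by (simp add: prod_upd)
    ultimately show ?thesis
      unfolding first_order_def by (auto intro!: lin_plus_fun lin_sum_fun vs vsH)
  qed
  have prod0: "(\<Prod>k\<in>A. e (xs ! k)) = 0" if "homog GH xs ds" "finite A" "k \<in> A" "k < length xs" "ds ! k \<noteq> 0" for xs ds A k
  proof -
    have "e (xs ! k) = 0" using that e(2)[of "ds ! k" "xs ! k"] by (simp add: homog_def)
    then show ?thesis using that by auto
  qed
  have deg: "?\<Phi> xs \<in> G (sum_list ds + 0)" if h: "homog GH xs ds" for xs ds
  proof -
    let ?n = "length xs"
    have len: "length ds = ?n" using h by (simp add: homog_def)
    have sl: "sum_list ds = (\<Sum>k<?n. ds ! k)" by (simp add: sum_list_sum_nth len lessThan_atLeast0)
    have "sc (\<Prod>k\<in>{..<?n} - {i}. e (xs ! k)) (u (xs ! i)) \<in> G (sum_list ds)" if i: "i < ?n" for i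
    proof (cases "\<exists>k\<in>{..<?n} - {i}. ds ! k \<noteq> 0")
      case True
      then have "(\<Prod>k\<in>{..<?n} - {i}. e (xs ! k)) = 0" using prod0[OF h, of "{..<?n} - {i}"] by blast
      then show ?thesis by (simp only: subspace_closed(1)[OF grG] vector_space_simps(6)[OF vs])
    next
      case False
      then have "sum_list ds = ds ! i" unfolding sl using i by (simp add: sum.remove[of _ i])
      then show ?thesis
        using u(2)[of "xs ! i" "ds ! i"] h i by (simp add: homog_def subspace_closed(3)[OF grG])
    qed
    moreover have "sc (\<Prod>k<?n. e (xs ! k)) one \<in> G (sum_list ds)"
    proof (cases "\<exists>k<?n. ds ! k \<noteq> 0")
      case True
      then have "(\<Prod>k<?n. e (xs ! k)) = 0" using prod0[OF h, of "{..<?n}"] by blast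
      then show ?thesis by (simp only: subspace_closed(1)[OF grG] vector_space_simps(6)[OF vs])
    next
      case False
      then have "sum_list ds = 0" unfolding sl by simp
      then show ?thesis using one by (simp add: subspace_closed(3)[OF grG])
    qed
    ultimately show ?thesis
      unfolding first_order_def add_0_right
      by (intro subspace_closed(2)[OF grG] subspace_closed(5)[OF grG]) auto
  qed
  have sym: "?\<Phi> (swap_adj j xs) = sc (of_int (ksign (ds ! j) (ds ! Suc j))) (?\<Phi> xs)"
    if h: "homog GH xs ds" and j: "Suc j < length xs" for xs ds j
  proof -
    let ?n = "length xs" and ?t = "adj_transp j"
    note img = adj_transp_image_atMost[OF j]
    have pr: "(\<Prod>k\<in>?t ` A. e (swap_adj j xs ! k)) = (\<Prod>k\<in>A. e (xs ! k))" if "A \<subseteq> {..<?n}" for A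
    proof -
      have "(\<Prod>k\<in>?t ` A. e (swap_adj j xs ! k)) = (\<Prod>k\<in>A. e (swap_adj j xs ! ?t k))"
        by (simp add: prod.reindex[OF inj_adj_transp])
      also have "\<dots> = (\<Prod>k\<in>A. e (xs ! k))"
        using that j adj_transp_less[OF j] by (intro prod.cong refl) (auto simp: nth_swap_adj)
      finally show ?thesis .
    qed
    have "(\<Sum>i<?n. sc (\<Prod>k\<in>{..<?n} - {i}. e (swap_adj j xs ! k)) (u (swap_adj j xs ! i)))
      = (\<Sum>i\<in>?t ` {..<?n}. sc (\<Prod>k\<in>?t ` {..<?n} - {i}. e (swap_adj j xs ! k)) (u (swap_adj j xs ! i)))"
      unfolding img ..
    also have "\<dots> = (\<Sum>i<?n. sc (\<Prod>k\<in>?t ` {..<?n} - {?t i}. e (swap_adj j xs ! k)) (u (swap_adj j xs ! ?t i)))"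
      by (simp add: sum.reindex[OF inj_adj_transp])
    also have "\<dots> = (\<Sum>i<?n. sc (\<Prod>k\<in>{..<?n} - {i}. e (xs ! k)) (u (xs ! i)))"
    proof (intro sum.cong refl)
      fix i assume i: "i \<in> {..<?n}"
      have "?t ` {..<?n} - {?t i} = ?t ` ({..<?n} - {i})"
        using inj_on_image_set_diff[OF inj_adj_transp[of j UNIV], of "{..<?n}" "{i}"] by simp
      then show "sc (\<Prod>k\<in>?t ` {..<?n} - {?t i}. e (swap_adj j xs ! k)) (u (swap_adj j xs ! ?t i))
        = sc (\<Prod>k\<in>{..<?n} - {i}. e (xs ! k)) (u (xs ! i))"
        using i j adj_transp_less[OF j] pr[of "{..<?n} - {i}"] by (simp add: nth_swap_adj)
    qed
    finally have "?\<Phi> (swap_adj j xs) = ?\<Phi> xs"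
      using pr[of "{..<?n}"] unfolding img by (simp add: first_order_def)
    moreover have "?\<Phi> xs = 0" if "ksign (ds ! j) (ds ! Suc j) \<noteq> 1"
    proof -
      have odd: "ds ! j \<noteq> 0" "ds ! Suc j \<noteq> 0" using that by (auto simp: ksign_def split: if_splits)
      have "(\<Prod>k\<in>{..<?n} - {i}. e (xs ! k)) = 0" for i
      proof (cases "i = j")
        case True
        then show ?thesis using j odd by (intro prod0[OF h, of _ "Suc j"]) auto
      next
        case False
        then show ?thesis using j odd by (intro prod0[OF h, of _ j]) auto
      qed
      moreover have "(\<Prod>k<?n. e (xs ! k)) = 0" using j odd by (intro prod0[OF h, of _ j]) auto
      ultimately show ?thesis
        unfolding first_order_def by (simp only: vector_space_simps(6)[OF vs] sum.neutral_const add_0)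
    qed
    ultimately show ?thesis
      by (cases "ksign (ds ! j) (ds ! Suc j) = 1") (simp_all add: vector_space_simps(4,5)[OF vs])
  qed
  show ?thesis
    unfolding sym_family_def sym_map_def using ml deg sym by auto
qed

theorem theorem6p2:
  fixes sc :: "'k::field_char_0 \<Rightarrow> 'v::ab_group_add \<Rightarrow> 'v" and G :: "int \<Rightarrow> 'v set"
    and one :: 'v and M :: "'v list \<Rightarrow> 'v" and K :: "'v \<Rightarrow> 'v"
    and c :: "'v \<Rightarrow> 'k" and lK :: "'v list \<Rightarrow> 'v"
    and scH :: "'k \<Rightarrow> 'h::ab_group_add \<Rightarrow> 'h" and GH :: "int \<Rightarrow> 'h set" and pr :: "'v \<Rightarrow> 'h"
  assumes "homotopy_prob_alg sc G one M K"
    and "expectation sc G one K c"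
    and "is_descendant sc G M K lK"
    and "is_cohomology sc G K scH GH pr"
    and "pr one \<noteq> 0"
  shows "\<exists>\<phi> :: 'h list \<Rightarrow> 'v.
           unital_sLinf_morphism scH GH (pr one) (\<lambda>_. 0) sc G one lK \<phi>
         \<and> (\<forall>h. K (\<phi> [h]) = 0 \<and> pr (\<phi> [h]) = h)"
proof -
  have grG: "graded_vs sc G" and one: "one \<in> G 0" "K one = 0" and M: "sym_family sc G sc G 0 M"
    and M1: "\<And>x. M [x] = x" and Mone: "\<And>xs. xs \<noteq> [] \<Longrightarrow> M (xs @ [one]) = M xs"
    and K: "graded_map sc G sc G 1 K"
    using assms(1) unfolding homotopy_prob_alg_def by blast+
  have c: "lin sc (*) c" "\<And>i v. i \<noteq> 0 \<Longrightarrow> v \<in> G i \<Longrightarrow> c v = 0" "c one = 1"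
    using assms(2) unfolding expectation_def by blast+
  have grH: "graded_vs scH GH" and prdeg: "\<And>v. v \<in> G 0 \<Longrightarrow> pr v \<in> GH 0"
    using assms(4)[unfolded is_cohomology_def, THEN conjunct1]
      assms(4)[unfolded is_cohomology_def, THEN conjunct2, THEN conjunct1]
    by (auto simp: graded_map_def)
  have linK: "lin sc sc K" using K by (simp add: graded_map_def)
  have vs: "vector_space sc" using lin_vs[OF linK] by simp
  obtain s where s: "lin scH sc s" "\<And>i h. h \<in> GH i \<Longrightarrow> s h \<in> G i" "\<And>h. K (s h) = 0"
    "\<And>h. pr (s h) = h" "s (pr one) = one"
    using cohomology_section[OF grG K assms(4) one assms(5)] by blast
  define e where "e h = c (s h)" for h
  \<comment> \<open>Removing the multiple of the unit makes \<open>u\<close> vanish on the class of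
    the unit. In arity one the two parts of \<open>\<Phi>\<close> add up to \<open>s\<close> again,
    so the first component of the morphism is the section itself.\<close>
  define u where "u h = s h - sc (e h) one" for h
  define \<Phi> where "\<Phi> = first_order sc e u one"
  have e: "lin scH (*) e" "\<And>i h. i \<noteq> 0 \<Longrightarrow> h \<in> GH i \<Longrightarrow> e h = 0" "e (pr one) = 1"
    using lin_comp[OF s(1) c(1)] c(2) s(2,5) c(3) by (auto simp: e_def[abs_def])
  have vsH: "vector_space scH" using lin_vs[OF s(1)] by simp
  have "lin scH sc (\<lambda>h. sc (e h) one)"
    unfolding lin_iff
    by (simp add: vs vsH lin_add[OF e(1)] lin_scale[OF e(1)] vector_space_simps(2)[OF vs] vector_space_simps(3)[OF vs])
  from lin_minus_fun[OF s(1) this] have u1: "lin scH sc u" by (simp add: u_def[abs_def])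
  have u2: "u h \<in> G i" if "h \<in> GH i" for h i
  proof (cases "i = 0")
    case True
    then show ?thesis using s(2)[OF that] one(1) unfolding u_def by (intro subspace_closed[OF grG]) auto
  next
    case False
    then show ?thesis using s(2)[OF that] e(2)[OF False that] by (simp add: u_def vector_space_simps(6)[OF vs])
  qed
  have u_one: "u (pr one) = 0" using s(5) e(3) by (simp add: u_def vector_space_simps(4)[OF vs])
  have \<Phi>sym: "sym_family scH GH sc G 0 \<Phi>"
    unfolding \<Phi>_def by (rule first_order_sym_family[OF grG e(1,2) u1 u2 one(1)])
  have \<Phi>one: "\<Phi> (xs @ [pr one]) = \<Phi> xs" for xs
    unfolding \<Phi>_def by (rule first_order_snoc[where e = e and u = u, OF vs e(3) u_one])
  have \<Phi>1: "\<Phi> [h] = s h" for h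
    by (simp add: \<Phi>_def first_order_def u_def vector_space_simps(4)[OF vs] lessThan_Suc)
  have "K (u h) = 0" for h
    using s(3) one(2) by (simp add: u_def lin_diff[OF linK] lin_scale[OF linK] vector_space_simps(5)[OF vs])
  then have K\<Phi>: "K (\<Phi> xs) = 0" for xs
    using one(2) by (simp add: \<Phi>_def first_order_def lin_add[OF linK] lin_sum[OF linK] lin_scale[OF linK]
        vector_space_simps(5)[OF vs])
  have ml: "multilin s1 s2 n f" if "sym_family s1 G1 s2 G2 0 f" "1 \<le> n"
    for s1 :: "'k \<Rightarrow> 'a::ab_group_add \<Rightarrow> 'a" and s2 :: "'k \<Rightarrow> 'b::ab_group_add \<Rightarrow> 'b" and G1 G2 n f
    using that by (simp add: sym_family_def sym_map_def multilin_def)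
  obtain \<phi> where \<phi>: "\<And>n. 1 \<le> n \<Longrightarrow> multilin scH sc n \<phi>"
    "\<And>xs ds. xs \<noteq> [] \<Longrightarrow> homog GH xs ds \<Longrightarrow> outer_sum sc ds xs M \<phi> = \<Phi> xs"
    using exists_compositional_preimage[OF grH vs ml[OF M] M1 ml[OF \<Phi>sym]] by blast
  interpret compositional_preimage scH GH sc G M \<Phi> \<phi>
    by unfold_locales (use grH grG M M1 \<Phi>sym \<phi> in auto)
  have "outer_sum sc ds xs lK \<phi> = inner_sum sc ds xs \<phi> (\<lambda>_. 0)" if xs: "xs \<noteq> []" "homog GH xs ds" for xs ds
  proof -
    have "outer_sum sc ds xs lK \<phi> = 0"
      unfolding outer_sum_eq
      using xs by (intro descendant_outer_sum_zero[OF K assms(3) K\<Phi> xs(2)]) auto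
    \<comment> \<open>The distinguished argument is a value of the zero structure on cohomology, so
      multilinearity kills every term on the right-hand side of the morphism equation.\<close>
    moreover have "\<phi> (inner_args xs bs i (\<lambda>_. 0)) = 0" if i: "i < length bs" for bs i
    proof (rule multilin_zero[OF \<phi>(1)])
      show "i < length (inner_args xs bs i (\<lambda>_. 0))" using i by (simp add: inner_args_def)
      then show "1 \<le> length (inner_args xs bs i (\<lambda>_. 0))" by simp
      show "inner_args xs bs i (\<lambda>_. 0) ! i = 0" using i by (simp add: inner_args_def)
    qed
    then have "inner_sum sc ds xs \<phi> (\<lambda>_. 0) = 0"
      unfolding inner_sum_def by (intro sum.neutral) (auto simp: vector_space_simps(5)[OF vs])
    ultimately show ?thesis by simp
  qed
  moreover have "\<phi> (xs @ [pr one]) = 0" if "xs \<noteq> []" for xs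
    by (rule \<phi>_unit[OF prdeg[OF one(1)] Mone \<Phi>one _ that]) (simp_all add: \<Phi>1 s(5))
  ultimately have "unital_sLinf_morphism scH GH (pr one) (\<lambda>_. 0) sc G one lK \<phi>"
    using \<phi>_sym_family \<phi>_single \<Phi>1 s(5) by (simp add: unital_sLinf_morphism_def)
  moreover have "K (\<phi> [h]) = 0 \<and> pr (\<phi> [h]) = h" for h
    using \<phi>_single \<Phi>1 s(3,4) by simp
  ultimately show ?thesis by blast
qed

end
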